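(* Let $\{\phi_k\}_{k\in\mathbb N}$ be an essentially bounded orthonormal system on a probability space $(\Omega,\Sigma,\nu)$. Then there is a constant $C>0$, depending only on this orthonormal system, such that for every $n\in\mathbb N$, every real $n\times n$ matrix $\mathbf A$ with $\det\mathbf A\neq 0$, every integer $r$ with $\frac23 n\le r\le n$, and every $2\le p<\infty$, $$\min_{L_r\in\mathbb G(r,n)}\ \mathrm{rad}\left(\mathbf A B^n_{(\mathrm J,p)}\cap L_r\ \middle|\ B^n_{(\mathrm J,1)}\cap L_r\right)\ \ge\ C\,\varrho_n\,\left(\mathbf E\left[\|\cdot\|_{B^n_{(\mathrm J,p)}}\right]\right)^{-\frac32},$$ where $\varrho_n=\left(\rho\left((\mathbf A^{-1})^*\mathbf A^{-1}\right)\right)^{-1/2}$ and $\rho\left((\mathbf A^{-1})^*\mathbf A^{-1}\right)=\max\{|\sigma_k| : 1\le k\le n\}$ is the spectral radius of $(\mathbf A^{-1})^*\mathbf A^{-1}$, whose eigenvalues are $\sigma_1,\dots,\sigma_n$.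
   Context: $(\Omega,\Sigma,\nu)$ is a probability space, $L_p=L_p(\Omega,\Sigma,\nu)$ is the usual space of real-valued functions with norm $\|\cdot\|_p$, and orthonormality is with respect to $[f,g]=\int_\Omega fg\,d\nu$. The functions $\phi_k:\Omega\to\mathbb R$, $k\in\mathbb N$, belong to $L_\infty$ and form an orthonormal system. Essentially bounded: the orthonormal system $\{\phi_k\}$ is called essentially bounded if for every $0<c<1$ there is $M>0$ depending only on $c$ such that for every $n\in\mathbb N$ there is a set of orthonormal functions $\{\xi_k\}_{1\le k\le m}$, $m\ge cn$, with $\mathrm{lin}\{\xi_1,\dots,\xi_m\}\subset\mathrm{lin}\{\phi_1,\dots,\phi_n\}$ and $\max_{1\le k\le m}\|\xi_k\|_\infty\le M$. For $\alpha=(\alpha_1,\dots,\alpha_n)\in\mathbb R^n$ put $\mathrm J\alpha=t^\alpha=\sum_{k=1}^n\alpha_k\phi_k$ and $\|\alpha\|_{(\mathrm J,p)}=\|t^\alpha\|_p$. The set $B^n_{(\mathrm J,p)}=\{\alpha\in\mathbb R^n:\|\alpha\|_{(\mathrm J,p)}\le1\}$ is the corresponding unit ball. For an origin-symmetric convex body $V$, $\|\cdot\|_V$ denotes the norm with unit ball $V$ (so $\|\cdot\|_{B^n_{(\mathrm J,p)}}=\|\cdot\|_{(\mathrm J,p)}$). $\mathbf E[\|\cdot\|_V]=\int_{\mathbb S^{n-1}}\|\alpha\|_V\,d\mu(\alpha)$, where $\mu$ is the normalized rotation-invariant (Haar) measure on the Euclidean unit sphere $\mathbb S^{n-1}\subset\mathbb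 R^n$. $\mathbb G(r,n)$ is the Grassmannian of $r$-dimensional linear subspaces of $\mathbb R^n$. The radius is $\mathrm{rad}(V|W)=\sup\{\|\alpha\|_W:\alpha\in V\}$; for sections by $L_r$ the norm $\|\cdot\|_W$ is the one on $L_r$ with unit ball $W$, so that $\mathrm{rad}(\mathbf A B^n_{(\mathrm J,p)}\cap L_r\,|\,B^n_{(\mathrm J,1)}\cap L_r)=\sup\{\|\alpha\|_{(\mathrm J,1)}:\alpha\in\mathbf A B^n_{(\mathrm J,p)}\cap L_r\}$. *)

theory Defs
  imports
    "HOL-Probability.Probability"
    "HOL-Probability.Essential_Supremum"
    "Jordan_Normal_Form.Gauss_Jordan_Elimination"
    "Jordan_Normal_Form.Spectral_Radius"
    "Jordan_Normal_Form.VS_Connect"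
begin

section \<open>Function spaces and orthonormal systems\<close>

text \<open>Functions are treated pointwise; sequences are indexed from 0, so that the first \<open>n\<close>
  members of a system \<open>\<phi>\<close> are \<open>\<phi> 0, \<dots>, \<phi> (n - 1)\<close>.\<close>

definition Linf_norm :: "'a measure \<Rightarrow> ('a \<Rightarrow> real) \<Rightarrow> ereal" where
  "Linf_norm M f = esssup M (\<lambda>x. ereal \<bar>f x\<bar>)"

definition Linf :: "'a measure \<Rightarrow> ('a \<Rightarrow> real) set" where
  "Linf M = {f. f \<in> borel_measurable M \<and> Linf_norm M f < \<infinity>}"

definition Lp_norm :: "'a measure \<Rightarrow> real \<Rightarrow> ('a \<Rightarrow> real) \<Rightarrow> real" where
  "Lp_norm M p f = (\<integral>x. \<bar>f x\<bar> powr p \<partial>M) powr (1 / p)"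

definition orthonormal_on :: "'a measure \<Rightarrow> nat set \<Rightarrow> (nat \<Rightarrow> 'a \<Rightarrow> real) \<Rightarrow> bool" where
  "orthonormal_on M I f \<longleftrightarrow>
     (\<forall>i\<in>I. \<forall>j\<in>I. (\<integral>x. f i x * f j x \<partial>M) = (if i = j then 1 else 0))"

definition lin :: "(nat \<Rightarrow> 'a \<Rightarrow> real) \<Rightarrow> nat \<Rightarrow> ('a \<Rightarrow> real) set" where
  "lin f n = {g. \<exists>a :: nat \<Rightarrow> real. g = (\<lambda>x. \<Sum>k<n. a k * f k x)}"

definition essentially_bounded :: "'a measure \<Rightarrow> (nat \<Rightarrow> 'a \<Rightarrow> real) \<Rightarrow> bool" where
  "essentially_bounded M \<phi> \<longleftrightarrow>
     (\<forall>c::real. 0 < c \<and> c < 1 \<longrightarrow>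
        (\<exists>B::real. B > 0 \<and>
          (\<forall>n\<ge>1. \<exists>m \<xi>. real m \<ge> c * real n \<and> orthonormal_on M {..<m} \<xi>
              \<and> lin \<xi> m \<subseteq> lin \<phi> n \<and> (\<forall>k<m. Linf_norm M (\<xi> k) \<le> ereal B))))"


section \<open>The norms induced on \<open>\<real>\<^sup>n\<close>\<close>

definition J :: "(nat \<Rightarrow> 'a \<Rightarrow> real) \<Rightarrow> real vec \<Rightarrow> 'a \<Rightarrow> real" where
  "J \<phi> \<alpha> = (\<lambda>x. \<Sum>k<dim_vec \<alpha>. vec_index \<alpha> k * \<phi> k x)"

definition J_norm :: "'a measure \<Rightarrow> (nat \<Rightarrow> 'a \<Rightarrow> real) \<Rightarrow> real \<Rightarrow> real vec \<Rightarrow> real" where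
  "J_norm M \<phi> p \<alpha> = Lp_norm M p (J \<phi> \<alpha>)"

definition J_ball :: "'a measure \<Rightarrow> (nat \<Rightarrow> 'a \<Rightarrow> real) \<Rightarrow> nat \<Rightarrow> real \<Rightarrow> real vec set" where
  "J_ball M \<phi> n p = {\<alpha> \<in> carrier_vec n. J_norm M \<phi> p \<alpha> \<le> 1}"


section \<open>Haar measure on the sphere\<close>

definition unit_sphere :: "nat \<Rightarrow> real vec set" where
  "unit_sphere n = {\<alpha> \<in> carrier_vec n. scalar_prod \<alpha> \<alpha> = 1}"

text \<open>The Borel sets of the sphere are the traces of the Borel sets of \<open>\<real>\<^sup>n\<close>, the latter given by
  the product \<open>\<sigma>\<close>-algebra on coordinate functions.\<close>

definition sphere_borel :: "nat \<Rightarrow> real vec measure" where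
  "sphere_borel n =
     vimage_algebra (unit_sphere n) (\<lambda>\<alpha>. \<lambda>i\<in>{..<n}. vec_index \<alpha> i) (\<Pi>\<^sub>M i\<in>{..<n}. (borel :: real measure))"

text \<open>For \<open>n \<ge> 1\<close> exactly one measure has this property.  Invariance is under the full orthogonal
  group, since for \<open>n = 1\<close> the special orthogonal group is trivial.\<close>

definition sphere_haar :: "nat \<Rightarrow> real vec measure \<Rightarrow> bool" where
  "sphere_haar n \<mu> \<longleftrightarrow>
     prob_space \<mu> \<and> space \<mu> = unit_sphere n \<and> sets \<mu> = sets (sphere_borel n) \<and>
     (\<forall>Q \<in> carrier_mat n n. transpose_mat Q * Q = 1\<^sub>m n \<longrightarrow>
        distr \<mu> \<mu> (\<lambda>\<alpha>. mult_mat_vec Q \<alpha>) = \<mu>)"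

definition sphere_mean :: "real vec measure \<Rightarrow> (real vec \<Rightarrow> real) \<Rightarrow> real" where
  "sphere_mean \<mu> N = (\<integral>\<alpha>. N \<alpha> \<partial>\<mu>)"


section \<open>Sections by subspaces\<close>

definition grassmannian :: "nat \<Rightarrow> nat \<Rightarrow> real vec set set" where
  "grassmannian r n =
     {L. subspace class_ring L (module_vec TYPE(real) n) \<and>
         vectorspace.dim class_ring ((module_vec TYPE(real) n)\<lparr>carrier := L\<rparr>) = r}"

text \<open>The reference body \<open>W\<close> enters through its norm \<open>N\<close>.\<close>

definition rad :: "real vec set \<Rightarrow> (real vec \<Rightarrow> real) \<Rightarrow> real" where
  "rad V N = (SUP \<alpha>\<in>V. N \<alpha>)"

definition varrho :: "real mat \<Rightarrow> real" where
  "varrho A =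
     (let B = the (mat_inverse A)
      in spectral_radius (map_mat complex_of_real (transpose_mat B * B)) powr (- 1 / 2))"

end

theory Submission
  imports Defs "Jordan_Normal_Form.DL_Rank"
begin

text \<open>
  Let \<open>B\<close> be the inverse of \<open>A\<close> and let \<open>\<parallel>\<alpha>\<parallel>\<^sub>p\<close> be the norm that \<open>L\<^sub>p\<close> induces on \<open>\<real>\<^sup>n\<close>. The
  section of \<open>A B\<^sub>p\<close> by \<open>L\<close> consists of those \<open>\<alpha>\<close> in \<open>L\<close> with \<open>\<parallel>B \<alpha>\<parallel>\<^sub>p \<le> 1\<close>, so its radius is the
  largest quotient \<open>\<parallel>\<alpha>\<parallel>\<^sub>1 / \<parallel>B \<alpha>\<parallel>\<^sub>p\<close> over \<open>L\<close>. A quotient that is large somewhere is found by comparing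
  averages: if \<open>P\<close> is the orthogonal projection onto \<open>L\<close> and \<open>\<alpha>\<close> is uniformly distributed on the
  sphere, then some value of \<open>P \<alpha>\<close> has a quotient at least as large as the quotient of the means of
  \<open>\<parallel>P \<alpha>\<parallel>\<^sub>1\<close> and \<open>\<parallel>B P \<alpha>\<parallel>\<^sub>p\<close>.

  Let \<open>\<beta>\<close> be the spectral radius of \<open>B\<^sup>T B\<close>, so that \<open>varrho A\<close> is \<open>1 / sqrt \<beta>\<close> and
  \<open>|B x|\<^sup>2 \<le> \<beta> |x|\<^sup>2\<close> (\<open>spectral_radius_bounds_norm\<close>). The mean in the denominator is at most
  \<open>sqrt \<beta> * E\<close>, where \<open>E\<close> is the mean of \<open>\<parallel>\<alpha>\<parallel>\<^sub>p\<close> (\<open>mean_mult_projection_le\<close>,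
  \<open>mean_le_operator_norm\<close>). Indeed, by convexity and invariance of the measure, replacing a matrix
  \<open>T\<close> by \<open>T G\<close>, where \<open>G\<close> is a mixture of the identity and an orthogonal matrix, cannot increase the
  mean of \<open>\<parallel>T \<alpha>\<parallel>\<^sub>p\<close>. A projection is such a mixture; and \<open>B\<close> is reached from \<open>sqrt \<beta>\<close> times an
  orthogonal matrix by finitely many such steps, one for each square in a decomposition of the
  quadratic form \<open>\<beta> |x|\<^sup>2 - |B\<^sup>T x|\<^sup>2\<close>.

  The mean in the numerator is bounded below by a constant (\<open>mean_J_norm_1_projection_ge\<close>). Write
  \<open>f(x)\<close> for the vector \<open>(\<phi>\<^sub>k(x))\<close>. Then \<open>\<parallel>P \<alpha>\<parallel>\<^sub>1\<close> is the integral of \<open>|\<alpha> \<bullet> P f(x)|\<close>, and averaging over \<open>\<alpha>\<close>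
  first gives at least \<open>|P f(x)|\<close> times a multiple of \<open>n\<^sup>-\<^sup>1\<^sup>/\<^sup>2\<close>, by the second and fourth moments of
  linear forms on the sphere. Essential boundedness provides a projection \<open>R\<close> of rank \<open>m \<ge> 2n/3\<close>
  with \<open>|R f(x)| \<le> K n\<^sup>1\<^sup>/\<^sup>2\<close> almost everywhere, so \<open>|P f| \<ge> (P f \<bullet> R f) / (K n\<^sup>1\<^sup>/\<^sup>2)\<close>; and the integral
  of \<open>P f \<bullet> R f\<close> is the trace of \<open>P R\<close>, which is at least \<open>r + m - n \<ge> n/3\<close> (\<open>frame_overlap\<close>).

  Together the radius is at least \<open>C * varrho A / E\<close> for a constant \<open>C\<close>. As \<open>p \<ge> 2\<close>, the norm \<open>\<parallel>\<alpha>\<parallel>\<^sub>p\<close> dominates the Euclidean one,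
  so \<open>E \<ge> 1\<close> and \<open>E\<^sup>-\<^sup>1 \<ge> E\<^sup>-\<^sup>3\<^sup>/\<^sup>2\<close>. That the minimum over the Grassmannian is attained follows from
  compactness of the set of orthonormal \<open>r\<close>-frames and lower semicontinuity of the radius
  (\<open>section_rad_attains_minimum\<close>).
\<close>

text \<open>Entries and scalar products are those of vectors of variable dimension, so the competing
  notations for fixed-dimensional Euclidean spaces are switched off.\<close>
unbundle no inner_syntax
unbundle no vec_syntax

section \<open>Orthonormal frames and reflections\<close>

lemma scalar_prod_self_sum:
  fixes x :: "real vec"
  assumes "x \<in> carrier_vec n"
  shows "x \<bullet> x = (\<Sum>i<n. (x $ i)\<^sup>2)"
  using assms by (auto simp: scalar_prod_def power2_eq_square atLeast0LessThan)

lemma scalar_prod_self_nonneg: "0 \<le> (x :: real vec) \<bullet> x"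
  using scalar_prod_self_sum[of x "dim_vec x"] by (simp add: sum_nonneg)

lemma scalar_prod_self_eq_0D:
  fixes x :: "real vec"
  assumes "x \<in> carrier_vec n" "x \<bullet> x = 0"
  shows "x = 0\<^sub>v n"
proof -
  have "(\<Sum>i<n. (x $ i)\<^sup>2) = 0" using assms scalar_prod_self_sum by metis
  then have "\<forall>i<n. x $ i = 0" by (subst (asm) sum_nonneg_eq_0_iff) auto
  then show ?thesis using assms(1) by (intro eq_vecI) auto
qed

lemma scalar_prod_self_pos:
  fixes x :: "real vec"
  assumes "x \<in> carrier_vec n" "x \<noteq> 0\<^sub>v n"
  shows "0 < x \<bullet> x"
  using scalar_prod_self_eq_0D[OF assms(1)] scalar_prod_self_nonneg[of x] assms(2) by fastforce

lemma scalar_prod_Cauchy_Schwarz: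
  fixes x y :: "real vec"
  assumes "x \<in> carrier_vec n" "y \<in> carrier_vec n"
  shows "(x \<bullet> y)\<^sup>2 \<le> (x \<bullet> x) * (y \<bullet> y)"
  using Cauchy_Schwarz_ineq_sum[of "\<lambda>i. x $ i" "\<lambda>i. y $ i" "{..<n}"] assms
  by (simp add: scalar_prod_self_sum[OF assms(1)] scalar_prod_self_sum[OF assms(2)])
     (simp add: scalar_prod_def atLeast0LessThan)

lemma scalar_prod_self_combination:
  fixes x y :: "real vec"
  assumes "x \<in> carrier_vec n" "y \<in> carrier_vec n"
  shows "(x + c \<cdot>\<^sub>v y) \<bullet> (x + c \<cdot>\<^sub>v y) = x \<bullet> x + 2 * c * (y \<bullet> x) + c\<^sup>2 * (y \<bullet> y)"
proof -
  have "(x + c \<cdot>\<^sub>v y) \<bullet> (x + c \<cdot>\<^sub>v y) = x \<bullet> x + c * (y \<bullet> x) + (c * (x \<bullet> y) + c * (c * (y \<bullet> y)))"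
    using assms by (simp add: scalar_prod_add_distrib[of _ n] add_scalar_prod_distrib[of _ n] algebra_simps)
  then show ?thesis using comm_scalar_prod[OF assms] by (simp add: algebra_simps power2_eq_square)
qed

lemma minus_eq_plus_smult:
  fixes x y :: "real vec"
  assumes "x \<in> carrier_vec n" "y \<in> carrier_vec n"
  shows "x - y = x + (-1) \<cdot>\<^sub>v y"
  using assms by (intro eq_vecI) auto

text \<open>The columns of a frame are an orthonormal family of \<open>r\<close> vectors in \<open>\<real>\<^sup>n\<close>. Thus \<open>U * U\<^sup>T\<close> is the
  orthogonal projection onto their span, and for \<open>r = n\<close> a frame is an orthogonal matrix.\<close>
definition frame :: "nat \<Rightarrow> nat \<Rightarrow> real mat \<Rightarrow> bool" where
  "frame n r U \<longleftrightarrow> U \<in> carrier_mat n r \<and> U\<^sup>T * U = 1\<^sub>m r"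

lemma frame_carrier: "frame n r U \<Longrightarrow> U \<in> carrier_mat n r"
  by (simp add: frame_def)

lemma scalar_prod_transpose:
  fixes A :: "real mat"
  assumes "A \<in> carrier_mat n r" "x \<in> carrier_vec n" "y \<in> carrier_vec r"
  shows "x \<bullet> (A *\<^sub>v y) = (A\<^sup>T *\<^sub>v x) \<bullet> y"
  using transpose_vec_mult_scalar[OF assms(1,3,2)] by simp

lemma frame_transpose_mult:
  assumes "frame n r U" "x \<in> carrier_vec r"
  shows "U\<^sup>T *\<^sub>v (U *\<^sub>v x) = x"
  using assms assoc_mult_mat_vec[of "U\<^sup>T" r n U r x] by (auto simp: frame_def)

lemma frame_isometry:
  assumes "frame n r U" "x \<in> carrier_vec r" "y \<in> carrier_vec r"
  shows "(U *\<^sub>v x) \<bullet> (U *\<^sub>v y) = x \<bullet> y"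
  using assms frame_transpose_mult[OF assms(1,2)] scalar_prod_transpose[of U n r "U *\<^sub>v x" y]
  by (auto simp: frame_def)

text \<open>Pythagoras for the decomposition of \<open>y\<close> into its projection \<open>U (U\<^sup>T y)\<close>, of length \<open>|U\<^sup>T y|\<close>, and the
  remainder.\<close>
lemma frame_residual:
  assumes "frame n r U" "y \<in> carrier_vec n"
  shows "(y - U *\<^sub>v (U\<^sup>T *\<^sub>v y)) \<bullet> (y - U *\<^sub>v (U\<^sup>T *\<^sub>v y)) = y \<bullet> y - (U\<^sup>T *\<^sub>v y) \<bullet> (U\<^sup>T *\<^sub>v y)"
proof -
  have U: "U \<in> carrier_mat n r" using assms(1) by (rule frame_carrier)
  define a where "a = U\<^sup>T *\<^sub>v y"
  have a: "a \<in> carrier_vec r" using U assms by (auto simp: a_def)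
  have Ua: "U *\<^sub>v a \<in> carrier_vec n" using U a by auto
  have "(U *\<^sub>v a) \<bullet> y = a \<bullet> a"
    using scalar_prod_transpose[OF U assms(2) a] comm_scalar_prod[OF Ua assms(2)] by (simp add: a_def)
  then show ?thesis
    unfolding a_def[symmetric] minus_eq_plus_smult[OF assms(2) Ua]
      scalar_prod_self_combination[OF assms(2) Ua] frame_isometry[OF assms(1) a a] by simp
qed

lemma Bessel_inequality:
  assumes "frame n r U" "y \<in> carrier_vec n"
  shows "(U\<^sup>T *\<^sub>v y) \<bullet> (U\<^sup>T *\<^sub>v y) \<le> y \<bullet> y"
  using frame_residual[OF assms] scalar_prod_self_nonneg[of "y - U *\<^sub>v (U\<^sup>T *\<^sub>v y)"] by simp

text \<open>Polarization recovers the scalar products of the columns from lengths.\<close>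
lemma frameI_isometry:
  assumes Q: "Q \<in> carrier_mat n r"
    and iso: "\<And>x. x \<in> carrier_vec r \<Longrightarrow> (Q *\<^sub>v x) \<bullet> (Q *\<^sub>v x) = x \<bullet> x"
  shows "frame n r Q"
proof -
  have pol: "(Q *\<^sub>v x) \<bullet> (Q *\<^sub>v y) = x \<bullet> y" if "x \<in> carrier_vec r" "y \<in> carrier_vec r" for x y
  proof -
    have Qx: "Q *\<^sub>v x \<in> carrier_vec n" and Qy: "Q *\<^sub>v y \<in> carrier_vec n" using Q that by auto
    have "(Q *\<^sub>v (y + 1 \<cdot>\<^sub>v x)) \<bullet> (Q *\<^sub>v (y + 1 \<cdot>\<^sub>v x)) = (y + 1 \<cdot>\<^sub>v x) \<bullet> (y + 1 \<cdot>\<^sub>v x)"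
      by (rule iso) (use that in auto)
    moreover have "Q *\<^sub>v (y + 1 \<cdot>\<^sub>v x) = Q *\<^sub>v y + 1 \<cdot>\<^sub>v (Q *\<^sub>v x)"
      using that by (simp add: mult_add_distrib_mat_vec[OF Q])
    ultimately show ?thesis
      using scalar_prod_self_combination[OF that(2,1), of 1] scalar_prod_self_combination[OF Qy Qx, of 1]
        iso[OF that(1)] iso[OF that(2)] by simp
  qed
  have "Q\<^sup>T * Q = 1\<^sub>m r"
  proof (rule eq_matI)
    fix i j assume "i < dim_row (1\<^sub>m r)" "j < dim_col (1\<^sub>m r)"
    then have ij: "i < r" "j < r" by auto
    have "(Q\<^sup>T * Q) $$ (i, j) = col Q i \<bullet> col Q j" using ij Q by auto
    also have "\<dots> = (Q *\<^sub>v unit_vec r i) \<bullet> (Q *\<^sub>v unit_vec r j)"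
    proof -
      have "Q *\<^sub>v unit_vec r i = col Q i" if "i < r" for i
        using that Q by (intro eq_vecI) auto
      then show ?thesis using ij by simp
    qed
    also have "\<dots> = 1\<^sub>m r $$ (i, j)" using ij by (simp add: pol)
    finally show "(Q\<^sup>T * Q) $$ (i, j) = 1\<^sub>m r $$ (i, j)" .
  qed (use Q in auto)
  then show ?thesis using Q by (simp add: frame_def)
qed

definition reflection :: "real vec \<Rightarrow> real mat" where
  "reflection u = mat (dim_vec u) (dim_vec u)
     (\<lambda>(i, j). (if i = j then 1 else 0) - 2 / (u \<bullet> u) * (u $ i * u $ j))"

lemma reflection_carrier: "u \<in> carrier_vec n \<Longrightarrow> reflection u \<in> carrier_mat n n"
  by (auto simp: reflection_def)

lemma transpose_reflection: "(reflection u)\<^sup>T = reflection u"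
  by (rule eq_matI) (auto simp: reflection_def)

text \<open>The matrix is \<open>1 + s u u\<^sup>T\<close>.\<close>
lemma rank_one_update_mult:
  fixes u x :: "real vec"
  assumes "u \<in> carrier_vec n" "x \<in> carrier_vec n"
  shows "mat n n (\<lambda>(i, j). (if i = j then 1 else 0) + s * (u $ i * u $ j)) *\<^sub>v x = x + (s * (u \<bullet> x)) \<cdot>\<^sub>v u"
    (is "?A *\<^sub>v x = _")
proof (rule eq_vecI)
  fix i assume "i < dim_vec (x + (s * (u \<bullet> x)) \<cdot>\<^sub>v u)"
  then have i: "i < n" using assms by auto
  have "(?A *\<^sub>v x) $ i = (\<Sum>j<n. ((if i = j then 1 else 0) + s * (u $ i * u $ j)) * x $ j)"
    using i assms by (simp add: scalar_prod_def atLeast0LessThan)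
  also have "\<dots> = (\<Sum>j<n. (if i = j then x $ j else 0) + s * u $ i * (u $ j * x $ j))"
    by (intro sum.cong) (auto simp: algebra_simps)
  also have "\<dots> = (\<Sum>j<n. (if i = j then x $ j else 0)) + s * u $ i * (\<Sum>j<n. u $ j * x $ j)"
    by (simp add: sum.distrib sum_distrib_left)
  also have "(\<Sum>j<n. u $ j * x $ j) = u \<bullet> x" using assms by (simp add: scalar_prod_def atLeast0LessThan)
  finally show "(?A *\<^sub>v x) $ i = (x + (s * (u \<bullet> x)) \<cdot>\<^sub>v u) $ i" using i assms by simp
qed (use assms in auto)

lemma reflection_mult:
  assumes "u \<in> carrier_vec n" "x \<in> carrier_vec n"
  shows "reflection u *\<^sub>v x = x + (- 2 * (u \<bullet> x) / (u \<bullet> u)) \<cdot>\<^sub>v u"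
  using rank_one_update_mult[OF assms, of "- 2 / (u \<bullet> u)"] assms by (simp add: reflection_def)

lemma frame_reflection:
  assumes u: "u \<in> carrier_vec n" "u \<bullet> u \<noteq> 0"
  shows "frame n n (reflection u)"
proof (rule frameI_isometry[OF reflection_carrier[OF u(1)]])
  fix x :: "real vec" assume x: "x \<in> carrier_vec n"
  show "(reflection u *\<^sub>v x) \<bullet> (reflection u *\<^sub>v x) = x \<bullet> x"
    unfolding reflection_mult[OF u(1) x] scalar_prod_self_combination[OF x u(1)]
    using u(2) by (simp add: field_simps power2_eq_square)
qed

text \<open>The reflection in the hyperplane orthogonal to \<open>v - w\<close> exchanges \<open>v\<close> and \<open>w\<close>. The transpose is
  what appears when an orthogonal change of the random vector is moved to the other side of a
  scalar product.\<close>
lemma orthogonal_transitive_on_spheres: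
  assumes v: "v \<in> carrier_vec n" and w: "w \<in> carrier_vec n" and eq: "v \<bullet> v = w \<bullet> w"
  obtains Q where "frame n n Q" "Q\<^sup>T *\<^sub>v v = w"
proof (cases "v = w")
  case True
  then have "frame n n (1\<^sub>m n)" "(1\<^sub>m n)\<^sup>T *\<^sub>v v = w" using v by (auto simp: frame_def)
  then show ?thesis by (rule that)
next
  case False
  define u where "u = v - w"
  have u: "u \<in> carrier_vec n" using v w by (auto simp: u_def)
  have "u \<noteq> 0\<^sub>v n"
  proof
    assume "u = 0\<^sub>v n"
    then have "\<forall>i<n. v $ i = w $ i" using v w unfolding u_def vec_eq_iff by auto
    then show False using False v w by (auto simp: vec_eq_iff)
  qed
  then have pos: "u \<bullet> u > 0" using scalar_prod_self_pos u by blast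
  have wv: "w \<bullet> v = v \<bullet> w" using comm_scalar_prod v w by blast
  have uv: "u \<bullet> v = v \<bullet> v - v \<bullet> w" and uu: "u \<bullet> u = 2 * (v \<bullet> v - v \<bullet> w)"
    unfolding u_def using v w eq wv
    by (simp_all add: minus_scalar_prod_distrib[of _ n] scalar_prod_minus_distrib[of _ n])
  have c: "- 2 * (u \<bullet> v) / (u \<bullet> u) = -1" using uv uu pos by (simp add: field_simps)
  have "reflection u *\<^sub>v v = w"
    unfolding reflection_mult[OF u v] c using v w by (intro eq_vecI) (auto simp: u_def)
  then show ?thesis using that[of "reflection u"] frame_reflection[OF u] pos
    by (simp add: transpose_reflection)
qed

lemma frame_col_norm:
  assumes "frame n r U" "j < r"
  shows "col U j \<bullet> col U j = 1"
proof -
  have "col U j \<bullet> col U j = (U\<^sup>T * U) $$ (j, j)" using assms(2) frame_carrier[OF assms(1)] by auto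
  also have "\<dots> = 1" using assms by (simp add: frame_def)
  finally show ?thesis .
qed

text \<open>Both sides are the sum of the squares of all entries of \<open>W\<^sup>T D\<close>, taken by columns of \<open>W\<close> and by
  columns of \<open>D\<close>.\<close>
lemma sum_scalar_prod_transpose_cols:
  fixes D W :: "real mat"
  assumes D: "D \<in> carrier_mat n l" and W: "W \<in> carrier_mat n m"
  shows "(\<Sum>k<m. (D\<^sup>T *\<^sub>v col W k) \<bullet> (D\<^sup>T *\<^sub>v col W k)) = (\<Sum>i<l. (W\<^sup>T *\<^sub>v col D i) \<bullet> (W\<^sup>T *\<^sub>v col D i))"
proof -
  have "(\<Sum>k<m. (D\<^sup>T *\<^sub>v col W k) \<bullet> (D\<^sup>T *\<^sub>v col W k)) = (\<Sum>k<m. \<Sum>i<l. (col D i \<bullet> col W k)\<^sup>2)"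
    using D W by (intro sum.cong refl, subst scalar_prod_self_sum[of _ l]) auto
  also have "\<dots> = (\<Sum>i<l. \<Sum>k<m. (col W k \<bullet> col D i)\<^sup>2)"
    using D W by (subst sum.swap) (intro sum.cong refl, simp add: comm_scalar_prod[of _ n])
  also have "\<dots> = (\<Sum>i<l. (W\<^sup>T *\<^sub>v col D i) \<bullet> (W\<^sup>T *\<^sub>v col D i))"
    using D W by (intro sum.cong refl, subst scalar_prod_self_sum[of _ m]) auto
  finally show ?thesis .
qed

text \<open>The trace of the projection \<open>U U\<^sup>T\<close> is its rank.\<close>
lemma frame_trace:
  assumes "frame n r U"
  shows "(\<Sum>i<n. (U\<^sup>T *\<^sub>v unit_vec n i) \<bullet> (U\<^sup>T *\<^sub>v unit_vec n i)) = real r"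
proof -
  have "real r = (\<Sum>j<r. ((1\<^sub>m n)\<^sup>T *\<^sub>v col U j) \<bullet> ((1\<^sub>m n)\<^sup>T *\<^sub>v col U j))"
    using assms frame_carrier[OF assms] by (simp add: frame_col_norm)
  also have "\<dots> = (\<Sum>i<n. (U\<^sup>T *\<^sub>v col (1\<^sub>m n) i) \<bullet> (U\<^sup>T *\<^sub>v col (1\<^sub>m n) i))"
    by (rule sum_scalar_prod_transpose_cols) (use frame_carrier[OF assms] in auto)
  finally show ?thesis by simp
qed

lemma frame_le:
  assumes "frame n r U"
  shows "r \<le> n"
proof -
  have "real r = (\<Sum>i<n. (U\<^sup>T *\<^sub>v unit_vec n i) \<bullet> (U\<^sup>T *\<^sub>v unit_vec n i))"
    by (simp only: frame_trace[OF assms])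
  also have "\<dots> \<le> (\<Sum>i<n. unit_vec n i \<bullet> unit_vec n i)"
    by (intro sum_mono Bessel_inequality[OF assms]) simp
  also have "\<dots> = real n" by simp
  finally show ?thesis by simp
qed

text \<open>With \<open>P = U U\<^sup>T\<close> and \<open>R = W W\<^sup>T\<close> the right-hand side is the trace of \<open>P R\<close>. Its defect from
  \<open>m\<close> is the sum of \<open>|(1 - P) b|\<^sup>2\<close> over the columns \<open>b\<close> of \<open>W\<close>, and by the Bessel inequality for
  \<open>W\<close> this does not exceed the trace \<open>n - r\<close> of \<open>1 - P\<close>.\<close>
lemma frame_overlap:
  assumes U: "frame n r U" and W: "frame n m W"
  shows "real r + real m - real n \<le> (\<Sum>k<m. (U\<^sup>T *\<^sub>v col W k) \<bullet> (U\<^sup>T *\<^sub>v col W k))"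
proof -
  have Uc: "U \<in> carrier_mat n r" and Wc: "W \<in> carrier_mat n m" using U W frame_carrier by auto
  define D where "D = 1\<^sub>m n - U * U\<^sup>T"
  have D: "D \<in> carrier_mat n n" using Uc by (auto simp: D_def)
  have Dt: "D\<^sup>T = D"
    unfolding D_def using Uc by (simp add: transpose_minus[of _ n n] transpose_mult[of _ n r _ n])
  have Dx: "D *\<^sub>v x = x - U *\<^sub>v (U\<^sup>T *\<^sub>v x)" if "x \<in> carrier_vec n" for x
    unfolding D_def using that Uc
    by (simp add: minus_mult_distrib_mat_vec[of _ n n] assoc_mult_mat_vec[of _ n r _ n])
  have norm_D: "(D *\<^sub>v x) \<bullet> (D *\<^sub>v x) = x \<bullet> x - (U\<^sup>T *\<^sub>v x) \<bullet> (U\<^sup>T *\<^sub>v x)" if "x \<in> carrier_vec n" for x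
    using Dx[OF that] frame_residual[OF U that] by simp
  have col1: "D *\<^sub>v unit_vec n i = col D i" if "i < n" for i using that D by (intro eq_vecI) auto
  have "real m - (\<Sum>k<m. (U\<^sup>T *\<^sub>v col W k) \<bullet> (U\<^sup>T *\<^sub>v col W k))
      = (\<Sum>k<m. (D\<^sup>T *\<^sub>v col W k) \<bullet> (D\<^sup>T *\<^sub>v col W k))"
    using Wc W by (simp add: Dt norm_D frame_col_norm sum_subtractf)
  also have "\<dots> = (\<Sum>i<n. (W\<^sup>T *\<^sub>v col D i) \<bullet> (W\<^sup>T *\<^sub>v col D i))"
    by (rule sum_scalar_prod_transpose_cols[OF D Wc])
  also have "\<dots> \<le> (\<Sum>i<n. col D i \<bullet> col D i)"
    by (intro sum_mono Bessel_inequality[OF W]) (use D in auto)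
  also have "\<dots> = (\<Sum>i<n. 1 - (U\<^sup>T *\<^sub>v unit_vec n i) \<bullet> (U\<^sup>T *\<^sub>v unit_vec n i))"
    by (intro sum.cong refl) (simp add: col1[symmetric] norm_D)
  also have "\<dots> = real n - real r" by (simp add: sum_subtractf frame_trace[OF U])
  finally show ?thesis by simp
qed

text \<open>The symmetric form of Gaussian elimination: subtracting the square
  of the last row divided by the last diagonal entry clears the last row and column, and what
  remains is the minimum of the form over the last variable, hence still nonnegative.\<close>
lemma positive_semidefinite_sum_of_squares:
  fixes S :: "nat \<Rightarrow> nat \<Rightarrow> real"
  assumes "\<And>i j. i < n \<Longrightarrow> j < n \<Longrightarrow> S i j = S j i"
    and "\<And>x. 0 \<le> (\<Sum>i<n. \<Sum>j<n. S i j * (x i * x j))"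
  shows "\<exists>v. \<forall>i<n. \<forall>j<n. S i j = (\<Sum>k<n. v k i * v k j)"
  using assms
proof (induction n arbitrary: S)
  case 0
  then show ?case by simp
next
  case (Suc n)
  define d where "d = S n n"
  define w where "w i = (if d = 0 then 0 else S i n / sqrt d)" for i
  have form: "(\<Sum>i<Suc n. \<Sum>j<Suc n. S i j * (x i * x j)) =
     (\<Sum>i<n. \<Sum>j<n. S i j * (x i * x j)) + 2 * x n * (\<Sum>i<n. S i n * x i) + d * (x n)\<^sup>2" for x
  proof -
    have "(\<Sum>j<n. S n j * (x n * x j)) = (\<Sum>i<n. S i n * (x i * x n))"
      using Suc.prems(1) by (intro sum.cong) auto
    then show ?thesis
      by (simp add: sum.distrib d_def power2_eq_square sum_distrib_left algebra_simps)
  qed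
  have d0: "d \<ge> 0"
    using Suc.prems(2)[of "\<lambda>i. if i = n then 1 else 0"] unfolding form by simp
  have off: "S i n = 0" if "d = 0" "i < n" for i
  proof (rule ccontr)
    assume ne: "S i n \<noteq> 0"
    have "0 \<le> S i i + 2 * t * S i n" for t
    proof -
      have "(\<Sum>a<n. S a n * (if a = i then 1 else if a = n then t else 0)) = S i n"
        using that by (subst sum.cong[OF refl, of _ _ "\<lambda>a. if a = i then S a n else 0"]) auto
      moreover have "(\<Sum>a<n. \<Sum>b<n. S a b * ((if a = i then 1 else if a = n then t else 0) *
         (if b = i then 1 else if b = n then t else 0))) = S i i"
      proof -
        have "(\<Sum>a<n. \<Sum>b<n. S a b * ((if a = i then 1 else if a = n then t else 0) *
         (if b = i then 1 else if b = n then t else 0))) = (\<Sum>a<n. \<Sum>b<n. if b = i then (if a = i then S a b else 0) else 0)"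
          by (intro sum.cong) auto
        then show ?thesis using that by simp
      qed
      ultimately show ?thesis
        using Suc.prems(2)[of "\<lambda>a. if a = i then 1 else if a = n then t else 0"] that
        unfolding form by simp
    qed
    from this[of "- (S i i + 1) / (2 * S i n)"] show False using ne by (simp add: field_simps)
  qed
  have sq: "sqrt d * sqrt d = d" using d0 by simp
  have row: "S i n = w i * w n" if "i < Suc n" for i
    using off d0 that sq by (cases "i = n") (auto simp: w_def d_def field_simps)
  define S' where "S' i j = S i j - w i * w j" for i j
  have "\<exists>v. \<forall>i<n. \<forall>j<n. S' i j = (\<Sum>k<n. v k i * v k j)"
  proof (rule Suc.IH)
    show "S' i j = S' j i" if "i < n" "j < n" for i j using Suc.prems(1) that by (simp add: S'_def)
    fix x :: "nat \<Rightarrow> real"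
    define l where "l = (\<Sum>i<n. S i n * x i)"
    define y where "y i = (if i = n then (if d = 0 then 0 else - l / d) else x i)" for i
    have wx: "(\<Sum>i<n. w i * x i) = (if d = 0 then 0 else l / sqrt d)"
      by (simp add: w_def l_def sum_divide_distrib)
    have wx2: "(\<Sum>i<n. w i * x i)\<^sup>2 = (if d = 0 then 0 else l\<^sup>2 / d)"
      unfolding wx using d0 by (simp add: power_divide)
    have "0 \<le> (\<Sum>i<Suc n. \<Sum>j<Suc n. S i j * (y i * y j))" by (rule Suc.prems(2))
    also have "\<dots> = (\<Sum>i<n. \<Sum>j<n. S i j * (x i * x j)) + (2 * y n * l + d * (y n)\<^sup>2)"
      unfolding form by (simp add: y_def l_def)
    also have "2 * y n * l + d * (y n)\<^sup>2 = - (\<Sum>i<n. w i * x i)\<^sup>2"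
      unfolding wx2 by (simp add: y_def field_simps power2_eq_square)
    also have "(\<Sum>i<n. \<Sum>j<n. S i j * (x i * x j)) + - (\<Sum>i<n. w i * x i)\<^sup>2
      = (\<Sum>i<n. \<Sum>j<n. S' i j * (x i * x j))"
    proof -
      have "(\<Sum>i<n. w i * x i)\<^sup>2 = (\<Sum>i<n. \<Sum>j<n. w i * w j * (x i * x j))"
        by (simp add: power2_eq_square sum_product algebra_simps)
      then show ?thesis by (simp add: S'_def sum_subtractf left_diff_distrib)
    qed
    finally show "0 \<le> (\<Sum>i<n. \<Sum>j<n. S' i j * (x i * x j))" .
  qed
  then obtain v where v: "\<And>i j. i < n \<Longrightarrow> j < n \<Longrightarrow> S' i j = (\<Sum>k<n. v k i * v k j)" by blast
  define v' where "v' k i = (if k = n then w i else if i = n then 0 else v k i)" for k i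
  have "S i j = (\<Sum>k<Suc n. v' k i * v' k j)" if "i < Suc n" "j < Suc n" for i j
  proof (cases "i < n \<and> j < n")
    case True
    then show ?thesis using v[of i j] by (simp add: v'_def S'_def)
  next
    case False
    then have "i = n \<or> j = n" using that by auto
    then have "(\<Sum>k<n. v' k i * v' k j) = 0" by (intro sum.neutral) (auto simp: v'_def)
    moreover have "S i j = w i * w j"
      using \<open>i = n \<or> j = n\<close> row[OF that(1)] row[OF that(2)] Suc.prems(1)[OF that] by auto
    ultimately show ?thesis by (simp add: v'_def)
  qed
  then show ?case by blast
qed

section \<open>Seminorms on coordinate vectors\<close>

definition seminorm_on :: "nat \<Rightarrow> (real vec \<Rightarrow> real) \<Rightarrow> bool" where
  "seminorm_on n N \<longleftrightarrow>
     (\<forall>x\<in>carrier_vec n. \<forall>y\<in>carrier_vec n. N (x + y) \<le> N x + N y) \<and>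
     (\<forall>c. \<forall>x\<in>carrier_vec n. N (c \<cdot>\<^sub>v x) = \<bar>c\<bar> * N x)"

lemma seminorm_triangle:
  "seminorm_on n N \<Longrightarrow> x \<in> carrier_vec n \<Longrightarrow> y \<in> carrier_vec n \<Longrightarrow> N (x + y) \<le> N x + N y"
  by (simp add: seminorm_on_def)

lemma seminorm_smult: "seminorm_on n N \<Longrightarrow> x \<in> carrier_vec n \<Longrightarrow> N (c \<cdot>\<^sub>v x) = \<bar>c\<bar> * N x"
  by (simp add: seminorm_on_def)

lemma seminorm_zero: "seminorm_on n N \<Longrightarrow> N (0\<^sub>v n) = 0"
proof -
  have "0 \<cdot>\<^sub>v 0\<^sub>v n = (0\<^sub>v n :: real vec)" by auto
  then show "seminorm_on n N \<Longrightarrow> N (0\<^sub>v n) = 0" using seminorm_smult[of n N "0\<^sub>v n" 0] by simp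
qed

lemma seminorm_nonneg:
  assumes "seminorm_on n N" "x \<in> carrier_vec n"
  shows "0 \<le> N x"
proof -
  have "x + (-1) \<cdot>\<^sub>v x = 0\<^sub>v n" using assms(2) by (intro eq_vecI) auto
  then show ?thesis
    using seminorm_triangle[OF assms, of "(-1) \<cdot>\<^sub>v x"] seminorm_smult[OF assms, of "-1"]
      seminorm_zero[OF assms(1)] assms(2) by simp
qed

text \<open>Adds the coordinates one at a time and uses the triangle inequality at each step; this is what
  makes seminorms bounded on bounded sets and continuous.\<close>
lemma seminorm_le_coordinate_sum:
  assumes N: "seminorm_on n N" and x: "x \<in> carrier_vec n"
  shows "N x \<le> (\<Sum>i<n. \<bar>x $ i\<bar> * N (unit_vec n i))"
proof -
  define y where "y k = vec n (\<lambda>i. if i < k then x $ i else 0)" for k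
  have "N (y k) \<le> (\<Sum>i<k. \<bar>x $ i\<bar> * N (unit_vec n i))" if "k \<le> n" for k
    using that
  proof (induction k)
    case 0
    have "y 0 = 0\<^sub>v n" by (auto simp: y_def)
    then show ?case using seminorm_zero[OF N] by simp
  next
    case (Suc k)
    have "y (Suc k) = y k + (x $ k) \<cdot>\<^sub>v unit_vec n k" using Suc.prems by (intro eq_vecI) (auto simp: y_def less_Suc_eq)
    then have "N (y (Suc k)) \<le> N (y k) + N ((x $ k) \<cdot>\<^sub>v unit_vec n k)"
      using seminorm_triangle[OF N, of "y k" "(x $ k) \<cdot>\<^sub>v unit_vec n k"] by (auto simp: y_def)
    also have "N ((x $ k) \<cdot>\<^sub>v unit_vec n k) = \<bar>x $ k\<bar> * N (unit_vec n k)"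
      by (rule seminorm_smult[OF N]) simp
    finally show ?case using Suc by simp
  qed
  from this[of n] have "N (y n) \<le> (\<Sum>i<n. \<bar>x $ i\<bar> * N (unit_vec n i))" by simp
  moreover have "y n = x" using x by (intro eq_vecI) (auto simp: y_def)
  ultimately show ?thesis by simp
qed

lemma seminorm_abs_diff_le:
  assumes N: "seminorm_on n N" and x: "x \<in> carrier_vec n" and y: "y \<in> carrier_vec n"
  shows "\<bar>N x - N y\<bar> \<le> (\<Sum>i<n. \<bar>x $ i - y $ i\<bar> * N (unit_vec n i))"
proof -
  have *: "N x - N y \<le> (\<Sum>i<n. \<bar>x $ i - y $ i\<bar> * N (unit_vec n i))"
    if x: "x \<in> carrier_vec n" and y: "y \<in> carrier_vec n" for x y
  proof -
    have "y + (x - y) = x" using x y by (intro eq_vecI) auto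
    then have "N x \<le> N y + N (x - y)" using seminorm_triangle[OF N y, of "x - y"] x y by simp
    moreover have "N (x - y) \<le> (\<Sum>i<n. \<bar>x $ i - y $ i\<bar> * N (unit_vec n i))"
      using seminorm_le_coordinate_sum[OF N, of "x - y"] x y by simp
    ultimately show ?thesis by simp
  qed
  have "(\<Sum>i<n. \<bar>y $ i - x $ i\<bar> * N (unit_vec n i)) = (\<Sum>i<n. \<bar>x $ i - y $ i\<bar> * N (unit_vec n i))"
    by (intro sum.cong) (simp_all add: abs_minus_commute)
  then show ?thesis using *[OF x y] *[OF y x] by simp
qed

lemma seminorm_tendsto:
  assumes N: "seminorm_on n N" and x: "x \<in> carrier_vec n" and y: "\<And>k. y k \<in> carrier_vec n"
    and lim: "\<And>i. i < n \<Longrightarrow> (\<lambda>k. y k $ i) \<longlonglongrightarrow> x $ i"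
  shows "(\<lambda>k. N (y k)) \<longlonglongrightarrow> N x"
proof -
  have "(\<lambda>k. \<Sum>i<n. \<bar>y k $ i - x $ i\<bar> * N (unit_vec n i)) \<longlonglongrightarrow> (\<Sum>i<n. \<bar>x $ i - x $ i\<bar> * N (unit_vec n i))"
    by (intro tendsto_intros lim) auto
  then have "(\<lambda>k. \<Sum>i<n. \<bar>y k $ i - x $ i\<bar> * N (unit_vec n i)) \<longlonglongrightarrow> 0" by simp
  then have "(\<lambda>k. N (y k) - N x) \<longlonglongrightarrow> 0"
    by (rule Lim_null_comparison[rotated]) (use seminorm_abs_diff_le[OF N y x] in auto)
  then show ?thesis using LIM_zero_iff by blast
qed

lemma seminorm_mult_mat:
  assumes "seminorm_on n N" "T \<in> carrier_mat n m"
  shows "seminorm_on m (\<lambda>x. N (T *\<^sub>v x))"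
  using assms by (auto simp: seminorm_on_def mult_add_distrib_mat_vec[of _ n m] mult_mat_vec[of _ n m])

section \<open>Moments of linear forms on the sphere\<close>

locale haar_sphere =
  fixes n :: nat and \<mu> :: "real vec measure"
  assumes haar: "sphere_haar n \<mu>" and dim_pos: "n \<ge> 1"
begin

sublocale prob_space \<mu>
  using haar by (simp add: sphere_haar_def)

lemma space_haar: "space \<mu> = unit_sphere n"
  using haar by (simp add: sphere_haar_def)

lemma in_space_haar: "\<alpha> \<in> space \<mu> \<longleftrightarrow> \<alpha> \<in> carrier_vec n \<and> \<alpha> \<bullet> \<alpha> = 1"
  by (simp add: space_haar unit_sphere_def)

lemma sets_haar: "sets \<mu> = sets (sphere_borel n)"
  using haar by (simp add: sphere_haar_def)

lemma measurable_coordinate: "i < n \<Longrightarrow> (\<lambda>\<alpha>. \<alpha> $ i) \<in> borel_measurable \<mu>"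
proof -
  assume i: "i < n"
  have "(\<lambda>\<alpha>. \<lambda>i\<in>{..<n}. \<alpha> $ i) \<in> measurable \<mu> (\<Pi>\<^sub>M i\<in>{..<n}. (borel :: real measure))"
    unfolding measurable_cong_sets[OF sets_haar refl] sphere_borel_def
    by (rule measurable_vimage_algebra1) (auto simp: space_PiM)
  moreover have "(\<lambda>f. f i) \<in> measurable (\<Pi>\<^sub>M i\<in>{..<n}. (borel :: real measure)) borel"
    by (rule measurable_component_singleton) (use i in simp)
  ultimately have "(\<lambda>\<alpha>. (\<lambda>i\<in>{..<n}. \<alpha> $ i) i) \<in> borel_measurable \<mu>"
    by (rule measurable_compose)
  then show ?thesis using i by simp
qed

lemma measurable_linear: "v \<in> carrier_vec n \<Longrightarrow> (\<lambda>\<alpha>. \<alpha> \<bullet> v) \<in> borel_measurable \<mu>"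
  by (auto simp: scalar_prod_def atLeast0LessThan intro!: borel_measurable_sum borel_measurable_times measurable_coordinate)

lemma measurable_orthogonal:
  assumes Q: "frame n n Q"
  shows "(\<lambda>\<alpha>. Q *\<^sub>v \<alpha>) \<in> measurable \<mu> \<mu>"
  unfolding measurable_cong_sets[OF refl sets_haar] sphere_borel_def
proof (rule measurable_vimage_algebra2)
  have Qc: "Q \<in> carrier_mat n n" using Q by (rule frame_carrier)
  show "(\<lambda>\<alpha>. Q *\<^sub>v \<alpha>) \<in> space \<mu> \<rightarrow> unit_sphere n"
    using Qc by (auto simp: in_space_haar unit_sphere_def frame_isometry[OF Q])
  show "(\<lambda>\<alpha>. \<lambda>i\<in>{..<n}. (Q *\<^sub>v \<alpha>) $ i) \<in> measurable \<mu> (\<Pi>\<^sub>M i\<in>{..<n}. borel)"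
  proof (rule measurable_restrict)
    fix i assume i: "i \<in> {..<n}"
    have "(\<lambda>\<alpha>. \<alpha> \<bullet> row Q i) \<in> borel_measurable \<mu>" by (rule measurable_linear) (use Qc i in auto)
    moreover have "(Q *\<^sub>v \<alpha>) $ i = \<alpha> \<bullet> row Q i" if "\<alpha> \<in> space \<mu>" for \<alpha>
      using that i Qc by (auto simp: in_space_haar intro: comm_scalar_prod[of _ n])
    ultimately show "(\<lambda>\<alpha>. (Q *\<^sub>v \<alpha>) $ i) \<in> borel_measurable \<mu>"
      by (subst measurable_cong) auto
  qed
qed

lemma integral_orthogonal:
  fixes f :: "real vec \<Rightarrow> real"
  assumes Q: "frame n n Q" and f: "f \<in> borel_measurable \<mu>"
  shows "(\<integral>\<alpha>. f (Q *\<^sub>v \<alpha>) \<partial>\<mu>) = (\<integral>\<alpha>. f \<alpha> \<partial>\<mu>)"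
proof -
  have "distr \<mu> \<mu> (\<lambda>\<alpha>. Q *\<^sub>v \<alpha>) = \<mu>"
    using haar Q by (auto simp: sphere_haar_def frame_def)
  then show ?thesis using integral_distr[OF measurable_orthogonal[OF Q] f] by simp
qed

text \<open>An orthogonal matrix that carries \<open>v\<close> to \<open>w\<close> turns one linear form into the other and preserves the
  measure.\<close>
lemma integral_linear_form_cong:
  fixes f :: "real \<Rightarrow> real"
  assumes v: "v \<in> carrier_vec n" and w: "w \<in> carrier_vec n" and eq: "v \<bullet> v = w \<bullet> w"
    and f: "f \<in> borel_measurable borel"
  shows "(\<integral>\<alpha>. f (\<alpha> \<bullet> v) \<partial>\<mu>) = (\<integral>\<alpha>. f (\<alpha> \<bullet> w) \<partial>\<mu>)"
proof -
  obtain Q where Q: "frame n n Q" "Q\<^sup>T *\<^sub>v v = w" using orthogonal_transitive_on_spheres[OF v w eq] .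
  have Qc: "Q \<in> carrier_mat n n" using Q(1) by (rule frame_carrier)
  have "(\<integral>\<alpha>. f (\<alpha> \<bullet> w) \<partial>\<mu>) = (\<integral>\<alpha>. f ((Q *\<^sub>v \<alpha>) \<bullet> v) \<partial>\<mu>)"
  proof (rule Bochner_Integration.integral_cong[OF refl])
    fix \<alpha> assume "\<alpha> \<in> space \<mu>"
    then have a: "\<alpha> \<in> carrier_vec n" by (simp add: in_space_haar)
    have "(Q *\<^sub>v \<alpha>) \<bullet> v = v \<bullet> (Q *\<^sub>v \<alpha>)" using a v Qc by (intro comm_scalar_prod[of _ n]) auto
    also have "\<dots> = w \<bullet> \<alpha>" using scalar_prod_transpose[OF Qc v a] Q(2) by simp
    also have "\<dots> = \<alpha> \<bullet> w" using w a by (rule comm_scalar_prod)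
    finally show "f (\<alpha> \<bullet> w) = f ((Q *\<^sub>v \<alpha>) \<bullet> v)" by simp
  qed
  also have "\<dots> = (\<integral>\<alpha>. f (\<alpha> \<bullet> v) \<partial>\<mu>)"
    by (rule integral_orthogonal[OF Q(1)]) (rule measurable_compose[OF measurable_linear[OF v] f])
  finally show ?thesis by simp
qed

lemma abs_linear_form_le:
  assumes "\<alpha> \<in> space \<mu>" "v \<in> carrier_vec n"
  shows "\<bar>\<alpha> \<bullet> v\<bar> \<le> sqrt (v \<bullet> v)"
  using scalar_prod_Cauchy_Schwarz[of \<alpha> n v] assms
  by (metis in_space_haar mult_1 real_sqrt_abs real_sqrt_le_iff)

lemma integrable_bounded:
  fixes f :: "real vec \<Rightarrow> real"
  assumes "f \<in> borel_measurable \<mu>" "\<And>\<alpha>. \<alpha> \<in> space \<mu> \<Longrightarrow> \<bar>f \<alpha>\<bar> \<le> K"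
  shows "integrable \<mu> f"
  by (rule integrable_const_bound[of f K]) (use assms in auto)

lemma abs_coordinate_le: "\<alpha> \<in> space \<mu> \<Longrightarrow> i < n \<Longrightarrow> \<bar>\<alpha> $ i\<bar> \<le> 1"
  using abs_linear_form_le[of \<alpha> "unit_vec n i"] by (simp add: in_space_haar)

lemma integrable_coordinates:
  assumes "i < n" "j < n"
  shows "integrable \<mu> (\<lambda>\<alpha>. (\<alpha> $ i) ^ k * (\<alpha> $ j) ^ l)"
proof (rule integrable_bounded[of _ 1])
  show "(\<lambda>\<alpha>. (\<alpha> $ i) ^ k * (\<alpha> $ j) ^ l) \<in> borel_measurable \<mu>"
    by (intro borel_measurable_times borel_measurable_power measurable_coordinate assms)
  show "\<bar>(\<alpha> $ i) ^ k * (\<alpha> $ j) ^ l\<bar> \<le> 1" if "\<alpha> \<in> space \<mu>" for \<alpha>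
    using abs_coordinate_le[OF that assms(1)] abs_coordinate_le[OF that assms(2)]
    by (simp add: abs_mult power_abs mult_le_one power_le_one)
qed

lemma integrable_coordinate_power: "i < n \<Longrightarrow> integrable \<mu> (\<lambda>\<alpha>. (\<alpha> $ i) ^ k)"
  using integrable_coordinates[of i i k 0] by simp

lemma integrable_linear_form_power:
  assumes "v \<in> carrier_vec n"
  shows "integrable \<mu> (\<lambda>\<alpha>. (\<alpha> \<bullet> v) ^ k)"
proof (rule integrable_bounded[of _ "sqrt (v \<bullet> v) ^ k"])
  show "(\<lambda>\<alpha>. (\<alpha> \<bullet> v) ^ k) \<in> borel_measurable \<mu>"
    by (intro borel_measurable_power measurable_linear assms)
  show "\<bar>(\<alpha> \<bullet> v) ^ k\<bar> \<le> sqrt (v \<bullet> v) ^ k" if "\<alpha> \<in> space \<mu>" for \<alpha>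
    using abs_linear_form_le[OF that assms] by (simp add: power_abs power_mono)
qed

lemma even_moment_coordinate:
  assumes v: "v \<in> carrier_vec n" and i: "i < n"
  shows "(\<integral>\<alpha>. (\<alpha> \<bullet> v) ^ (2 * k) \<partial>\<mu>) = (v \<bullet> v) ^ k * (\<integral>\<alpha>. (\<alpha> $ i) ^ (2 * k) \<partial>\<mu>)"
proof -
  define c where "c = sqrt (v \<bullet> v)"
  have c2: "c\<^sup>2 = v \<bullet> v" by (simp add: c_def scalar_prod_self_nonneg)
  have "(\<integral>\<alpha>. (\<alpha> \<bullet> v) ^ (2 * k) \<partial>\<mu>) = (\<integral>\<alpha>. (\<alpha> \<bullet> (c \<cdot>\<^sub>v unit_vec n i)) ^ (2 * k) \<partial>\<mu>)"
    by (rule integral_linear_form_cong[OF v]) (use i c2 in \<open>auto simp: power2_eq_square\<close>)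
  also have "\<dots> = (\<integral>\<alpha>. (v \<bullet> v) ^ k * (\<alpha> $ i) ^ (2 * k) \<partial>\<mu>)"
    by (rule Bochner_Integration.integral_cong[OF refl])
       (use i in \<open>auto simp: in_space_haar power_mult_distrib power_mult c2\<close>)
  finally show ?thesis by simp
qed

text \<open>By rotation invariance every coordinate has the same second moment, and the squares of the
  coordinates sum to 1.\<close>
lemma second_moment:
  assumes v: "v \<in> carrier_vec n"
  shows "(\<integral>\<alpha>. (\<alpha> \<bullet> v)\<^sup>2 \<partial>\<mu>) = (v \<bullet> v) / n"
proof -
  have "real n * (\<integral>\<alpha>. (\<alpha> \<bullet> v)\<^sup>2 \<partial>\<mu>) = (\<Sum>i<n. (\<integral>\<alpha>. (\<alpha> \<bullet> v)\<^sup>2 \<partial>\<mu>))" by simp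
  also have "\<dots> = (\<Sum>i<n. (v \<bullet> v) * (\<integral>\<alpha>. (\<alpha> $ i)\<^sup>2 \<partial>\<mu>))"
    by (intro sum.cong refl) (use even_moment_coordinate[OF v, of _ 1] in simp)
  also have "\<dots> = (v \<bullet> v) * (\<integral>\<alpha>. (\<Sum>i<n. (\<alpha> $ i)\<^sup>2) \<partial>\<mu>)"
    by (simp add: sum_distrib_left integrable_coordinate_power)
  also have "(\<integral>\<alpha>. (\<Sum>i<n. (\<alpha> $ i)\<^sup>2) \<partial>\<mu>) = (\<integral>\<alpha>. 1 \<partial>\<mu>)"
    by (rule Bochner_Integration.integral_cong[OF refl])
       (auto simp: in_space_haar scalar_prod_self_sum[symmetric])
  finally show ?thesis using dim_pos by (simp add: prob_space field_simps)
qed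

text \<open>The forms \<open>\<alpha>\<^sub>i + \<alpha>\<^sub>j\<close> and \<open>\<alpha>\<^sub>i - \<alpha>\<^sub>j\<close> both have coefficient vectors of squared length 2, so their
  fourth moments are four times that of \<open>\<alpha>\<^sub>i\<close>; in the sum of the two the odd mixed terms cancel.\<close>
lemma mixed_fourth_moment:
  assumes ij: "i < n" "j < n" "i \<noteq> j"
  shows "(\<integral>\<alpha>. (\<alpha> $ i)\<^sup>2 * (\<alpha> $ j)\<^sup>2 \<partial>\<mu>) = (\<integral>\<alpha>. (\<alpha> $ i) ^ 4 \<partial>\<mu>) / 3"
proof -
  note four = even_moment_coordinate[where k = 2, simplified]
  have E: "(\<integral>\<alpha>. (\<alpha> $ j) ^ 4 \<partial>\<mu>) = (\<integral>\<alpha>. (\<alpha> $ i) ^ 4 \<partial>\<mu>)"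
    using four[of "unit_vec n i" i] four[of "unit_vec n i" j] ij by simp
  define v where "v c = unit_vec n i + c \<cdot>\<^sub>v unit_vec n j" for c :: real
  have v: "v c \<in> carrier_vec n" for c by (simp add: v_def)
  have vv: "v c \<bullet> v c = 1 + c\<^sup>2" for c
    unfolding v_def using ij by (subst scalar_prod_self_combination[of _ n]) auto
  have av: "\<alpha> \<bullet> v c = \<alpha> $ i + c * \<alpha> $ j" if "\<alpha> \<in> space \<mu>" for \<alpha> c
    using that ij by (auto simp: in_space_haar v_def scalar_prod_add_distrib[of _ n])
  have "8 * (\<integral>\<alpha>. (\<alpha> $ i) ^ 4 \<partial>\<mu>) = (\<integral>\<alpha>. (\<alpha> \<bullet> v 1) ^ 4 \<partial>\<mu>) + (\<integral>\<alpha>. (\<alpha> \<bullet> v (-1)) ^ 4 \<partial>\<mu>)"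
    using four[OF v, of i 1] four[OF v, of i "-1"] ij by (simp add: vv)
  also have "\<dots> = (\<integral>\<alpha>. (\<alpha> \<bullet> v 1) ^ 4 + (\<alpha> \<bullet> v (-1)) ^ 4 \<partial>\<mu>)"
    using integrable_linear_form_power[OF v] by simp
  also have "\<dots> = (\<integral>\<alpha>. 2 * (\<alpha> $ i) ^ 4 + 12 * ((\<alpha> $ i)\<^sup>2 * (\<alpha> $ j)\<^sup>2) + 2 * (\<alpha> $ j) ^ 4 \<partial>\<mu>)"
    by (rule Bochner_Integration.integral_cong[OF refl]) (simp add: av power2_eq_square power4_eq_xxxx algebra_simps)
  also have "\<dots> = 4 * (\<integral>\<alpha>. (\<alpha> $ i) ^ 4 \<partial>\<mu>) + 12 * (\<integral>\<alpha>. (\<alpha> $ i)\<^sup>2 * (\<alpha> $ j)\<^sup>2 \<partial>\<mu>)"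
    using ij by (simp add: integrable_coordinates integrable_coordinate_power E)
  finally show ?thesis by simp
qed

text \<open>Expanding \<open>1 = (\<Sum>i. \<alpha>\<^sub>i\<^sup>2)\<^sup>2\<close> and taking means gives a linear equation for the fourth moment of one
  coordinate.\<close>
lemma fourth_moment:
  assumes v: "v \<in> carrier_vec n"
  shows "(\<integral>\<alpha>. (\<alpha> \<bullet> v) ^ 4 \<partial>\<mu>) = 3 * (v \<bullet> v)\<^sup>2 / (real n * (real n + 2))"
proof -
  define E where "E = (\<integral>\<alpha>. (\<alpha> $ 0) ^ 4 \<partial>\<mu>)"
  note four = even_moment_coordinate[where k = 2, simplified]
  have E: "(\<integral>\<alpha>. (\<alpha> $ i) ^ 4 \<partial>\<mu>) = E" if "i < n" for i
    using four[of "unit_vec n i" i] four[of "unit_vec n i" 0] that dim_pos by (simp add: E_def)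
  have "1 = (\<integral>\<alpha>. (\<Sum>i<n. (\<alpha> $ i)\<^sup>2) * (\<Sum>j<n. (\<alpha> $ j)\<^sup>2) \<partial>\<mu>)"
  proof -
    have "(\<integral>\<alpha>. (\<Sum>i<n. (\<alpha> $ i)\<^sup>2) * (\<Sum>j<n. (\<alpha> $ j)\<^sup>2) \<partial>\<mu>) = (\<integral>\<alpha>. 1 \<partial>\<mu>)"
      by (rule Bochner_Integration.integral_cong[OF refl])
         (auto simp: in_space_haar scalar_prod_self_sum[symmetric])
    then show ?thesis by (simp add: prob_space)
  qed
  also have "\<dots> = (\<Sum>i<n. \<Sum>j<n. (\<integral>\<alpha>. (\<alpha> $ i)\<^sup>2 * (\<alpha> $ j)\<^sup>2 \<partial>\<mu>))"
    unfolding sum_product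
    by (subst Bochner_Integration.integral_sum; (intro sum.cong refl Bochner_Integration.integral_sum)?)
       (auto intro!: Bochner_Integration.integrable_sum integrable_coordinates)
  also have "\<dots> = (\<Sum>i<n. \<Sum>j<n. E / 3 + (if i = j then 2 * E / 3 else 0))"
  proof (intro sum.cong refl)
    fix i j assume ij: "i \<in> {..<n}" "j \<in> {..<n}"
    show "(\<integral>\<alpha>. (\<alpha> $ i)\<^sup>2 * (\<alpha> $ j)\<^sup>2 \<partial>\<mu>) = E / 3 + (if i = j then 2 * E / 3 else 0)"
    proof (cases "i = j")
      case True
      then show ?thesis using ij E[of j] by (simp flip: power_add)
    next
      case False
      then show ?thesis using ij mixed_fourth_moment[of i j] E[of i] by simp
    qed
  qed
  also have "\<dots> = real n * (real n + 2) * E / 3"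
    by (simp add: sum.distrib) (simp add: field_simps)
  finally have "real n * (real n + 2) * E = 3" by simp
  then have "E * (real n * (real n + 2)) = 3" by (simp only: mult.commute)
  moreover have "real n * (real n + 2) \<noteq> 0" using dim_pos by simp
  ultimately have "E = 3 / (real n * (real n + 2))" by (rule eq_divide_imp[rotated])
  then show ?thesis using four[OF v, of 0] dim_pos by (simp add: E_def)
qed

text \<open>A lower bound for a first absolute moment from the second and fourth moments, by means of the
  inequality \<open>s y\<^sup>2 - s\<^sup>3 y\<^sup>4 \<le> |y|\<close>.\<close>
lemma abs_linear_form_mean_ge:
  assumes v: "v \<in> carrier_vec n"
  shows "2 / 9 * sqrt (v \<bullet> v) / sqrt n \<le> (\<integral>\<alpha>. \<bar>\<alpha> \<bullet> v\<bar> \<partial>\<mu>)"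
proof (cases "v \<bullet> v = 0")
  case True
  then show ?thesis by simp
next
  case False
  define c where "c = sqrt (v \<bullet> v)"
  define q where "q = sqrt (real n)"
  have c: "c > 0" "c\<^sup>2 = v \<bullet> v" using False scalar_prod_self_nonneg[of v] by (auto simp: c_def)
  have q: "q > 0" "q\<^sup>2 = real n" using dim_pos by (auto simp: q_def)
  (* The lower bound produced by s = tau * q / c is (tau - 3 tau^3) * c / q, which is largest at
     tau = 1/3. *)
  define s where "s = q / (3 * c)"
  have s: "s > 0" using c q by (simp add: s_def)
  have pw: "s * y\<^sup>2 - s ^ 3 * y ^ 4 \<le> \<bar>y\<bar>" for y :: real
  proof -
    define z where "z = s * \<bar>y\<bar>"
    have z: "z \<ge> 0" using s by (simp add: z_def)
    have "0 \<le> 1 - z + z ^ 3"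
    proof (cases "z \<le> 1")
      case False
      then show ?thesis using power_increasing[of 1 3 z] by simp
    qed (use z in simp)
    then have "0 \<le> \<bar>y\<bar> * (1 - z + z ^ 3)" by simp
    also have "\<dots> = \<bar>y\<bar> - s * y\<^sup>2 + s ^ 3 * y ^ 4"
    proof -
      have "\<bar>y\<bar> * \<bar>y\<bar> = y\<^sup>2" by (simp add: power2_eq_square)
      moreover have "\<bar>y\<bar> * \<bar>y\<bar> ^ 3 = y ^ 4"
        using power_even_abs[of 4 y] by (simp add: numeral_eq_Suc)
      ultimately show ?thesis by (simp add: z_def algebra_simps power_mult_distrib)
    qed
    finally show ?thesis by simp
  qed
  have "2 / 9 * c / q = s * (c\<^sup>2 / q\<^sup>2) - s ^ 3 * (3 * (c\<^sup>2)\<^sup>2 / (q\<^sup>2 * q\<^sup>2))"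
    using c(1) q(1) by (simp add: s_def field_simps power2_eq_square power3_eq_cube)
  also have "\<dots> \<le> s * (c\<^sup>2 / q\<^sup>2) - s ^ 3 * (3 * (c\<^sup>2)\<^sup>2 / (q\<^sup>2 * (q\<^sup>2 + 2)))"
    using s c(1) q(1) by (intro diff_left_mono mult_left_mono divide_left_mono mult_pos_pos add_pos_pos) auto
  also have "\<dots> = s * (\<integral>\<alpha>. (\<alpha> \<bullet> v)\<^sup>2 \<partial>\<mu>) - s ^ 3 * (\<integral>\<alpha>. (\<alpha> \<bullet> v) ^ 4 \<partial>\<mu>)"
    by (simp add: second_moment[OF v] fourth_moment[OF v] c q)
  also have "\<dots> = (\<integral>\<alpha>. s * (\<alpha> \<bullet> v)\<^sup>2 - s ^ 3 * (\<alpha> \<bullet> v) ^ 4 \<partial>\<mu>)"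
    using integrable_linear_form_power[OF v] by simp
  also have "\<dots> \<le> (\<integral>\<alpha>. \<bar>\<alpha> \<bullet> v\<bar> \<partial>\<mu>)"
    using integrable_linear_form_power[OF v, of 2] integrable_linear_form_power[OF v, of 4]
      integrable_linear_form_power[OF v, of 1] pw
    by (intro integral_mono) auto
  finally show ?thesis by (simp add: c_def q_def)
qed

end

section \<open>Means of seminorms of matrix images\<close>

lemma sum_of_squares_expand:
  fixes a :: "nat \<Rightarrow> nat \<Rightarrow> real"
  shows "(\<Sum>k\<in>K. (\<Sum>i\<in>I. a k i * x i)\<^sup>2) = (\<Sum>i\<in>I. \<Sum>j\<in>I. (\<Sum>k\<in>K. a k i * a k j) * (x i * x j))"
proof -
  have "(\<Sum>k\<in>K. (\<Sum>i\<in>I. a k i * x i)\<^sup>2) = (\<Sum>k\<in>K. \<Sum>i\<in>I. \<Sum>j\<in>I. a k i * a k j * (x i * x j))"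
    by (simp add: power2_eq_square sum_product algebra_simps)
  also have "\<dots> = (\<Sum>i\<in>I. \<Sum>j\<in>I. \<Sum>k\<in>K. a k i * a k j * (x i * x j))"
    by (subst sum.swap) (intro sum.cong refl sum.swap)
  finally show ?thesis by (simp add: sum_distrib_right)
qed

text \<open>The hypothesis says that the symmetric matrix \<open>\<rho> - B B\<^sup>T\<close> is positive semidefinite.\<close>
lemma contraction_defect_sum_of_squares:
  fixes B :: "real mat" and \<rho> :: real
  assumes B: "B \<in> carrier_mat n n"
    and bound: "\<And>x. x \<in> carrier_vec n \<Longrightarrow> (B\<^sup>T *\<^sub>v x) \<bullet> (B\<^sup>T *\<^sub>v x) \<le> \<rho> * (x \<bullet> x)"
  obtains v where "\<And>k. v k \<in> carrier_vec n"
    "\<And>x. x \<in> carrier_vec n \<Longrightarrow> \<rho> * (x \<bullet> x) = (B\<^sup>T *\<^sub>v x) \<bullet> (B\<^sup>T *\<^sub>v x) + (\<Sum>k<n. (v k \<bullet> x)\<^sup>2)"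
proof -
  define S where "S i j = (if i = j then \<rho> else 0) - (\<Sum>k<n. B $$ (i, k) * B $$ (j, k))" for i j
  have form: "(\<Sum>i<n. \<Sum>j<n. S i j * (x $ i * x $ j)) = \<rho> * (x \<bullet> x) - (B\<^sup>T *\<^sub>v x) \<bullet> (B\<^sup>T *\<^sub>v x)"
    if x: "x \<in> carrier_vec n" for x
  proof -
    have "(B\<^sup>T *\<^sub>v x) \<bullet> (B\<^sup>T *\<^sub>v x) = (\<Sum>k<n. (\<Sum>i<n. B $$ (i, k) * x $ i)\<^sup>2)"
      using B x by (subst scalar_prod_self_sum[of _ n]) (auto simp: scalar_prod_def atLeast0LessThan)
    also have "\<dots> = (\<Sum>i<n. \<Sum>j<n. (\<Sum>k<n. B $$ (i, k) * B $$ (j, k)) * (x $ i * x $ j))"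
      by (rule sum_of_squares_expand)
    finally have 1: "(B\<^sup>T *\<^sub>v x) \<bullet> (B\<^sup>T *\<^sub>v x) = \<dots>" .
    have "(\<Sum>i<n. \<Sum>j<n. (if i = j then \<rho> else 0) * (x $ i * x $ j)) = \<rho> * (x \<bullet> x)"
      unfolding scalar_prod_self_sum[OF x]
      by (simp add: if_distrib[of "\<lambda>c. c * _"] power2_eq_square sum_distrib_left cong: if_cong)
    then show ?thesis unfolding 1 S_def by (simp add: left_diff_distrib sum_subtractf)
  qed
  have "\<exists>v. \<forall>i<n. \<forall>j<n. S i j = (\<Sum>k<n. v k i * v k j)"
  proof (rule positive_semidefinite_sum_of_squares)
    show "S i j = S j i" for i j by (simp add: S_def mult.commute)
    fix x :: "nat \<Rightarrow> real"
    show "0 \<le> (\<Sum>i<n. \<Sum>j<n. S i j * (x i * x j))"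
      using form[of "vec n x"] bound[of "vec n x"] by simp
  qed
  then obtain v where v: "\<And>i j. i < n \<Longrightarrow> j < n \<Longrightarrow> S i j = (\<Sum>k<n. v k i * v k j)" by blast
  show ?thesis
  proof (rule that[of "\<lambda>k. vec n (v k)"])
    fix x :: "real vec" assume x: "x \<in> carrier_vec n"
    have "(\<Sum>k<n. (vec n (v k) \<bullet> x)\<^sup>2) = (\<Sum>k<n. (\<Sum>i<n. v k i * x $ i)\<^sup>2)"
      using x by (simp add: scalar_prod_def atLeast0LessThan)
    also have "\<dots> = (\<Sum>i<n. \<Sum>j<n. S i j * (x $ i * x $ j))"
      unfolding sum_of_squares_expand by (intro sum.cong refl) (simp add: v)
    finally show "\<rho> * (x \<bullet> x) = (B\<^sup>T *\<^sub>v x) \<bullet> (B\<^sup>T *\<^sub>v x) + (\<Sum>k<n. (vec n (v k) \<bullet> x)\<^sup>2)"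
      using form[OF x] by simp
  qed simp
qed

context haar_sphere
begin

text \<open>Only the sphere carries a \<open>\<sigma>\<close>-algebra here, so measurability of \<open>N\<close> is expressed through its
  compositions with linear maps restricted to the sphere.\<close>
definition measurable_seminorm :: "(real vec \<Rightarrow> real) \<Rightarrow> bool" where
  "measurable_seminorm N \<longleftrightarrow> seminorm_on n N \<and>
     (\<forall>T\<in>carrier_mat n n. (\<lambda>\<alpha>. N (T *\<^sub>v \<alpha>)) \<in> borel_measurable \<mu>)"

definition mean :: "(real vec \<Rightarrow> real) \<Rightarrow> real mat \<Rightarrow> real" where
  "mean N T = (\<integral>\<alpha>. N (T *\<^sub>v \<alpha>) \<partial>\<mu>)"

lemma integrable_seminorm:
  assumes N: "measurable_seminorm N" and T: "T \<in> carrier_mat n n"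
  shows "integrable \<mu> (\<lambda>\<alpha>. N (T *\<^sub>v \<alpha>))"
proof (rule integrable_bounded[of _ "\<Sum>i<n. sqrt (row T i \<bullet> row T i) * N (unit_vec n i)"])
  have sn: "seminorm_on n N" using N by (simp add: measurable_seminorm_def)
  show "(\<lambda>\<alpha>. N (T *\<^sub>v \<alpha>)) \<in> borel_measurable \<mu>" using N T by (simp add: measurable_seminorm_def)
  fix \<alpha> assume a: "\<alpha> \<in> space \<mu>"
  then have ac: "\<alpha> \<in> carrier_vec n" by (simp add: in_space_haar)
  have Ta: "T *\<^sub>v \<alpha> \<in> carrier_vec n" using T ac by auto
  have "\<bar>N (T *\<^sub>v \<alpha>)\<bar> = N (T *\<^sub>v \<alpha>)" using seminorm_nonneg[OF sn Ta] by simp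
  also have "\<dots> \<le> (\<Sum>i<n. \<bar>(T *\<^sub>v \<alpha>) $ i\<bar> * N (unit_vec n i))" by (rule seminorm_le_coordinate_sum[OF sn Ta])
  also have "\<dots> \<le> (\<Sum>i<n. sqrt (row T i \<bullet> row T i) * N (unit_vec n i))"
  proof (intro sum_mono mult_right_mono)
    fix i assume i: "i \<in> {..<n}"
    have r: "row T i \<in> carrier_vec n" using T i by auto
    have "(T *\<^sub>v \<alpha>) $ i = \<alpha> \<bullet> row T i" using T i comm_scalar_prod[OF r ac] by auto
    then show "\<bar>(T *\<^sub>v \<alpha>) $ i\<bar> \<le> sqrt (row T i \<bullet> row T i)" using abs_linear_form_le[OF a r] by simp
    show "0 \<le> N (unit_vec n i)" by (rule seminorm_nonneg[OF sn]) simp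
  qed
  finally show "\<bar>N (T *\<^sub>v \<alpha>)\<bar> \<le> (\<Sum>i<n. sqrt (row T i \<bullet> row T i) * N (unit_vec n i))" .
qed

lemma mean_mult_orthogonal:
  assumes N: "measurable_seminorm N" and T: "T \<in> carrier_mat n n" and Q: "frame n n Q"
  shows "mean N (T * Q) = mean N T"
proof -
  have Qc: "Q \<in> carrier_mat n n" using Q by (rule frame_carrier)
  have "mean N (T * Q) = (\<integral>\<alpha>. N (T *\<^sub>v (Q *\<^sub>v \<alpha>)) \<partial>\<mu>)"
    unfolding mean_def using T Qc
    by (intro Bochner_Integration.integral_cong refl) (simp add: in_space_haar assoc_mult_mat_vec[of _ n n _ n])
  also have "\<dots> = mean N T"
    unfolding mean_def using N T by (intro integral_orthogonal[OF Q]) (simp add: measurable_seminorm_def)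
  finally show ?thesis .
qed

text \<open>Convexity bounds \<open>N (T G \<alpha>)\<close> by a mixture of \<open>N (T \<alpha>)\<close> and \<open>N (T H \<alpha>)\<close>, whose means agree.\<close>
lemma mean_mult_mixture_le:
  assumes N: "measurable_seminorm N" and T: "T \<in> carrier_mat n n" and H: "frame n n H"
    and t: "0 \<le> t" "t \<le> 1" and G: "G \<in> carrier_mat n n"
    and mix: "\<And>x. x \<in> carrier_vec n \<Longrightarrow> G *\<^sub>v x = (1 - t) \<cdot>\<^sub>v x + t \<cdot>\<^sub>v (H *\<^sub>v x)"
  shows "mean N (T * G) \<le> mean N T"
proof -
  have sn: "seminorm_on n N" using N by (simp add: measurable_seminorm_def)
  have Hc: "H \<in> carrier_mat n n" using H by (rule frame_carrier)
  have TH: "T * H \<in> carrier_mat n n" using T Hc by simp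
  have "mean N (T * G) \<le> (\<integral>\<alpha>. (1 - t) * N (T *\<^sub>v \<alpha>) + t * N ((T * H) *\<^sub>v \<alpha>) \<partial>\<mu>)"
    unfolding mean_def
  proof (rule integral_mono)
    show "integrable \<mu> (\<lambda>\<alpha>. N (T * G *\<^sub>v \<alpha>))" using integrable_seminorm[OF N, of "T * G"] T G by simp
    show "integrable \<mu> (\<lambda>\<alpha>. (1 - t) * N (T *\<^sub>v \<alpha>) + t * N (T * H *\<^sub>v \<alpha>))"
      using integrable_seminorm[OF N T] integrable_seminorm[OF N TH] by simp
    fix \<alpha> assume "\<alpha> \<in> space \<mu>"
    then have a: "\<alpha> \<in> carrier_vec n" by (simp add: in_space_haar)
    have Ta: "T *\<^sub>v \<alpha> \<in> carrier_vec n" "T * H *\<^sub>v \<alpha> \<in> carrier_vec n" using T TH a by auto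
    have "T * G *\<^sub>v \<alpha> = T *\<^sub>v ((1 - t) \<cdot>\<^sub>v \<alpha> + t \<cdot>\<^sub>v (H *\<^sub>v \<alpha>))"
      using T G a by (simp add: assoc_mult_mat_vec[of _ n n _ n] mix)
    also have "\<dots> = (1 - t) \<cdot>\<^sub>v (T *\<^sub>v \<alpha>) + t \<cdot>\<^sub>v (T * H *\<^sub>v \<alpha>)"
      using T Hc a
      by (subst mult_add_distrib_mat_vec[of _ n n]) (auto simp: mult_mat_vec[of _ n n] assoc_mult_mat_vec[of _ n n _ n])
    finally have "N (T * G *\<^sub>v \<alpha>) \<le> N ((1 - t) \<cdot>\<^sub>v (T *\<^sub>v \<alpha>)) + N (t \<cdot>\<^sub>v (T * H *\<^sub>v \<alpha>))"
      using seminorm_triangle[OF sn, of "(1 - t) \<cdot>\<^sub>v (T *\<^sub>v \<alpha>)" "t \<cdot>\<^sub>v (T * H *\<^sub>v \<alpha>)"] Ta by simp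
    then show "N (T * G *\<^sub>v \<alpha>) \<le> (1 - t) * N (T *\<^sub>v \<alpha>) + t * N (T * H *\<^sub>v \<alpha>)"
      using seminorm_smult[OF sn Ta(1), of "1 - t"] seminorm_smult[OF sn Ta(2), of t] t by simp
  qed
  also have "\<dots> = (1 - t) * mean N T + t * mean N (T * H)"
    unfolding mean_def using integrable_seminorm[OF N T] integrable_seminorm[OF N TH] by simp
  also have "\<dots> = mean N T" by (simp add: mean_mult_orthogonal[OF N T H] algebra_simps)
  finally show ?thesis .
qed

text \<open>A projection \<open>P\<close> is the midpoint of the identity and the orthogonal matrix \<open>2 P - 1\<close>.\<close>
lemma mean_mult_projection_le:
  assumes N: "measurable_seminorm N" and T: "T \<in> carrier_mat n n" and U: "frame n r U"
  shows "mean N (T * (U * U\<^sup>T)) \<le> mean N T"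
proof -
  have Uc: "U \<in> carrier_mat n r" using U by (rule frame_carrier)
  define P where "P = U * U\<^sup>T"
  define H where "H = P + P - 1\<^sub>m n"
  have P: "P \<in> carrier_mat n n" and Hc: "H \<in> carrier_mat n n" using Uc by (auto simp: P_def H_def)
  have Px: "P *\<^sub>v x = U *\<^sub>v (U\<^sup>T *\<^sub>v x)" if "x \<in> carrier_vec n" for x
    using that Uc by (simp add: P_def assoc_mult_mat_vec[of _ n r _ n])
  have Hx: "H *\<^sub>v x = (P *\<^sub>v x + P *\<^sub>v x) - x" if "x \<in> carrier_vec n" for x
    using that P
    by (simp add: H_def minus_mult_distrib_mat_vec[of _ n n] add_mult_distrib_mat_vec[of _ n n])
  have H: "frame n n H"
  proof (rule frameI_isometry[OF Hc])
    fix x :: "real vec" assume x: "x \<in> carrier_vec n"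
    have Utx: "U\<^sup>T *\<^sub>v x \<in> carrier_vec r" using Uc x by auto
    have PP: "(P *\<^sub>v x) \<bullet> (P *\<^sub>v x) = (U\<^sup>T *\<^sub>v x) \<bullet> (U\<^sup>T *\<^sub>v x)"
      unfolding Px[OF x] by (rule frame_isometry[OF U Utx Utx])
    have Pxc: "P *\<^sub>v x \<in> carrier_vec n" using P x by auto
    have xP: "x \<bullet> (P *\<^sub>v x) = (U\<^sup>T *\<^sub>v x) \<bullet> (U\<^sup>T *\<^sub>v x)"
      unfolding Px[OF x] by (rule scalar_prod_transpose[OF Uc x Utx])
    have "H *\<^sub>v x = (- 1) \<cdot>\<^sub>v x + 2 \<cdot>\<^sub>v (P *\<^sub>v x)"
      unfolding Hx[OF x] using x P by (intro eq_vecI) auto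
    then have "(H *\<^sub>v x) \<bullet> (H *\<^sub>v x) = x \<bullet> x - 4 * ((P *\<^sub>v x) \<bullet> x) + 4 * ((P *\<^sub>v x) \<bullet> (P *\<^sub>v x))"
      using scalar_prod_self_combination[of "(- 1) \<cdot>\<^sub>v x" n "P *\<^sub>v x" 2] x Pxc by simp
    then show "(H *\<^sub>v x) \<bullet> (H *\<^sub>v x) = x \<bullet> x" using PP xP comm_scalar_prod[OF x Pxc] by simp
  qed
  have "mean N (T * P) \<le> mean N T"
  proof (rule mean_mult_mixture_le[OF N T H, of "1 / 2"])
    fix x :: "real vec" assume x: "x \<in> carrier_vec n"
    show "P *\<^sub>v x = (1 - 1 / 2) \<cdot>\<^sub>v x + (1 / 2) \<cdot>\<^sub>v (H *\<^sub>v x)"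
      unfolding Hx[OF x] using x P by (intro eq_vecI) (auto simp: field_simps)
  qed (use P in auto)
  then show ?thesis by (simp add: P_def)
qed

text \<open>Enlarging \<open>T T\<^sup>T\<close> by \<open>v v\<^sup>T\<close> does not decrease the mean. With \<open>T u = v\<close> one takes
  \<open>T' = T (1 + s u u\<^sup>T)\<close>, where \<open>s\<close> is chosen such that \<open>(1 + s u u\<^sup>T)\<^sup>2 = 1 + u u\<^sup>T\<close>. The inverse of the
  factor has the form \<open>1 - t u u\<^sup>T\<close> and is therefore a mixture of the identity and the reflection
  along \<open>u\<close>, so passing back from \<open>T'\<close> to \<open>T\<close> cannot increase the mean. The right inverse \<open>R\<close>
  provides \<open>u\<close> and is carried along so that the step can be repeated.\<close>
lemma mean_le_rank_one_enlargement:
  assumes N: "measurable_seminorm N" and T: "T \<in> carrier_mat n n" and R: "R \<in> carrier_mat n n"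
    and TR: "T * R = 1\<^sub>m n" and v: "v \<in> carrier_vec n"
  obtains T' R' where "T' \<in> carrier_mat n n" "R' \<in> carrier_mat n n" "T' * R' = 1\<^sub>m n"
    "\<And>x. x \<in> carrier_vec n \<Longrightarrow> (T'\<^sup>T *\<^sub>v x) \<bullet> (T'\<^sup>T *\<^sub>v x) = (T\<^sup>T *\<^sub>v x) \<bullet> (T\<^sup>T *\<^sub>v x) + (v \<bullet> x)\<^sup>2"
    "mean N T \<le> mean N T'"
proof (cases "R *\<^sub>v v = 0\<^sub>v n")
  case True
  have "v = T *\<^sub>v (R *\<^sub>v v)" using T R v TR assoc_mult_mat_vec[OF T R v] by simp
  then have v0: "v = 0\<^sub>v n" using True T by auto
  show ?thesis
    by (rule that[OF T R TR]) (auto simp: v0)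
next
  case False
  define u where "u = R *\<^sub>v v"
  have u: "u \<in> carrier_vec n" using R v by (auto simp: u_def)
  have Tu: "T *\<^sub>v u = v" unfolding u_def using T R v TR assoc_mult_mat_vec[OF T R v] by simp
  define a where "a = u \<bullet> u"
  have a: "a > 0" unfolding a_def using False u by (intro scalar_prod_self_pos[of _ n]) (auto simp: u_def)
  (* The positive root of 2 s + a s^2 = 1. *)
  define s where "s = (sqrt (1 + a) - 1) / a"
  have s0: "s > 0" using a by (simp add: s_def)
  have "a * s = sqrt (1 + a) - 1" using a by (simp add: s_def)
  then have "(a * s + 1)\<^sup>2 = 1 + a" using a by simp
  then have "a * (2 * s + s\<^sup>2 * a) = a * 1" by (simp add: power2_eq_square algebra_simps)
  then have s: "2 * s + s\<^sup>2 * a = 1" using a by simp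
  define t where "t = s / (1 + s * a)"
  have "s * a > 0" using s0 a by simp
  then have "1 + s * a \<noteq> 0" by linarith
  then have t: "t * (1 + s * a) = s" by (simp add: t_def)
  define K where "K = mat n n (\<lambda>(i, j). (if i = j then 1 else 0) + s * (u $ i * u $ j))"
  define G where "G = mat n n (\<lambda>(i, j). (if i = j then 1 else 0) + - t * (u $ i * u $ j))"
  have K: "K \<in> carrier_mat n n" and G: "G \<in> carrier_mat n n" by (auto simp: K_def G_def)
  have Kt: "K\<^sup>T = K" by (rule eq_matI) (auto simp: K_def)
  have Kx: "K *\<^sub>v x = x + (s * (u \<bullet> x)) \<cdot>\<^sub>v u" if "x \<in> carrier_vec n" for x
    unfolding K_def by (rule rank_one_update_mult[OF u that])
  have Gx: "G *\<^sub>v x = x + (- t * (u \<bullet> x)) \<cdot>\<^sub>v u" if "x \<in> carrier_vec n" for x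
    unfolding G_def by (rule rank_one_update_mult[OF u that])
  have KG: "K * G = 1\<^sub>m n"
  proof (rule eq_matI)
    fix i j assume "i < dim_row (1\<^sub>m n)" "j < dim_col (1\<^sub>m n)"
    then have ij: "i < n" "j < n" by auto
    define x where "x = (unit_vec n j :: real vec)"
    have x: "x \<in> carrier_vec n" by (simp add: x_def)
    have c: "u \<bullet> (x + (- t * (u \<bullet> x)) \<cdot>\<^sub>v u) = (1 - t * a) * (u \<bullet> x)"
      using u x by (simp add: scalar_prod_add_distrib[of _ n] a_def algebra_simps)
    have "K *\<^sub>v (G *\<^sub>v x) = (x + (- t * (u \<bullet> x)) \<cdot>\<^sub>v u) + (s * ((1 - t * a) * (u \<bullet> x))) \<cdot>\<^sub>v u"
      unfolding Gx[OF x] c[symmetric] using x u by (intro Kx) auto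
    also have "\<dots> = x + ((s * (1 - t * a) - t) * (u \<bullet> x)) \<cdot>\<^sub>v u"
      using x u by (intro eq_vecI) (auto simp: algebra_simps)
    also have "s * (1 - t * a) - t = 0" using t by (simp add: algebra_simps)
    finally have KGx: "K *\<^sub>v (G *\<^sub>v x) = x" using x u by auto
    have "G *\<^sub>v x = col G j" unfolding x_def using ij G by (intro eq_vecI) auto
    then have "(K * G) $$ (i, j) = (K *\<^sub>v (G *\<^sub>v x)) $ i" using ij K G by simp
    also have "\<dots> = x $ i" by (simp only: KGx)
    also have "\<dots> = 1\<^sub>m n $$ (i, j)" using ij by (simp add: x_def)
    finally show "(K * G) $$ (i, j) = 1\<^sub>m n $$ (i, j)" .
  qed (use K G in auto)
  show ?thesis
  proof (rule that[of "T * K" "G * R"])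
    show "T * K \<in> carrier_mat n n" "G * R \<in> carrier_mat n n" using T K G R by auto
    have "T * K * (G * R) = T * (K * G) * R"
      using T K G R by (simp add: assoc_mult_mat[of _ n n _ n _ n])
    then show "T * K * (G * R) = 1\<^sub>m n" using T R TR by (simp add: KG)
    show "mean N T \<le> mean N (T * K)"
    proof -
      have "T = T * K * G" using T K G KG by (simp add: assoc_mult_mat[of _ n n _ n _ n])
      moreover have "mean N (T * K * G) \<le> mean N (T * K)"
      proof (rule mean_mult_mixture_le[OF N _ frame_reflection[OF u] _ _ G, of _ "t * a / 2"])
        show "T * K \<in> carrier_mat n n" using T K by auto
        show "u \<bullet> u \<noteq> 0" using a by (simp add: a_def)
        have "t \<ge> 0" using s0 a by (simp add: t_def)
        then show "0 \<le> t * a / 2" using a by simp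
        have "t * a \<le> 1" using \<open>s * a > 0\<close> by (simp add: t_def)
        then show "t * a / 2 \<le> 1" by simp
        fix x :: "real vec" assume x: "x \<in> carrier_vec n"
        show "G *\<^sub>v x = (1 - t * a / 2) \<cdot>\<^sub>v x + (t * a / 2) \<cdot>\<^sub>v (reflection u *\<^sub>v x)"
          unfolding Gx[OF x] reflection_mult[OF u x] a_def[symmetric]
          using x u a by (intro eq_vecI) (auto simp: field_simps)
      qed
      ultimately show ?thesis by simp
    qed
    fix x :: "real vec" assume x: "x \<in> carrier_vec n"
    define y where "y = T\<^sup>T *\<^sub>v x"
    have y: "y \<in> carrier_vec n" using T x by (auto simp: y_def)
    have uy: "u \<bullet> y = v \<bullet> x"
      using scalar_prod_transpose[OF T x u] Tu comm_scalar_prod[OF u y] comm_scalar_prod[OF v x] by (simp add: y_def)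
    have "(T * K)\<^sup>T *\<^sub>v x = K *\<^sub>v y"
      using T K x by (simp add: transpose_mult[OF T K] Kt y_def assoc_mult_mat_vec[of _ n n _ n])
    then have "((T * K)\<^sup>T *\<^sub>v x) \<bullet> ((T * K)\<^sup>T *\<^sub>v x) = y \<bullet> y + (2 * s + s\<^sup>2 * a) * (u \<bullet> y)\<^sup>2"
      using scalar_prod_self_combination[OF y u, of "s * (u \<bullet> y)"]
      by (simp add: Kx[OF y] a_def power2_eq_square algebra_simps)
    then show "((T * K)\<^sup>T *\<^sub>v x) \<bullet> ((T * K)\<^sup>T *\<^sub>v x) = (T\<^sup>T *\<^sub>v x) \<bullet> (T\<^sup>T *\<^sub>v x) + (v \<bullet> x)\<^sup>2"
      unfolding s uy y_def[symmetric] by simp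
  qed
qed

text \<open>Adding the squares of the defect one after the other leads from \<open>B B\<^sup>T\<close> to \<open>\<rho>\<close> times the identity,
  and a matrix with \<open>T T\<^sup>T = \<rho>\<close> is \<open>sqrt \<rho>\<close> times an orthogonal one. For a Gaussian vector in place of
  one on the sphere this is the statement that adding an independent centred vector
  does not decrease the mean of a norm.\<close>
lemma mean_le_operator_norm:
  assumes N: "measurable_seminorm N" and B: "B \<in> carrier_mat n n" and R: "R \<in> carrier_mat n n"
    and BR: "B * R = 1\<^sub>m n" and \<rho>: "\<rho> > 0"
    and bound: "\<And>x. x \<in> carrier_vec n \<Longrightarrow> (B\<^sup>T *\<^sub>v x) \<bullet> (B\<^sup>T *\<^sub>v x) \<le> \<rho> * (x \<bullet> x)"
  shows "mean N B \<le> sqrt \<rho> * mean N (1\<^sub>m n)"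
proof -
  have sn: "seminorm_on n N" using N by (simp add: measurable_seminorm_def)
  obtain v where v: "\<And>k. v k \<in> carrier_vec n"
    and sq: "\<And>x. x \<in> carrier_vec n \<Longrightarrow> \<rho> * (x \<bullet> x) = (B\<^sup>T *\<^sub>v x) \<bullet> (B\<^sup>T *\<^sub>v x) + (\<Sum>k<n. (v k \<bullet> x)\<^sup>2)"
    using contraction_defect_sum_of_squares[OF B bound] by blast
  have "\<exists>T R. T \<in> carrier_mat n n \<and> R \<in> carrier_mat n n \<and> T * R = 1\<^sub>m n \<and> mean N B \<le> mean N T \<and>
     (\<forall>x\<in>carrier_vec n. (T\<^sup>T *\<^sub>v x) \<bullet> (T\<^sup>T *\<^sub>v x) = (B\<^sup>T *\<^sub>v x) \<bullet> (B\<^sup>T *\<^sub>v x) + (\<Sum>k<j. (v k \<bullet> x)\<^sup>2))" for j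
  proof (induction j)
    case 0
    show ?case using B R BR by (intro exI[of _ B] exI[of _ R]) auto
  next
    case (Suc j)
    then obtain T R where T: "T \<in> carrier_mat n n" "R \<in> carrier_mat n n" "T * R = 1\<^sub>m n" "mean N B \<le> mean N T"
      and Tx: "\<forall>x\<in>carrier_vec n. (T\<^sup>T *\<^sub>v x) \<bullet> (T\<^sup>T *\<^sub>v x) = (B\<^sup>T *\<^sub>v x) \<bullet> (B\<^sup>T *\<^sub>v x) + (\<Sum>k<j. (v k \<bullet> x)\<^sup>2)"
      by blast
    obtain T' R' where T': "T' \<in> carrier_mat n n" "R' \<in> carrier_mat n n" "T' * R' = 1\<^sub>m n"
      "\<And>x. x \<in> carrier_vec n \<Longrightarrow> (T'\<^sup>T *\<^sub>v x) \<bullet> (T'\<^sup>T *\<^sub>v x) = (T\<^sup>T *\<^sub>v x) \<bullet> (T\<^sup>T *\<^sub>v x) + (v j \<bullet> x)\<^sup>2"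
      "mean N T \<le> mean N T'"
      using mean_le_rank_one_enlargement[OF N T(1-3) v[of j]] by metis
    then show ?case using Tx T(4) by (intro exI[of _ T'] exI[of _ R']) auto
  qed
  from this[of n] obtain T where T: "T \<in> carrier_mat n n" "mean N B \<le> mean N T"
    and Tx: "\<And>x. x \<in> carrier_vec n \<Longrightarrow> (T\<^sup>T *\<^sub>v x) \<bullet> (T\<^sup>T *\<^sub>v x) = \<rho> * (x \<bullet> x)"
    using sq by auto
  define c where "c = 1 / sqrt \<rho>"
  have c: "c > 0" "c * c * \<rho> = 1" "sqrt \<rho> * c = 1" using \<rho> by (auto simp: c_def)
  define Q where "Q = c \<cdot>\<^sub>m T"
  have Q: "Q \<in> carrier_mat n n" using T by (simp add: Q_def)
  have smult_vec: "(d \<cdot>\<^sub>m A) *\<^sub>v x = d \<cdot>\<^sub>v (A *\<^sub>v x)" if "A \<in> carrier_mat n n" "x \<in> carrier_vec n" for d and A :: "real mat" and x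
    using that by (intro eq_vecI) auto
  have "frame n n (Q\<^sup>T)"
  proof (rule frameI_isometry)
    fix x :: "real vec" assume x: "x \<in> carrier_vec n"
    have "Q\<^sup>T = c \<cdot>\<^sub>m T\<^sup>T" unfolding Q_def by (intro eq_matI) auto
    then have Qx: "Q\<^sup>T *\<^sub>v x = c \<cdot>\<^sub>v (T\<^sup>T *\<^sub>v x)" using smult_vec[of "T\<^sup>T" x c] T x by simp
    have "(Q\<^sup>T *\<^sub>v x) \<bullet> (Q\<^sup>T *\<^sub>v x) = c * c * ((T\<^sup>T *\<^sub>v x) \<bullet> (T\<^sup>T *\<^sub>v x))"
      unfolding Qx using T x by simp
    then show "(Q\<^sup>T *\<^sub>v x) \<bullet> (Q\<^sup>T *\<^sub>v x) = x \<bullet> x" using c Tx[OF x] by (metis mult.assoc mult_1)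
  qed (use Q in auto)
  then have "Q * Q\<^sup>T = 1\<^sub>m n" by (simp add: frame_def)
  then have "Q\<^sup>T * Q = 1\<^sub>m n" using mat_mult_left_right_inverse[OF Q _ ] Q by auto
  then have Qf: "frame n n Q" using Q by (simp add: frame_def)
  have "mean N T = (\<integral>\<alpha>. sqrt \<rho> * N (Q *\<^sub>v \<alpha>) \<partial>\<mu>)"
    unfolding mean_def
  proof (intro Bochner_Integration.integral_cong refl)
    fix \<alpha> assume "\<alpha> \<in> space \<mu>"
    then have a: "\<alpha> \<in> carrier_vec n" by (simp add: in_space_haar)
    have Ta: "T *\<^sub>v \<alpha> \<in> carrier_vec n" using T a by auto
    have "N (Q *\<^sub>v \<alpha>) = c * N (T *\<^sub>v \<alpha>)"
      unfolding Q_def smult_vec[OF T(1) a] seminorm_smult[OF sn Ta] using c by simp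
    then show "N (T *\<^sub>v \<alpha>) = sqrt \<rho> * N (Q *\<^sub>v \<alpha>)" using c by (metis mult.assoc mult_1)
  qed
  also have "\<dots> = sqrt \<rho> * mean N (1\<^sub>m n * Q)" using Q by (simp add: mean_def)
  also have "\<dots> = sqrt \<rho> * mean N (1\<^sub>m n)" using mean_mult_orthogonal[OF N _ Qf, of "1\<^sub>m n"] by simp
  finally show ?thesis using T(2) by simp
qed

end

section \<open>Lebesgue norms of bounded functions\<close>

lemma Linf_norm_leD:
  assumes "Linf_norm M f \<le> ereal B"
  shows "AE x in M. \<bar>f x\<bar> \<le> B"
proof -
  have "AE x in M. ereal \<bar>f x\<bar> \<le> Linf_norm M f" unfolding Linf_norm_def by (rule esssup_AE)
  then show ?thesis
  proof (rule AE_mp, intro AE_I2 impI)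
    fix x assume "ereal \<bar>f x\<bar> \<le> Linf_norm M f"
    then have "ereal \<bar>f x\<bar> \<le> ereal B" using assms by (rule order_trans)
    then show "\<bar>f x\<bar> \<le> B" by simp
  qed
qed

lemma Linf_iff: "f \<in> Linf M \<longleftrightarrow> f \<in> borel_measurable M \<and> (\<exists>K. AE x in M. \<bar>f x\<bar> \<le> K)"
proof
  assume f: "f \<in> Linf M"
  then have "Linf_norm M f < \<infinity>" by (simp add: Linf_def)
  then obtain k :: nat where "Linf_norm M f < ereal (real k)" using less_PInf_Ex_of_nat by auto
  then have "Linf_norm M f \<le> ereal (real k)" by simp
  then show "f \<in> borel_measurable M \<and> (\<exists>K. AE x in M. \<bar>f x\<bar> \<le> K)"
    using f Linf_norm_leD by (auto simp: Linf_def)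
next
  assume "f \<in> borel_measurable M \<and> (\<exists>K. AE x in M. \<bar>f x\<bar> \<le> K)"
  then obtain K where f: "f \<in> borel_measurable M" and K: "AE x in M. \<bar>f x\<bar> \<le> K" by blast
  have "esssup M (\<lambda>x. ereal \<bar>f x\<bar>) \<le> ereal K"
    by (rule esssup_I) (use f K in auto)
  then show "f \<in> Linf M" using f
    by (auto simp: Linf_def Linf_norm_def intro: order.strict_trans1)
qed

lemma Linf_measurable: "f \<in> Linf M \<Longrightarrow> f \<in> borel_measurable M"
  by (simp add: Linf_def)

lemma LinfE:
  assumes "f \<in> Linf M"
  obtains K where "AE x in M. \<bar>f x\<bar> \<le> K" "K \<ge> 0"
proof -
  obtain K where "AE x in M. \<bar>f x\<bar> \<le> K" using assms by (auto simp: Linf_iff)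
  then have "AE x in M. \<bar>f x\<bar> \<le> max K 0" by (rule AE_mp) (auto intro: AE_I2)
  then show ?thesis by (rule that) simp
qed

lemma Linf_mult:
  assumes "f \<in> Linf M" "g \<in> Linf M"
  shows "(\<lambda>x. f x * g x) \<in> Linf M"
proof -
  obtain K where K: "AE x in M. \<bar>f x\<bar> \<le> K" "K \<ge> 0" using assms(1) by (rule LinfE)
  obtain L where L: "AE x in M. \<bar>g x\<bar> \<le> L" "L \<ge> 0" using assms(2) by (rule LinfE)
  have "AE x in M. \<bar>f x * g x\<bar> \<le> K * L"
    using K(1) L(1) by eventually_elim (simp add: abs_mult mult_mono K)
  then show ?thesis using assms[THEN Linf_measurable] by (auto simp: Linf_iff)
qed

lemma Linf_add:
  assumes "f \<in> Linf M" "g \<in> Linf M"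
  shows "(\<lambda>x. f x + g x) \<in> Linf M"
proof -
  obtain K where K: "AE x in M. \<bar>f x\<bar> \<le> K" "K \<ge> 0" using assms(1) by (rule LinfE)
  obtain L where L: "AE x in M. \<bar>g x\<bar> \<le> L" "L \<ge> 0" using assms(2) by (rule LinfE)
  have "AE x in M. \<bar>f x + g x\<bar> \<le> K + L"
    using K(1) L(1) by eventually_elim simp
  then show ?thesis using assms[THEN Linf_measurable] by (auto simp: Linf_iff)
qed

lemma Linf_const: "(\<lambda>x. c) \<in> Linf M"
  by (auto simp: Linf_iff)

lemma Linf_sum: "(\<And>i. i \<in> I \<Longrightarrow> f i \<in> Linf M) \<Longrightarrow> (\<lambda>x. \<Sum>i\<in>I. f i x) \<in> Linf M"
  by (induction I rule: infinite_finite_induct) (auto intro: Linf_add Linf_const)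

lemma Linf_abs_powr:
  assumes "f \<in> Linf M" "p \<ge> 0"
  shows "(\<lambda>x. \<bar>f x\<bar> powr p) \<in> Linf M"
proof -
  obtain K where K: "AE x in M. \<bar>f x\<bar> \<le> K" "K \<ge> 0" using assms(1) by (rule LinfE)
  have "AE x in M. \<bar>\<bar>f x\<bar> powr p\<bar> \<le> K powr p"
    using K(1) by eventually_elim (simp add: powr_mono2 assms)
  then show ?thesis using assms(1)[THEN Linf_measurable] by (auto simp: Linf_iff)
qed

lemma (in prob_space) Linf_integrable:
  assumes "f \<in> Linf M"
  shows "integrable M f"
proof -
  obtain K where "AE x in M. \<bar>f x\<bar> \<le> K" "K \<ge> 0" using assms by (rule LinfE)
  then show ?thesis using assms by (intro integrable_const_bound[of f K]) (auto simp: Linf_iff)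
qed

lemma powr_convex_nonneg:
  fixes u w t p :: real
  assumes "p \<ge> 1" "u \<ge> 0" "w \<ge> 0" "0 \<le> t" "t \<le> 1"
  shows "(t * u + (1 - t) * w) powr p \<le> t * u powr p + (1 - t) * w powr p"
proof -
  have scale: "(s * z) powr p \<le> s * z powr p" if "0 \<le> s" "s \<le> 1" "z \<ge> 0" for s z :: real
  proof -
    have "s powr p \<le> s" using that assms(1) powr_mono'[of 1 p s] by (cases "s = 0") auto
    then show ?thesis using that by (simp add: powr_mult mult_right_mono)
  qed
  show ?thesis
  proof (cases "u = 0 \<or> w = 0")
    case True
    then show ?thesis using scale[of t u] scale[of "1 - t" w] assms by auto
  next
    case False
    then have "u \<in> {0<..}" "w \<in> {0<..}" using assms by auto
    then show ?thesis
      using convex_onD[OF powr_convex[OF assms(1)], of "1 - t" u w] assms by simp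
  qed
qed

text \<open>Minkowski's inequality. For \<open>a\<close> and \<open>b\<close> above the two norms, \<open>|f + g| / (a + b)\<close> is at most the
  mixture of \<open>|f| / a\<close> and \<open>|g| / b\<close> with weights \<open>a / (a + b)\<close> and \<open>b / (a + b)\<close>; convexity of the
  power bounds the integral of its \<open>p\<close>-th power by 1. Taking \<open>a\<close> and \<open>b\<close> strictly above the norms
  avoids a division by zero.\<close>
lemma (in prob_space) Lp_norm_triangle:
  assumes p: "p \<ge> 1" and f: "f \<in> Linf M" and g: "g \<in> Linf M"
  shows "Lp_norm M p (\<lambda>x. f x + g x) \<le> Lp_norm M p f + Lp_norm M p g"
proof (rule field_le_epsilon)
  fix e :: real assume e: "e > 0"
  define a where "a = Lp_norm M p f + e / 2"
  define b where "b = Lp_norm M p g + e / 2"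
  have nn: "Lp_norm M p h \<ge> 0" for h by (simp add: Lp_norm_def)
  have a: "a > 0" and b: "b > 0" using nn[of f] nn[of g] e by (auto simp: a_def b_def)
  have int_le: "(\<integral>x. \<bar>h x\<bar> powr p \<partial>M) \<le> c powr p" if "Lp_norm M p h \<le> c" for h c
  proof -
    have "(\<integral>x. \<bar>h x\<bar> powr p \<partial>M) = Lp_norm M p h powr p"
      using p by (simp add: Lp_norm_def powr_powr)
    also have "\<dots> \<le> c powr p" using that p nn by (intro powr_mono2) auto
    finally show ?thesis .
  qed
  have intf: "(\<integral>x. \<bar>f x\<bar> powr p \<partial>M) \<le> a powr p" and intg: "(\<integral>x. \<bar>g x\<bar> powr p \<partial>M) \<le> b powr p"
    using e by (auto intro!: int_le simp: a_def b_def)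
  define t where "t = a / (a + b)"
  have t: "0 \<le> t" "t \<le> 1" using a b by (auto simp: t_def)
  have t1: "1 - t = b / (a + b)" using a b by (simp add: t_def field_simps)
  have pw: "\<bar>f x + g x\<bar> powr p \<le> (a + b) powr p * (t * (\<bar>f x\<bar> powr p / a powr p) + (1 - t) * (\<bar>g x\<bar> powr p / b powr p))" for x
  proof -
    have "\<bar>f x + g x\<bar> \<le> (a + b) * (t * (\<bar>f x\<bar> / a) + (1 - t) * (\<bar>g x\<bar> / b))"
      unfolding t1 unfolding t_def using a b abs_triangle_ineq[of "f x" "g x"]
      by (simp add: distrib_left)
    then have "\<bar>f x + g x\<bar> powr p \<le> ((a + b) * (t * (\<bar>f x\<bar> / a) + (1 - t) * (\<bar>g x\<bar> / b))) powr p"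
      using p by (intro powr_mono2) auto
    also have "\<dots> = (a + b) powr p * (t * (\<bar>f x\<bar> / a) + (1 - t) * (\<bar>g x\<bar> / b)) powr p"
      using a b t by (intro powr_mult)
    also have "\<dots> \<le> (a + b) powr p * (t * (\<bar>f x\<bar> / a) powr p + (1 - t) * (\<bar>g x\<bar> / b) powr p)"
      using powr_convex_nonneg[OF p, of "\<bar>f x\<bar> / a" "\<bar>g x\<bar> / b" t] a b t by (intro mult_left_mono) auto
    finally show ?thesis using a b by (simp add: powr_divide)
  qed
  have If: "integrable M (\<lambda>x. \<bar>f x\<bar> powr p)" and Ig: "integrable M (\<lambda>x. \<bar>g x\<bar> powr p)"
    and Ifg: "integrable M (\<lambda>x. \<bar>f x + g x\<bar> powr p)"
    using p by (intro Linf_integrable Linf_abs_powr Linf_add f g; simp)+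
  have "(\<integral>x. \<bar>f x + g x\<bar> powr p \<partial>M) \<le>
     (\<integral>x. (a + b) powr p * (t * (\<bar>f x\<bar> powr p / a powr p) + (1 - t) * (\<bar>g x\<bar> powr p / b powr p)) \<partial>M)"
    using If Ig Ifg pw by (intro integral_mono) auto
  also have "\<dots> = (a + b) powr p * (t * ((\<integral>x. \<bar>f x\<bar> powr p \<partial>M) / a powr p) + (1 - t) * ((\<integral>x. \<bar>g x\<bar> powr p \<partial>M) / b powr p))"
    using If Ig by simp
  also have "\<dots> \<le> (a + b) powr p * (t * 1 + (1 - t) * 1)"
    using intf intg a b t by (intro mult_left_mono add_mono) auto
  finally have "(\<integral>x. \<bar>f x + g x\<bar> powr p \<partial>M) \<le> (a + b) powr p" by simp
  then have "Lp_norm M p (\<lambda>x. f x + g x) \<le> ((a + b) powr p) powr (1 / p)"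
    unfolding Lp_norm_def using p by (intro powr_mono2) auto
  also have "\<dots> = a + b" using p a b by (simp add: powr_powr)
  finally show "Lp_norm M p (\<lambda>x. f x + g x) \<le> Lp_norm M p f + Lp_norm M p g + e"
    by (simp add: a_def b_def)
qed

lemma Lp_norm_cmult:
  assumes "p > 0"
  shows "Lp_norm M p (\<lambda>x. c * f x) = \<bar>c\<bar> * Lp_norm M p f"
proof -
  have "Lp_norm M p (\<lambda>x. c * f x) = (\<bar>c\<bar> powr p * (\<integral>x. \<bar>f x\<bar> powr p \<partial>M)) powr (1 / p)"
    by (simp add: Lp_norm_def abs_mult powr_mult)
  then show ?thesis using assms by (simp add: Lp_norm_def powr_mult powr_powr)
qed

text \<open>Integrates the tangent inequality \<open>1 + q (z - 1) \<le> z powr q\<close> for \<open>q = p / 2\<close> at \<open>z = f\<^sup>2 / a\<close>, where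
  \<open>a\<close> is the integral of \<open>f\<^sup>2\<close>, so that the left-hand side has integral 1.\<close>
lemma (in prob_space) L2_norm_le_Lp_norm:
  assumes p: "p \<ge> 2" and f: "f \<in> Linf M"
  shows "sqrt (\<integral>x. (f x)\<^sup>2 \<partial>M) \<le> Lp_norm M p f"
proof -
  define a where "a = (\<integral>x. (f x)\<^sup>2 \<partial>M)"
  have "a \<ge> 0" by (simp add: a_def)
  show ?thesis
  proof (cases "a = 0")
    case True
    then show ?thesis by (simp add: a_def[symmetric] Lp_norm_def)
  next
    case False
    with \<open>a \<ge> 0\<close> have a: "a > 0" by simp
    define q where "q = p / 2"
    have q: "q \<ge> 1" using p by (simp add: q_def)
    have bern: "1 + q * (z - 1) \<le> z powr q" if "z \<ge> 0" for z :: real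
    proof (cases "z = 0")
      case False
      then have "z powr q > 0" using that by simp
      then have "(z powr q) powr (1 / q) * 1 powr (1 - 1 / q) \<le> 1 / q * z powr q + (1 - 1 / q) * 1"
        using q by (intro Youngs_inequality_0) (auto simp: field_simps)
      then have "z \<le> 1 / q * z powr q + (1 - 1 / q)" using q that by (simp add: powr_powr)
      then have "q * z \<le> q * (1 / q * z powr q + (1 - 1 / q))" using q by (intro mult_left_mono) auto
      also have "\<dots> = z powr q + q - 1" using q by (simp add: distrib_left right_diff_distrib)
      finally show ?thesis by (simp add: algebra_simps)
    qed (use q in simp)
    have f2: "(\<lambda>x. (f x)\<^sup>2) \<in> Linf M" using Linf_mult[OF f f] by (simp add: power2_eq_square)
    have If2: "integrable M (\<lambda>x. (f x)\<^sup>2)" by (rule Linf_integrable[OF f2])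
    have Ip: "integrable M (\<lambda>x. \<bar>f x\<bar> powr p)" using p by (intro Linf_integrable Linf_abs_powr f) simp
    have eq: "((f x)\<^sup>2 / a) powr q = \<bar>f x\<bar> powr p / a powr q" for x
    proof -
      have "(f x)\<^sup>2 = \<bar>f x\<bar> powr 2" by (cases "f x = 0") (auto simp: powr_numeral)
      then have "(f x)\<^sup>2 powr q = (\<bar>f x\<bar> powr 2) powr q" by simp
      also have "\<dots> = \<bar>f x\<bar> powr p" unfolding powr_powr by (simp add: q_def)
      finally show ?thesis using a by (simp add: powr_divide)
    qed
    have "1 = (\<integral>x. 1 + q * ((f x)\<^sup>2 / a - 1) \<partial>M)"
      using If2 a by (simp add: a_def[symmetric] prob_space)
    also have "\<dots> \<le> (\<integral>x. \<bar>f x\<bar> powr p / a powr q \<partial>M)"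
    proof (rule integral_mono)
      show "1 + q * ((f x)\<^sup>2 / a - 1) \<le> \<bar>f x\<bar> powr p / a powr q" for x
        using bern[of "(f x)\<^sup>2 / a"] a by (simp add: eq)
    qed (use If2 Ip in auto)
    finally have "a powr q \<le> (\<integral>x. \<bar>f x\<bar> powr p \<partial>M)" using a by (simp add: field_simps)
    then have "(a powr q) powr (1 / p) \<le> Lp_norm M p f"
      unfolding Lp_norm_def using p a by (intro powr_mono2) auto
    moreover have "(a powr q) powr (1 / p) = sqrt a"
      using p a by (simp add: powr_powr q_def powr_half_sqrt)
    ultimately show ?thesis by (simp add: a_def)
  qed
qed

section \<open>Norms induced by a bounded orthonormal system\<close>

locale bounded_orthonormal_system = prob_space M for M :: "'a measure" +
  fixes \<phi> :: "nat \<Rightarrow> 'a \<Rightarrow> real"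
  assumes bounded_system: "\<And>k. \<phi> k \<in> Linf M" and orthonormal: "orthonormal_on M UNIV \<phi>"
begin

definition system_vec :: "nat \<Rightarrow> 'a \<Rightarrow> real vec" where
  "system_vec n x = vec n (\<lambda>k. \<phi> k x)"

lemma system_vec_carrier [simp]: "system_vec n x \<in> carrier_vec n"
  by (simp add: system_vec_def)

lemma J_eq_scalar_prod: "\<alpha> \<in> carrier_vec n \<Longrightarrow> J \<phi> \<alpha> x = \<alpha> \<bullet> system_vec n x"
  by (auto simp: J_def system_vec_def scalar_prod_def atLeast0LessThan)

lemma J_Linf: "J \<phi> \<alpha> \<in> Linf M"
  unfolding J_def by (intro Linf_sum Linf_mult Linf_const bounded_system)

text \<open>By orthonormality, \<open>J\<close> is an isometry from \<open>\<real>\<^sup>n\<close> into \<open>L\<^sub>2\<close>.\<close>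
lemma integral_J_mult:
  assumes "\<alpha> \<in> carrier_vec n" "\<beta> \<in> carrier_vec n"
  shows "(\<integral>x. J \<phi> \<alpha> x * J \<phi> \<beta> x \<partial>M) = \<alpha> \<bullet> \<beta>"
proof -
  have int: "integrable M (\<lambda>x. \<alpha> $ i * \<phi> i x * (\<beta> $ j * \<phi> j x))" for i j
    by (intro Linf_integrable Linf_mult Linf_const bounded_system)
  have "(\<integral>x. J \<phi> \<alpha> x * J \<phi> \<beta> x \<partial>M) = (\<integral>x. (\<Sum>i<n. \<Sum>j<n. \<alpha> $ i * \<phi> i x * (\<beta> $ j * \<phi> j x)) \<partial>M)"
    using assms by (simp add: J_def sum_product)
  also have "\<dots> = (\<Sum>i<n. \<Sum>j<n. (\<integral>x. \<alpha> $ i * \<phi> i x * (\<beta> $ j * \<phi> j x) \<partial>M))"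
    using int by simp
  also have "\<dots> = (\<Sum>i<n. \<Sum>j<n. if i = j then \<alpha> $ i * \<beta> $ j else 0)"
  proof (intro sum.cong refl)
    fix i j
    have "(\<integral>x. \<alpha> $ i * \<phi> i x * (\<beta> $ j * \<phi> j x) \<partial>M) = (\<integral>x. \<alpha> $ i * \<beta> $ j * (\<phi> i x * \<phi> j x) \<partial>M)"
      by (simp add: algebra_simps)
    also have "\<dots> = \<alpha> $ i * \<beta> $ j * (if i = j then 1 else 0)"
      using orthonormal by (simp add: orthonormal_on_def)
    finally show "(\<integral>x. \<alpha> $ i * \<phi> i x * (\<beta> $ j * \<phi> j x) \<partial>M) = (if i = j then \<alpha> $ i * \<beta> $ j else 0)" by simp
  qed
  also have "\<dots> = \<alpha> \<bullet> \<beta>" using assms by (simp add: scalar_prod_def atLeast0LessThan)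
  finally show ?thesis .
qed

lemma J_norm_seminorm:
  assumes "p \<ge> 1"
  shows "seminorm_on n (J_norm M \<phi> p)"
proof -
  have "J_norm M \<phi> p (\<alpha> + \<beta>) \<le> J_norm M \<phi> p \<alpha> + J_norm M \<phi> p \<beta>"
    if "\<alpha> \<in> carrier_vec n" "\<beta> \<in> carrier_vec n" for \<alpha> \<beta>
  proof -
    have "J \<phi> (\<alpha> + \<beta>) = (\<lambda>x. J \<phi> \<alpha> x + J \<phi> \<beta> x)"
      using that by (auto simp: J_eq_scalar_prod[of _ n] add_scalar_prod_distrib[of _ n])
    then show ?thesis using Lp_norm_triangle[OF assms J_Linf J_Linf] by (simp add: J_norm_def)
  qed
  moreover have "J_norm M \<phi> p (c \<cdot>\<^sub>v \<alpha>) = \<bar>c\<bar> * J_norm M \<phi> p \<alpha>" if "\<alpha> \<in> carrier_vec n" for c \<alpha>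
  proof -
    have "J \<phi> (c \<cdot>\<^sub>v \<alpha>) = (\<lambda>x. c * J \<phi> \<alpha> x)"
      using that by (auto simp: J_eq_scalar_prod[of _ n])
    then show ?thesis using Lp_norm_cmult[of p] assms by (simp add: J_norm_def)
  qed
  ultimately show ?thesis by (simp add: seminorm_on_def)
qed

lemma Euclidean_norm_le_J_norm:
  assumes "p \<ge> 2" "\<alpha> \<in> carrier_vec n"
  shows "sqrt (\<alpha> \<bullet> \<alpha>) \<le> J_norm M \<phi> p \<alpha>"
  using L2_norm_le_Lp_norm[OF assms(1) J_Linf, of \<alpha>] integral_J_mult[OF assms(2,2)]
  by (simp add: J_norm_def power2_eq_square)

lemma J_norm_1: "J_norm M \<phi> 1 \<alpha> = (\<integral>x. \<bar>J \<phi> \<alpha> x\<bar> \<partial>M)"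
  by (simp add: J_norm_def Lp_norm_def)

text \<open>The coefficient vectors of the functions \<open>\<xi>\<^sub>k\<close> are the columns of the frame; they are orthonormal
  because \<open>J\<close> is an isometry.\<close>
lemma essentially_bounded_frame:
  assumes "essentially_bounded M \<phi>" and c: "0 < c" "c < 1"
  obtains B where "B > 0"
    "\<And>n. n \<ge> 1 \<Longrightarrow> \<exists>m W. c * real n \<le> real m \<and> frame n m W \<and> (\<forall>k<m. AE x in M. \<bar>J \<phi> (col W k) x\<bar> \<le> B)"
proof -
  obtain B where B: "B > 0" and ex: "\<And>n. n \<ge> 1 \<Longrightarrow> \<exists>m \<xi>. real m \<ge> c * real n \<and> orthonormal_on M {..<m} \<xi>
              \<and> lin \<xi> m \<subseteq> lin \<phi> n \<and> (\<forall>k<m. Linf_norm M (\<xi> k) \<le> ereal B)"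
    using assms by (auto simp: essentially_bounded_def)
  show ?thesis
  proof (rule that[OF B])
    fix n :: nat assume "n \<ge> 1"
    then obtain m \<xi> where m: "real m \<ge> c * real n" and on: "orthonormal_on M {..<m} \<xi>"
      and lin: "lin \<xi> m \<subseteq> lin \<phi> n" and bd: "\<And>k. k < m \<Longrightarrow> Linf_norm M (\<xi> k) \<le> ereal B" using ex by metis
    have "\<exists>a. \<xi> k = (\<lambda>x. \<Sum>j<n. a j * \<phi> j x)" if "k < m" for k
    proof -
      have "\<xi> k = (\<lambda>x. \<Sum>j<m. (if j = k then 1 else 0) * \<xi> j x)"
        using that by (simp add: if_distrib[of "\<lambda>c. c * _"] cong: if_cong)
      then have "\<xi> k \<in> lin \<xi> m"
        unfolding lin_def by (intro CollectI exI[of _ "\<lambda>j. if j = k then 1 else 0"])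
      then show ?thesis using lin by (auto simp: lin_def)
    qed
    then obtain a where a: "\<And>k. k < m \<Longrightarrow> \<xi> k = (\<lambda>x. \<Sum>j<n. a k j * \<phi> j x)" by metis
    define W where "W = mat n m (\<lambda>(j, k). a k j)"
    have W: "W \<in> carrier_mat n m" by (simp add: W_def)
    have J: "J \<phi> (col W k) = \<xi> k" if "k < m" for k
      using that by (simp add: W_def J_def a)
    have "W\<^sup>T * W = 1\<^sub>m m"
    proof (rule eq_matI)
      fix i j assume "i < dim_row (1\<^sub>m m)" "j < dim_col (1\<^sub>m m)"
      then have ij: "i < m" "j < m" by auto
      have "(W\<^sup>T * W) $$ (i, j) = col W i \<bullet> col W j" using ij W by auto
      also have "\<dots> = (\<integral>x. \<xi> i x * \<xi> j x \<partial>M)"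
        using integral_J_mult[of "col W i" n "col W j"] ij W J by simp
      also have "\<dots> = 1\<^sub>m m $$ (i, j)" using on ij by (simp add: orthonormal_on_def)
      finally show "(W\<^sup>T * W) $$ (i, j) = 1\<^sub>m m $$ (i, j)" .
    qed (use W in auto)
    then have "frame n m W" using W by (simp add: frame_def)
    moreover have "\<forall>k<m. AE x in M. \<bar>J \<phi> (col W k) x\<bar> \<le> B" using bd Linf_norm_leD J by metis
    ultimately show "\<exists>m W. c * real n \<le> real m \<and> frame n m W \<and> (\<forall>k<m. AE x in M. \<bar>J \<phi> (col W k) x\<bar> \<le> B)"
      using m by blast
  qed
qed

end

locale haar_orthonormal_system = S: haar_sphere n \<mu> + bounded_orthonormal_system M \<phi>
  for n \<mu> M \<phi>
begin

text \<open>Measurability comes from the joint measurability of the integrand in \<open>\<alpha>\<close> and \<open>x\<close>.\<close>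
lemma J_norm_measurable_seminorm:
  assumes "p \<ge> 1"
  shows "S.measurable_seminorm (J_norm M \<phi> p)"
  unfolding S.measurable_seminorm_def
proof (intro conjI ballI)
  show "seminorm_on n (J_norm M \<phi> p)" using assms by (rule J_norm_seminorm)
  fix T :: "real mat" assume T: "T \<in> carrier_mat n n"
  have [measurable]: "\<phi> k \<in> borel_measurable M" for k using bounded_system by (rule Linf_measurable)
  have [measurable]: "(\<lambda>\<alpha>. \<alpha> \<bullet> row T k) \<in> borel_measurable \<mu>" if "k < n" for k
    using T that by (intro S.measurable_linear) auto
  have "(\<lambda>(\<alpha>, x). \<bar>\<Sum>k<n. (\<alpha> \<bullet> row T k) * \<phi> k x\<bar> powr p) \<in> borel_measurable (\<mu> \<Otimes>\<^sub>M M)"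
    by measurable
  then have "(\<lambda>\<alpha>. (\<integral>x. \<bar>\<Sum>k<n. (\<alpha> \<bullet> row T k) * \<phi> k x\<bar> powr p \<partial>M) powr (1 / p)) \<in> borel_measurable \<mu>"
    by measurable
  moreover have "J_norm M \<phi> p (T *\<^sub>v \<alpha>) = (\<integral>x. \<bar>\<Sum>k<n. (\<alpha> \<bullet> row T k) * \<phi> k x\<bar> powr p \<partial>M) powr (1 / p)"
    if "\<alpha> \<in> space \<mu>" for \<alpha>
  proof -
    have "(T *\<^sub>v \<alpha>) $ k = \<alpha> \<bullet> row T k" if "k < n" for k
      using that T \<open>\<alpha> \<in> space \<mu>\<close> by (auto simp: S.in_space_haar intro!: comm_scalar_prod[of _ n])
    then show ?thesis using T by (simp add: J_norm_def Lp_norm_def J_def)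
  qed
  ultimately show "(\<lambda>\<alpha>. J_norm M \<phi> p (T *\<^sub>v \<alpha>)) \<in> borel_measurable \<mu>"
    by (subst measurable_cong) auto
qed

text \<open>The mean of \<open>\<parallel>P \<alpha>\<parallel>\<^sub>1\<close> is a double integral of \<open>|\<alpha> \<bullet> P f(x)|\<close>. The integral over \<open>\<alpha>\<close> is at least a
  multiple of \<open>|P f(x)|\<close>, which Cauchy-Schwarz against \<open>W\<^sup>T f(x)\<close>, of length at most \<open>B sqrt n\<close>, bounds
  below by a function with an explicit integral, the overlap of the two frames.\<close>
lemma mean_J_norm_1_projection_ge:
  assumes U: "frame n r U" and W: "frame n m W" and B: "B > 0"
    and bound: "\<And>k. k < m \<Longrightarrow> AE x in M. \<bar>J \<phi> (col W k) x\<bar> \<le> B"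
  shows "2 / (9 * B * real n) * (real r + real m - real n) \<le> S.mean (J_norm M \<phi> 1) (U * U\<^sup>T)"
proof -
  interpret pair_sigma_finite \<mu> M ..
  have Uc: "U \<in> carrier_mat n r" and Wc: "W \<in> carrier_mat n m" using U W frame_carrier by auto
  define P where "P = U * U\<^sup>T"
  have P: "P \<in> carrier_mat n n" using Uc by (simp add: P_def)
  have Pt: "P\<^sup>T = P" unfolding P_def using Uc by (simp add: transpose_mult[of _ n r _ n])
  have Pxy: "(P *\<^sub>v x) \<bullet> y = x \<bullet> (P *\<^sub>v y)" if "x \<in> carrier_vec n" "y \<in> carrier_vec n" for x y
    using scalar_prod_transpose[OF P that] by (simp add: Pt)
  define g where "g x = P *\<^sub>v system_vec n x" for x
  have g: "g x \<in> carrier_vec n" for x unfolding g_def using P by (auto intro!: mult_mat_vec_carrier)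
  have J_P: "J \<phi> (P *\<^sub>v \<alpha>) x = \<alpha> \<bullet> g x" if "\<alpha> \<in> carrier_vec n" for \<alpha> x
    using that P Pxy[OF that] by (simp add: J_eq_scalar_prod[of _ n] g_def mult_mat_vec_carrier)
  have gi: "g x $ i = J \<phi> (row P i) x" if "i < n" for i x
    using that P by (simp add: g_def J_eq_scalar_prod[of _ n])
  have [measurable]: "J \<phi> \<beta> \<in> borel_measurable M" for \<beta> using J_Linf by (rule Linf_measurable)
  have [measurable]: "(\<lambda>\<alpha>. \<alpha> $ i) \<in> borel_measurable \<mu>" if "i < n" for i
    using that by (rule S.measurable_coordinate)
  define F where "F \<alpha> x = \<bar>\<Sum>i<n. \<alpha> $ i * J \<phi> (row P i) x\<bar>" for \<alpha> x
  have F: "F \<alpha> x = \<bar>\<alpha> \<bullet> g x\<bar>" for \<alpha> x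
  proof -
    have "dim_vec (g x) = n" using g[of x] by auto
    then show ?thesis by (simp add: F_def scalar_prod_def atLeast0LessThan gi)
  qed
  have F_meas: "(\<lambda>(\<alpha>, x). F \<alpha> x) \<in> borel_measurable (\<mu> \<Otimes>\<^sub>M M)"
    unfolding F_def by measurable
  have F_int: "(\<integral>x. F \<alpha> x \<partial>M) = J_norm M \<phi> 1 (P *\<^sub>v \<alpha>)" if "\<alpha> \<in> space \<mu>" for \<alpha>
    using that by (simp add: S.in_space_haar J_norm_1 J_P F)
  have F_integrable: "integrable (\<mu> \<Otimes>\<^sub>M M) (\<lambda>(\<alpha>, x). F \<alpha> x)"
  proof (rule Fubini_integrable[OF F_meas])
    have "integrable \<mu> (\<lambda>\<alpha>. J_norm M \<phi> 1 (P *\<^sub>v \<alpha>))"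
      using S.integrable_seminorm[OF J_norm_measurable_seminorm[of 1] P] by simp
    moreover have "(\<integral>x. norm (F \<alpha> x) \<partial>M) = J_norm M \<phi> 1 (P *\<^sub>v \<alpha>)" if "\<alpha> \<in> space \<mu>" for \<alpha>
      using F_int[OF that] by (simp add: F_def)
    ultimately show "integrable \<mu> (\<lambda>\<alpha>. \<integral>x. norm (case (\<alpha>, x) of (\<alpha>, x) \<Rightarrow> F \<alpha> x) \<partial>M)"
      by (subst Bochner_Integration.integrable_cong[OF refl, where g = "\<lambda>\<alpha>. J_norm M \<phi> 1 (P *\<^sub>v \<alpha>)"]) auto
    have "integrable M (F \<alpha>)" for \<alpha>
      unfolding F_def by (intro integrable_abs Linf_integrable Linf_sum Linf_mult Linf_const J_Linf)
    then show "AE \<alpha> in \<mu>. integrable M (\<lambda>x. case (\<alpha>, x) of (\<alpha>, x) \<Rightarrow> F \<alpha> x)" by simp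
  qed
  define h where "h x = (\<Sum>k<m. J \<phi> (col W k) x * J \<phi> (P *\<^sub>v col W k) x)" for x
  have h_int: "integrable M h"
    unfolding h_def by (intro Linf_integrable Linf_sum Linf_mult J_Linf)
  have h_eq: "h x = (W\<^sup>T *\<^sub>v system_vec n x) \<bullet> (W\<^sup>T *\<^sub>v g x)" for x
  proof -
    have "(W\<^sup>T *\<^sub>v system_vec n x) \<bullet> (W\<^sup>T *\<^sub>v g x) = (\<Sum>k<m. (col W k \<bullet> system_vec n x) * (col W k \<bullet> g x))"
      using Wc g[of x] by (simp add: scalar_prod_def[of _ "W\<^sup>T *\<^sub>v g x"] atLeast0LessThan)
    also have "\<dots> = h x"
      unfolding h_def using Wc P
      by (intro sum.cong refl) (simp add: J_eq_scalar_prod[of _ n] Pxy g_def mult_mat_vec_carrier)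
    finally show ?thesis by simp
  qed
  have "2 / (9 * B * real n) * (real r + real m - real n) \<le> 2 / (9 * B * real n) * (\<integral>x. h x \<partial>M)"
  proof (rule mult_left_mono)
    have "(\<integral>x. h x \<partial>M) = (\<Sum>k<m. col W k \<bullet> (P *\<^sub>v col W k))"
      unfolding h_def using Wc P
      by (subst Bochner_Integration.integral_sum) (auto intro!: Linf_integrable Linf_mult J_Linf sum.cong
          integral_J_mult mult_mat_vec_carrier)
    also have "\<dots> = (\<Sum>k<m. (U\<^sup>T *\<^sub>v col W k) \<bullet> (U\<^sup>T *\<^sub>v col W k))"
    proof (intro sum.cong refl)
      fix k assume "k \<in> {..<m}"
      then have c: "col W k \<in> carrier_vec n" using Wc by auto
      have "P *\<^sub>v col W k = U *\<^sub>v (U\<^sup>T *\<^sub>v col W k)"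
        unfolding P_def using Uc c by (simp add: assoc_mult_mat_vec[of _ n r _ n])
      then show "col W k \<bullet> (P *\<^sub>v col W k) = (U\<^sup>T *\<^sub>v col W k) \<bullet> (U\<^sup>T *\<^sub>v col W k)"
        using scalar_prod_transpose[OF Uc c, of "U\<^sup>T *\<^sub>v col W k"] Uc c by auto
    qed
    finally show "real r + real m - real n \<le> (\<integral>x. h x \<partial>M)" using frame_overlap[OF U W] by simp
  qed (use B in auto)
  also have "\<dots> = (\<integral>x. 2 / (9 * B * real n) * h x \<partial>M)" by simp
  also have "\<dots> \<le> (\<integral>x. (\<integral>\<alpha>. F \<alpha> x \<partial>\<mu>) \<partial>M)"
  proof (rule integral_mono_AE)
    show "integrable M (\<lambda>x. 2 / (9 * B * real n) * h x)" using h_int by simp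
    show "integrable M (\<lambda>x. \<integral>\<alpha>. F \<alpha> x \<partial>\<mu>)" using integrable_snd[OF F_integrable] .
    have "AE x in M. \<forall>k\<in>{..<m}. \<bar>J \<phi> (col W k) x\<bar> \<le> B"
      by (intro AE_finite_allI) (use bound in auto)
    then show "AE x in M. 2 / (9 * B * real n) * h x \<le> (\<integral>\<alpha>. F \<alpha> x \<partial>\<mu>)"
    proof eventually_elim
      fix x assume bd: "\<forall>k\<in>{..<m}. \<bar>J \<phi> (col W k) x\<bar> \<le> B"
      define a where "a = W\<^sup>T *\<^sub>v system_vec n x"
      define b where "b = W\<^sup>T *\<^sub>v g x"
      have ab: "a \<in> carrier_vec m" "b \<in> carrier_vec m"
        using Wc g[of x] by (auto simp: a_def b_def intro!: mult_mat_vec_carrier[of _ m n])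
      have "a \<bullet> a = (\<Sum>k<m. (J \<phi> (col W k) x)\<^sup>2)"
        unfolding scalar_prod_self_sum[OF ab(1)] using Wc
        by (intro sum.cong refl) (simp add: a_def J_eq_scalar_prod[of _ n])
      also have "\<dots> \<le> (\<Sum>k<m. B\<^sup>2)"
        using bd B by (intro sum_mono) (simp add: abs_le_square_iff[symmetric])
      also have "\<dots> \<le> real n * B\<^sup>2" using frame_le[OF W] by (simp add: mult_right_mono)
      finally have aa: "a \<bullet> a \<le> real n * B\<^sup>2" .
      have bb: "b \<bullet> b \<le> g x \<bullet> g x" unfolding b_def by (rule Bessel_inequality[OF W g])
      have "(h x)\<^sup>2 \<le> (a \<bullet> a) * (b \<bullet> b)"
        using scalar_prod_Cauchy_Schwarz[OF ab] by (simp add: h_eq a_def b_def)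
      also have "\<dots> \<le> (real n * B\<^sup>2) * (g x \<bullet> g x)"
        using aa bb by (intro mult_mono scalar_prod_self_nonneg) auto
      finally have "\<bar>h x\<bar> \<le> sqrt (real n * B\<^sup>2 * (g x \<bullet> g x))" by (rule real_le_rsqrt[of "\<bar>h x\<bar>", simplified])
      then have hx: "h x \<le> sqrt n * B * sqrt (g x \<bullet> g x)" using B by (simp add: real_sqrt_mult)
      have "2 / (9 * B * real n) * h x \<le> 2 / (9 * B * real n) * (sqrt n * B * sqrt (g x \<bullet> g x))"
        using hx B by (intro mult_left_mono) auto
      also have "\<dots> = 2 / 9 * sqrt (g x \<bullet> g x) / sqrt n"
      proof -
        define q where "q = sqrt (real n)"
        have q: "q > 0" "real n = q * q" using S.dim_pos by (auto simp: q_def)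
        show ?thesis unfolding q_def[symmetric] q(2) using q(1) B by (simp add: field_simps)
      qed
      also have "\<dots> \<le> (\<integral>\<alpha>. F \<alpha> x \<partial>\<mu>)" unfolding F by (rule S.abs_linear_form_mean_ge[OF g])
      finally show "2 / (9 * B * real n) * h x \<le> (\<integral>\<alpha>. F \<alpha> x \<partial>\<mu>)" .
    qed
  qed
  also have "\<dots> = (\<integral>\<alpha>. (\<integral>x. F \<alpha> x \<partial>M) \<partial>\<mu>)" by (rule Fubini_integral[OF F_integrable])
  also have "\<dots> = S.mean (J_norm M \<phi> 1) P"
    unfolding S.mean_def by (intro Bochner_Integration.integral_cong refl F_int)
  finally show ?thesis by (simp add: P_def)
qed

end

section \<open>The Grassmannian as the set of ranges of frames\<close>

definition mat_range :: "real mat \<Rightarrow> real vec set" where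
  "mat_range U = {U *\<^sub>v x | x. x \<in> carrier_vec (dim_col U)}"

lemma zero_in_mat_range:
  assumes "U \<in> carrier_mat n r"
  shows "0\<^sub>v n \<in> mat_range U"
proof -
  have "0\<^sub>v n = U *\<^sub>v 0\<^sub>v r" using assms by auto
  then show ?thesis using assms unfolding mat_range_def by (intro CollectI exI[of _ "0\<^sub>v r"]) auto
qed

text \<open>Orthonormal columns are distinct and linearly independent, so they are a basis of the range.\<close>
lemma mat_range_grassmannian:
  assumes U: "frame n r U"
  shows "mat_range U \<in> grassmannian r n"
proof -
  interpret vec_space "TYPE(real)" n .
  have Uc: "U \<in> carrier_mat n r" using U by (rule frame_carrier)
  have inj: "x = 0\<^sub>v r" if "x \<in> carrier_vec r" "U *\<^sub>v x = 0\<^sub>v n" for x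
    using frame_transpose_mult[OF U that(1)] that(2) Uc by auto
  have dist: "distinct (cols U)"
  proof (subst distinct_conv_nth, intro allI impI)
    fix i j assume ij: "i < length (cols U)" "j < length (cols U)" "i \<noteq> j"
    then have ij': "i < r" "j < r" using Uc by auto
    have "(U\<^sup>T * U) $$ (i, j) = 0" "(U\<^sup>T * U) $$ (i, i) = 1"
      using ij' ij(3) U by (simp_all add: frame_def)
    moreover have "(U\<^sup>T * U) $$ (i, j) = col U i \<bullet> col U j" "(U\<^sup>T * U) $$ (i, i) = col U i \<bullet> col U i"
      using ij' Uc by auto
    ultimately show "cols U ! i \<noteq> cols U ! j" using ij by auto
  qed
  have indep: "lin_indpt (set (cols U))"
  proof
    assume "lin_dep (set (cols U))"
    from lin_depE[OF Uc this dist] inj show False by metis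
  qed
  have rank: "rank U = r" by (rule lin_indpt_full_rank[OF Uc dist indep])
  have cols: "set (cols U) \<subseteq> carrier_vec n" using Uc cols_dim by blast
  have range: "mat_range U = span (set (cols U))"
    using col_space_eq[OF Uc] Uc by (auto simp: mat_range_def col_space_def)
  show ?thesis
    using rank span_is_subspace[of "set (cols U)"] cols
    unfolding grassmannian_def range rank_def by auto
qed

lemma frame_extend:
  assumes U: "frame n k U" and w: "w \<in> carrier_vec n" "w \<bullet> w = 1" and orth: "U\<^sup>T *\<^sub>v w = 0\<^sub>v k"
  obtains V where "frame n (Suc k) V"
    "\<And>z. z \<in> carrier_vec (Suc k) \<Longrightarrow> V *\<^sub>v z = U *\<^sub>v vec k (\<lambda>i. z $ i) + (z $ k) \<cdot>\<^sub>v w"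
proof -
  have Uc: "U \<in> carrier_mat n k" using U by (rule frame_carrier)
  define V where "V = mat n (Suc k) (\<lambda>(i, j). if j < k then U $$ (i, j) else w $ i)"
  have V: "V \<in> carrier_mat n (Suc k)" by (simp add: V_def)
  have Vz: "V *\<^sub>v z = U *\<^sub>v vec k (\<lambda>i. z $ i) + (z $ k) \<cdot>\<^sub>v w" if "z \<in> carrier_vec (Suc k)" for z
  proof (rule eq_vecI)
    fix i assume "i < dim_vec (U *\<^sub>v vec k (\<lambda>i. z $ i) + (z $ k) \<cdot>\<^sub>v w)"
    then have i: "i < n" using w by auto
    then show "(V *\<^sub>v z) $ i = (U *\<^sub>v vec k (\<lambda>i. z $ i) + (z $ k) \<cdot>\<^sub>v w) $ i"
      using that Uc w by (simp add: V_def scalar_prod_def atLeast0LessThan)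
  qed (use V Uc w in auto)
  have "frame n (Suc k) V"
  proof (rule frameI_isometry[OF V])
    fix z :: "real vec" assume z: "z \<in> carrier_vec (Suc k)"
    define y where "y = vec k (\<lambda>i. z $ i)"
    have y: "y \<in> carrier_vec k" by (simp add: y_def)
    have Uy: "U *\<^sub>v y \<in> carrier_vec n" using Uc y by auto
    have "w \<bullet> (U *\<^sub>v y) = 0" using scalar_prod_transpose[OF Uc w(1) y] orth y by simp
    then have "(V *\<^sub>v z) \<bullet> (V *\<^sub>v z) = y \<bullet> y + (z $ k)\<^sup>2"
      unfolding Vz[OF z] y_def[symmetric] scalar_prod_self_combination[OF Uy w(1)]
      by (simp add: w frame_isometry[OF U y y])
    also have "\<dots> = z \<bullet> z"
      unfolding scalar_prod_self_sum[OF y] scalar_prod_self_sum[OF z] by (simp add: y_def)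
    finally show "(V *\<^sub>v z) \<bullet> (V *\<^sub>v z) = z \<bullet> z" .
  qed
  then show ?thesis using that Vz by blast
qed

text \<open>A frame of maximal size with range inside \<open>L\<close> has range \<open>L\<close>: otherwise the component of some vector
  of \<open>L\<close> orthogonal to the range could be normalized and appended.\<close>
lemma subspace_eq_mat_range:
  assumes L: "subspace class_ring L (module_vec TYPE(real) n)"
  obtains k U where "frame n k U" "L = mat_range U"
proof -
  interpret vec_space "TYPE(real)" n .
  have sub: "submodule class_ring L (module_vec TYPE(real) n)" using L by (simp add: subspace_def)
  have Lc: "L \<subseteq> carrier_vec n" using sub by (auto simp: submodule_def)
  have add: "x + y \<in> L" if "x \<in> L" "y \<in> L" for x y using submodule.m_closed[OF sub that] by simp
  have smult: "c \<cdot>\<^sub>v x \<in> L" if "x \<in> L" for c x using submodule.smult_closed[OF sub _ that, of c] by simp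
  have zero: "0\<^sub>v n \<in> L" using submodule.zero_closed[OF sub] by simp
  define P where "P k \<longleftrightarrow> (\<exists>U. frame n k U \<and> mat_range U \<subseteq> L)" for k
  have "frame n 0 (mat n 0 (\<lambda>_. 0))" by (auto simp: frame_def)
  moreover have "mat_range (mat n 0 (\<lambda>_. 0)) \<subseteq> L"
  proof -
    have "mat n 0 (\<lambda>_. 0) *\<^sub>v x = 0\<^sub>v n" if "x \<in> carrier_vec 0" for x :: "real vec"
      using that by (intro eq_vecI) (auto simp: scalar_prod_def)
    then show ?thesis using zero by (auto simp: mat_range_def)
  qed
  ultimately have "P 0" by (auto simp: P_def)
  moreover have le: "k \<le> n" if "P k" for k using that frame_le by (auto simp: P_def)
  ultimately obtain k where k: "P k" and max: "\<And>j. P j \<Longrightarrow> j \<le> k"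
    using GreatestI_nat[of P 0 n] Greatest_le_nat[of P _ n] by blast
  from k obtain U where U: "frame n k U" and UL: "mat_range U \<subseteq> L" by (auto simp: P_def)
  have Uc: "U \<in> carrier_mat n k" using U by (rule frame_carrier)
  have "L \<subseteq> mat_range U"
  proof
    fix x assume x: "x \<in> L"
    then have xc: "x \<in> carrier_vec n" using Lc by auto
    have Utx: "U\<^sup>T *\<^sub>v x \<in> carrier_vec k" using Uc xc by auto
    define p where "p = U *\<^sub>v (U\<^sup>T *\<^sub>v x)"
    have p: "p \<in> carrier_vec n" using Uc Utx by (auto simp: p_def)
    have pr: "p \<in> mat_range U" using Uc Utx by (auto simp: mat_range_def p_def)
    define y where "y = x - p"
    have y: "y \<in> carrier_vec n" using xc p by (simp add: y_def)
    have yL: "y \<in> L"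
      unfolding y_def minus_eq_plus_smult[OF xc p] using x pr UL smult add by blast
    have Uty: "U\<^sup>T *\<^sub>v y = 0\<^sub>v k"
    proof -
      have "U\<^sup>T *\<^sub>v y = U\<^sup>T *\<^sub>v x - U\<^sup>T *\<^sub>v p"
        unfolding y_def using Uc xc p by (intro mult_minus_distrib_mat_vec[of _ k n]) auto
      also have "U\<^sup>T *\<^sub>v p = U\<^sup>T *\<^sub>v x" unfolding p_def by (rule frame_transpose_mult[OF U Utx])
      finally show ?thesis using Utx by auto
    qed
    have "y = 0\<^sub>v n"
    proof (rule ccontr)
      assume ne: "y \<noteq> 0\<^sub>v n"
      then have yy: "y \<bullet> y > 0" using scalar_prod_self_pos y by blast
      define w where "w = (1 / sqrt (y \<bullet> y)) \<cdot>\<^sub>v y"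
      have w: "w \<in> carrier_vec n" "w \<bullet> w = 1" using y yy by (auto simp: w_def)
      have "U\<^sup>T *\<^sub>v w = 0\<^sub>v k"
        unfolding w_def using mult_mat_vec[of "U\<^sup>T" k n y] Uc y Uty by auto
      then obtain V where V: "frame n (Suc k) V"
        "\<And>z. z \<in> carrier_vec (Suc k) \<Longrightarrow> V *\<^sub>v z = U *\<^sub>v vec k (\<lambda>i. z $ i) + (z $ k) \<cdot>\<^sub>v w"
        using frame_extend[OF U w] by blast
      have "mat_range V \<subseteq> L"
      proof
        fix v assume "v \<in> mat_range V"
        then obtain z where z: "z \<in> carrier_vec (Suc k)" "v = V *\<^sub>v z"
          using frame_carrier[OF V(1)] by (auto simp: mat_range_def)
        have "U *\<^sub>v vec k (\<lambda>i. z $ i) \<in> mat_range U"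
          using Uc unfolding mat_range_def by (intro CollectI exI[of _ "vec k (\<lambda>i. z $ i)"]) auto
        then have "U *\<^sub>v vec k (\<lambda>i. z $ i) \<in> L" using UL by blast
        moreover have "(z $ k) \<cdot>\<^sub>v w \<in> L" unfolding w_def by (intro smult yL)
        ultimately show "v \<in> L" unfolding z(2) V(2)[OF z(1)] by (rule add)
      qed
      then have "P (Suc k)" using V(1) by (auto simp: P_def)
      then show False using max by fastforce
    qed
    then have "x = p"
    proof -
      assume y0: "y = 0\<^sub>v n"
      have "x = p + y" unfolding y_def using xc p by (intro eq_vecI) auto
      then show ?thesis using y0 p by simp
    qed
    then show "x \<in> mat_range U" using pr by simp
  qed
  then show ?thesis using that U UL by blast
qed

lemma grassmannianE:
  assumes "L \<in> grassmannian r n"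
  obtains U where "frame n r U" "L = mat_range U"
proof -
  have "subspace class_ring L (module_vec TYPE(real) n)" using assms by (simp add: grassmannian_def)
  then obtain k U where U: "frame n k U" "L = mat_range U" by (rule subspace_eq_mat_range)
  have "L \<in> grassmannian k n" using mat_range_grassmannian U by simp
  then have "k = r" using assms by (simp add: grassmannian_def)
  then show ?thesis using U that by blast
qed

text \<open>The entries of a frame are bounded by 1, and the defining equations pass to the limit.\<close>
lemma frame_sequence_compact:
  assumes V: "\<And>k::nat. frame n r (V k)"
  obtains s U where "strict_mono s" "frame n r U"
    "\<forall>i<n. \<forall>j<r. (\<lambda>k. V (s k) $$ (i, j)) \<longlonglongrightarrow> U $$ (i, j)"
proof -
  have Vc: "V k \<in> carrier_mat n r" for k using V by (rule frame_carrier)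
  have entry: "\<bar>V k $$ (i, j)\<bar> \<le> 1" if "i < n" "j < r" for i j k
  proof -
    have c: "col (V k) j \<in> carrier_vec n" using Vc[of k] that by auto
    have "(V k $$ (i, j))\<^sup>2 \<le> (\<Sum>i<n. (col (V k) j $ i)\<^sup>2)"
      using that Vc[of k] member_le_sum[of i "{..<n}" "\<lambda>i. (col (V k) j $ i)\<^sup>2"] by simp
    also have "\<dots> = 1" using scalar_prod_self_sum[OF c] frame_col_norm[OF V that(2)] by simp
    finally show ?thesis by (simp add: abs_square_le_1)
  qed
  define f where "f k ij = V k $$ ij" for k and ij :: "nat \<times> nat"
  let ?I = "{..<n} \<times> {..<r}"
  have "\<forall>d\<subseteq>?I. \<exists>l s. strict_mono s \<and> (\<forall>e>0. \<forall>\<^sub>F k in sequentially. \<forall>i\<in>d. dist (f (s k) i) (l i) < e)"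
  proof (rule compact_lemma_general[where proj = "\<lambda>x. x" and unproj = "\<lambda>x. x"])
    fix ij assume "ij \<in> ?I"
    then show "bounded ((\<lambda>x. x ij) ` range f)"
      using entry by (auto simp: bounded_iff f_def image_iff intro!: exI[of _ 1])
  qed auto
  then obtain l s where s: "strict_mono s"
    and lim: "\<And>e. e > 0 \<Longrightarrow> \<forall>\<^sub>F k in sequentially. \<forall>i\<in>?I. dist (f (s k) i) (l i) < e" by blast
  define U where "U = mat n r l"
  have Uc: "U \<in> carrier_mat n r" by (simp add: U_def)
  have conv: "(\<lambda>k. V (s k) $$ (i, j)) \<longlonglongrightarrow> U $$ (i, j)" if "i < n" "j < r" for i j
  proof (rule tendstoI)
    fix e :: real assume "e > 0"
    from lim[OF this] show "\<forall>\<^sub>F k in sequentially. dist (V (s k) $$ (i, j)) (U $$ (i, j)) < e"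
      by eventually_elim (use that in \<open>auto simp: f_def U_def\<close>)
  qed
  have "U\<^sup>T * U = 1\<^sub>m r"
  proof (rule eq_matI)
    fix i j assume "i < dim_row (1\<^sub>m r)" "j < dim_col (1\<^sub>m r)"
    then have ij: "i < r" "j < r" by auto
    have prod: "(A\<^sup>T * A) $$ (i, j) = (\<Sum>a<n. A $$ (a, i) * A $$ (a, j))" if "A \<in> carrier_mat n r" for A :: "real mat"
      using that ij by (simp add: scalar_prod_def atLeast0LessThan)
    have "(\<lambda>k. ((V (s k))\<^sup>T * V (s k)) $$ (i, j)) \<longlonglongrightarrow> (U\<^sup>T * U) $$ (i, j)"
      unfolding prod[OF Vc] prod[OF Uc] using ij by (intro tendsto_intros conv) auto
    moreover have "((V (s k))\<^sup>T * V (s k)) $$ (i, j) = 1\<^sub>m r $$ (i, j)" for k using V[of "s k"] by (simp add: frame_def)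
    ultimately show "(U\<^sup>T * U) $$ (i, j) = 1\<^sub>m r $$ (i, j)" by (simp add: LIMSEQ_const_iff)
  qed (use Uc in auto)
  then have "frame n r U" using Uc by (simp add: frame_def)
  then show ?thesis using that s conv by blast
qed

lemma mult_mat_vec_tendsto:
  fixes V :: "nat \<Rightarrow> real mat"
  assumes V: "\<And>k. V k \<in> carrier_mat n r" and U: "U \<in> carrier_mat n r" and a: "a \<in> carrier_vec r"
    and conv: "\<And>i j. i < n \<Longrightarrow> j < r \<Longrightarrow> (\<lambda>k. V k $$ (i, j)) \<longlonglongrightarrow> U $$ (i, j)"
    and i: "i < n"
  shows "(\<lambda>k. (V k *\<^sub>v a) $ i) \<longlonglongrightarrow> (U *\<^sub>v a) $ i"
proof -
  have prod: "(A *\<^sub>v a) $ i = (\<Sum>j<r. A $$ (i, j) * a $ j)" if "A \<in> carrier_mat n r" for A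
    using that i a by (simp add: scalar_prod_def atLeast0LessThan)
  show ?thesis unfolding prod[OF V] prod[OF U] using i by (intro tendsto_intros conv) auto
qed

section \<open>Attainment of the minimal radius of a section\<close>

text \<open>In the application \<open>N\<close> is the \<open>L\<^sub>1\<close> norm, and the unit ball of \<open>G\<close> is the image of the \<open>L\<^sub>p\<close> ball under
  \<open>A\<close>. The coercivity assumption makes this ball bounded.\<close>
locale seminorm_pair =
  fixes n :: nat and N G :: "real vec \<Rightarrow> real" and c :: real
  assumes N: "seminorm_on n N" and G: "seminorm_on n G" and c: "c > 0"
    and coercive: "\<And>x. x \<in> carrier_vec n \<Longrightarrow> c * sqrt (x \<bullet> x) \<le> G x"
begin

definition section_rad :: "real vec set \<Rightarrow> real" where
  "section_rad L = rad ({\<alpha> \<in> carrier_vec n. G \<alpha> \<le> 1} \<inter> L) N"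

lemma unit_ball_bdd_above: "bdd_above (N ` ({\<alpha> \<in> carrier_vec n. G \<alpha> \<le> 1} \<inter> L))"
proof (rule bdd_aboveI2)
  fix \<alpha> assume "\<alpha> \<in> {\<alpha> \<in> carrier_vec n. G \<alpha> \<le> 1} \<inter> L"
  then have a: "\<alpha> \<in> carrier_vec n" "G \<alpha> \<le> 1" by auto
  have "c * sqrt (\<alpha> \<bullet> \<alpha>) \<le> 1" using coercive[OF a(1)] a(2) by simp
  then have s: "sqrt (\<alpha> \<bullet> \<alpha>) \<le> 1 / c" using c by (simp add: field_simps)
  have "N \<alpha> \<le> (\<Sum>i<n. \<bar>\<alpha> $ i\<bar> * N (unit_vec n i))" by (rule seminorm_le_coordinate_sum[OF N a(1)])
  also have "\<dots> \<le> (\<Sum>i<n. 1 / c * N (unit_vec n i))"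
  proof (intro sum_mono mult_right_mono)
    fix i assume i: "i \<in> {..<n}"
    have "(\<alpha> $ i)\<^sup>2 \<le> (\<Sum>i<n. (\<alpha> $ i)\<^sup>2)" using i by (intro member_le_sum) auto
    then have "\<bar>\<alpha> $ i\<bar> \<le> sqrt (\<alpha> \<bullet> \<alpha>)"
      unfolding scalar_prod_self_sum[OF a(1)] by (metis real_sqrt_abs real_sqrt_le_iff)
    then show "\<bar>\<alpha> $ i\<bar> \<le> 1 / c" using s by simp
    show "0 \<le> N (unit_vec n i)" by (rule seminorm_nonneg[OF N]) simp
  qed
  finally show "N \<alpha> \<le> (\<Sum>i<n. 1 / c * N (unit_vec n i))" .
qed

text \<open>By homogeneity the radius bounds the quotient \<open>N / G\<close> on the whole subspace.\<close>
lemma section_rad_upper: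
  assumes U: "U \<in> carrier_mat n r" and x: "x \<in> mat_range U"
  shows "N x \<le> section_rad (mat_range U) * G x"
proof -
  obtain y where y: "y \<in> carrier_vec r" "x = U *\<^sub>v y" using x U by (auto simp: mat_range_def)
  have xc: "x \<in> carrier_vec n" using y U by auto
  show ?thesis
  proof (cases "G x = 0")
    case True
    then have "sqrt (x \<bullet> x) \<le> 0" using coercive[OF xc] c by (simp add: mult_le_0_iff)
    then have "x \<bullet> x = 0" using scalar_prod_self_nonneg[of x] by simp
    then have "x = 0\<^sub>v n" using scalar_prod_self_eq_0D[OF xc] by simp
    then show ?thesis using True seminorm_zero[OF N] by simp
  next
    case False
    then have pos: "G x > 0" using seminorm_nonneg[OF G xc] by simp
    define z where "z = (1 / G x) \<cdot>\<^sub>v x"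
    have zc: "z \<in> carrier_vec n" using xc by (simp add: z_def)
    have "z = U *\<^sub>v ((1 / G x) \<cdot>\<^sub>v y)" unfolding z_def y(2) using mult_mat_vec[OF U y(1)] by simp
    then have zr: "z \<in> mat_range U" using y U unfolding mat_range_def by (intro CollectI exI[of _ "(1 / G x) \<cdot>\<^sub>v y"]) auto
    have Gz: "G z = 1" unfolding z_def seminorm_smult[OF G xc] using pos by simp
    have "N z \<le> section_rad (mat_range U)"
      unfolding section_rad_def rad_def using zc Gz zr by (intro cSUP_upper unit_ball_bdd_above) auto
    then show ?thesis unfolding z_def seminorm_smult[OF N xc] using pos by (simp add: field_simps)
  qed
qed

lemma section_rad_least:
  assumes U: "U \<in> carrier_mat n r"
    and bound: "\<And>x. x \<in> mat_range U \<Longrightarrow> G x \<le> 1 \<Longrightarrow> N x \<le> t"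
  shows "section_rad (mat_range U) \<le> t"
  unfolding section_rad_def rad_def
proof (rule cSUP_least)
  have "0\<^sub>v n \<in> {\<alpha> \<in> carrier_vec n. G \<alpha> \<le> 1} \<inter> mat_range U"
    using zero_in_mat_range[OF U] seminorm_zero[OF G] by simp
  then show "{\<alpha> \<in> carrier_vec n. G \<alpha> \<le> 1} \<inter> mat_range U \<noteq> {}" by blast
qed (use bound in auto)

lemma section_rad_nonneg:
  assumes U: "U \<in> carrier_mat n r"
  shows "0 \<le> section_rad (mat_range U)"
proof -
  have "N (0\<^sub>v n) \<le> section_rad (mat_range U)"
    unfolding section_rad_def rad_def using zero_in_mat_range[OF U] seminorm_zero[OF G] by (intro cSUP_upper unit_ball_bdd_above) auto
  then show ?thesis using seminorm_zero[OF N] by simp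
qed

text \<open>A minimizing sequence of subspaces has orthonormal frames, some subsequence of which converges to
  a frame \<open>U\<close>. A vector \<open>U y\<close> is the limit of the vectors with the same coordinates \<open>y\<close> in the approximating
  subspaces, and the inequality \<open>N \<le> radius * G\<close> valid there passes to the limit.\<close>
lemma section_rad_attains_minimum:
  assumes r: "r \<le> n"
  obtains L where "is_arg_min section_rad (\<lambda>L. L \<in> grassmannian r n) L"
proof -
  let ?S = "section_rad ` grassmannian r n"
  define U0 where "U0 = mat n r (\<lambda>(i, j). if i = j then 1 else (0 :: real))"
  have "frame n r U0"
  proof -
    have "U0\<^sup>T * U0 = 1\<^sub>m r"
    proof (rule eq_matI)
      fix i j assume "i < dim_row (1\<^sub>m r)" "j < dim_col (1\<^sub>m r)"
      then have ij: "i < r" "j < r" by auto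
      have "(U0\<^sup>T * U0) $$ (i, j) = (\<Sum>a<n. (if a = i then 1 else 0) * (if a = j then 1 else 0))"
        using ij by (simp add: U0_def scalar_prod_def atLeast0LessThan)
      also have "\<dots> = (\<Sum>a<n. if a = i then if i = j then 1 else 0 else 0)"
        by (intro sum.cong) auto
      finally show "(U0\<^sup>T * U0) $$ (i, j) = 1\<^sub>m r $$ (i, j)" using ij r by simp
    qed (auto simp: U0_def)
    then show ?thesis by (auto simp: frame_def U0_def)
  qed
  then have ne: "?S \<noteq> {}" using mat_range_grassmannian by blast
  have nonneg: "0 \<le> section_rad L" if "L \<in> grassmannian r n" for L
    using that section_rad_nonneg frame_carrier by (metis grassmannianE)
  then have bdd: "bdd_below ?S" by (intro bdd_belowI2)
  define t where "t = Inf ?S"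
  have "\<exists>U. frame n r U \<and> section_rad (mat_range U) < t + 1 / real (Suc k)" for k
  proof -
    have "t < t + 1 / real (Suc k)" by simp
    then obtain L where "L \<in> grassmannian r n" "section_rad L < t + 1 / real (Suc k)"
      using cInf_lessD[OF ne] unfolding t_def by blast
    then show ?thesis by (metis grassmannianE)
  qed
  then obtain V where V: "\<And>k. frame n r (V k)" and Vt: "\<And>k. section_rad (mat_range (V k)) < t + 1 / real (Suc k)" by metis
  obtain s U where s: "strict_mono s" and U: "frame n r U"
    and conv: "\<forall>i<n. \<forall>j<r. (\<lambda>k. V (s k) $$ (i, j)) \<longlonglongrightarrow> U $$ (i, j)"
    by (rule frame_sequence_compact[where V = V, OF V])
  have Vc: "V k \<in> carrier_mat n r" for k using V by (rule frame_carrier)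
  have Uc: "U \<in> carrier_mat n r" using U by (rule frame_carrier)
  have t0: "t \<ge> 0" unfolding t_def by (rule cInf_greatest[OF ne]) (use nonneg in auto)
  have "section_rad (mat_range U) \<le> t"
  proof (rule section_rad_least[OF Uc])
    fix x assume x: "x \<in> mat_range U" and Gx: "G x \<le> 1"
    obtain y where y: "y \<in> carrier_vec r" "x = U *\<^sub>v y" using x Uc by (auto simp: mat_range_def)
    have xc: "x \<in> carrier_vec n" using y Uc by auto
    define z where "z k = V (s k) *\<^sub>v y" for k
    have zc: "z k \<in> carrier_vec n" for k using Vc[of "s k"] y by (auto simp: z_def)
    have zr: "z k \<in> mat_range (V (s k))" for k using Vc[of "s k"] y by (auto simp: z_def mat_range_def)
    have lim: "(\<lambda>k. z k $ i) \<longlonglongrightarrow> x $ i" if "i < n" for i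
      unfolding z_def y(2) by (rule mult_mat_vec_tendsto[OF Vc Uc y(1) conv[rule_format] that])
    have "N x \<le> t * G x"
    proof (rule LIMSEQ_le)
      show "(\<lambda>k. N (z k)) \<longlonglongrightarrow> N x" by (rule seminorm_tendsto[OF N xc zc lim])
      have "(\<lambda>k. 1 / real (Suc (s k))) \<longlonglongrightarrow> 0"
        using LIMSEQ_subseq_LIMSEQ[OF LIMSEQ_inverse_real_of_nat s] by (simp add: o_def inverse_eq_divide)
      then have "(\<lambda>k. (t + 1 / real (Suc (s k))) * G (z k)) \<longlonglongrightarrow> (t + 0) * G x"
        by (intro tendsto_intros seminorm_tendsto[OF G xc zc lim])
      then show "(\<lambda>k. (t + 1 / real (Suc (s k))) * G (z k)) \<longlonglongrightarrow> t * G x" by simp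
      have "N (z k) \<le> (t + 1 / real (Suc (s k))) * G (z k)" for k
        using section_rad_upper[OF Vc zr] mult_right_mono[OF less_imp_le[OF Vt[of "s k"]] seminorm_nonneg[OF G zc[of k]]]
        by (rule order_trans)
      then show "\<exists>k0. \<forall>k\<ge>k0. N (z k) \<le> (t + 1 / real (Suc (s k))) * G (z k)" by blast
    qed
    also have "\<dots> \<le> t" using mult_left_mono[OF Gx t0] by simp
    finally show "N x \<le> t" .
  qed
  moreover have "t \<le> section_rad L" if "L \<in> grassmannian r n" for L
    unfolding t_def using that bdd by (intro cInf_lower) auto
  ultimately have "is_arg_min section_rad (\<lambda>L. L \<in> grassmannian r n) (mat_range U)"
    using mat_range_grassmannian[OF U] by (fastforce simp: is_arg_min_def)
  then show ?thesis by (rule that)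
qed

end

section \<open>The spectral radius and the operator norm\<close>

text \<open>A maximizer of \<open>|B x|\<^sup>2\<close> on the sphere exists by compactness and is an eigenvector of \<open>B\<^sup>T B\<close> whose
  eigenvalue is the maximum. The unit sphere is treated as the set of frames with one column.\<close>
lemma spectral_radius_bounds_norm:
  fixes B :: "real mat"
  assumes B: "B \<in> carrier_mat n n" and n: "n \<ge> 1" and x: "x \<in> carrier_vec n"
  shows "(B *\<^sub>v x) \<bullet> (B *\<^sub>v x) \<le> spectral_radius (map_mat complex_of_real (B\<^sup>T * B)) * (x \<bullet> x)"
proof -
  define S where "S = B\<^sup>T * B"
  have S: "S \<in> carrier_mat n n" using B by (simp add: S_def)
  define q where "q x = (B *\<^sub>v x) \<bullet> (B *\<^sub>v x)" for x
  have Bx: "B *\<^sub>v x \<in> carrier_vec n" if "x \<in> carrier_vec n" for x using B that by auto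
  have qs: "q (a \<cdot>\<^sub>v x) = a\<^sup>2 * q x" if "x \<in> carrier_vec n" for a x
    unfolding q_def mult_mat_vec[OF B that] using Bx[OF that] by (simp add: power2_eq_square)
  define K where "K = (\<Sum>i<n. row B i \<bullet> row B i)"
  have qK: "q x \<le> K * (x \<bullet> x)" if x: "x \<in> carrier_vec n" for x
  proof -
    have "q x = (\<Sum>i<n. (row B i \<bullet> x)\<^sup>2)"
      unfolding q_def scalar_prod_self_sum[OF Bx[OF x]] using B by simp
    also have "\<dots> \<le> (\<Sum>i<n. (row B i \<bullet> row B i) * (x \<bullet> x))"
      using B x by (intro sum_mono scalar_prod_Cauchy_Schwarz) auto
    finally show ?thesis by (simp add: K_def sum_distrib_right)
  qed
  define Q where "Q = q ` unit_sphere n"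
  have ne: "Q \<noteq> {}" using n by (auto simp: Q_def unit_sphere_def intro!: exI[of _ "unit_vec n 0"])
  have bdd: "bdd_above Q" unfolding Q_def by (rule bdd_aboveI2[of _ _ K]) (use qK in \<open>fastforce simp: unit_sphere_def\<close>)
  define l where "l = Sup Q"
  have up: "q x \<le> l * (x \<bullet> x)" if x: "x \<in> carrier_vec n" for x
  proof (cases "x = 0\<^sub>v n")
    case True
    then have "B *\<^sub>v x = 0\<^sub>v n" using B by auto
    then show ?thesis using True by (simp add: q_def)
  next
    case False
    then have pos: "x \<bullet> x > 0" using scalar_prod_self_pos x by blast
    have "(1 / sqrt (x \<bullet> x)) \<cdot>\<^sub>v x \<in> unit_sphere n" using x pos by (auto simp: unit_sphere_def)
    then have "q ((1 / sqrt (x \<bullet> x)) \<cdot>\<^sub>v x) \<le> l"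
      unfolding l_def by (intro cSup_upper bdd) (auto simp: Q_def)
    then show ?thesis unfolding qs[OF x] using pos by (simp add: field_simps)
  qed
  have "\<exists>V. frame n 1 V \<and> l - 1 / real (Suc k) < q (V *\<^sub>v vec 1 (\<lambda>_. 1))" for k
  proof -
    have "l - 1 / real (Suc k) < l" by simp
    then obtain u where u: "u \<in> carrier_vec n" "u \<bullet> u = 1" "l - 1 / real (Suc k) < q u"
      using less_cSupD[OF ne] unfolding l_def Q_def unit_sphere_def by blast
    define V where "V = mat n 1 (\<lambda>(i, j). u $ i)"
    have V: "V \<in> carrier_mat n 1" by (simp add: V_def)
    have Vz: "V *\<^sub>v z = (z $ 0) \<cdot>\<^sub>v u" if "z \<in> carrier_vec 1" for z
      using that u by (intro eq_vecI) (auto simp: V_def scalar_prod_def)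
    have "frame n 1 V"
    proof (rule frameI_isometry[OF V])
      fix z :: "real vec" assume z: "z \<in> carrier_vec 1"
      show "(V *\<^sub>v z) \<bullet> (V *\<^sub>v z) = z \<bullet> z"
        unfolding Vz[OF z] using u z by (simp add: scalar_prod_def[of z])
    qed
    moreover have "V *\<^sub>v vec 1 (\<lambda>_. 1) = u" using Vz[of "vec 1 (\<lambda>_. 1)"] u by auto
    ultimately show ?thesis using u(3) by blast
  qed
  then obtain V where V: "\<And>k. frame n 1 (V k)" and Vl: "\<And>k. l - 1 / real (Suc k) < q (V k *\<^sub>v vec 1 (\<lambda>_. 1))" by metis
  obtain s U where s: "strict_mono s" and U: "frame n 1 U"
    and conv: "\<forall>i<n. \<forall>j<1. (\<lambda>k. V (s k) $$ (i, j)) \<longlonglongrightarrow> U $$ (i, j)"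
    by (rule frame_sequence_compact[where V = V, OF V])
  define e where "e = vec 1 (\<lambda>_. 1 :: real)"
  have e: "e \<in> carrier_vec 1" "e \<bullet> e = 1" by (auto simp: e_def scalar_prod_def)
  define x0 where "x0 = U *\<^sub>v e"
  have x0: "x0 \<in> carrier_vec n" "x0 \<bullet> x0 = 1"
    using frame_carrier[OF U] e frame_isometry[OF U e(1) e(1)] by (auto simp: x0_def)
  have qsum: "q x = (\<Sum>i<n. (\<Sum>j<n. B $$ (i, j) * x $ j)\<^sup>2)" if "x \<in> carrier_vec n" for x
    unfolding q_def scalar_prod_self_sum[OF Bx[OF that]] using B that
    by (simp add: scalar_prod_def atLeast0LessThan)
  have zc: "V (s k) *\<^sub>v e \<in> carrier_vec n" for k using frame_carrier[OF V[of "s k"]] e by auto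
  have "l \<le> q x0"
  proof (rule LIMSEQ_le)
    show "(\<lambda>k. q (V (s k) *\<^sub>v e)) \<longlonglongrightarrow> q x0"
      unfolding qsum[OF zc] qsum[OF x0(1)] unfolding x0_def
      by (intro tendsto_intros mult_mat_vec_tendsto[OF frame_carrier[OF V] frame_carrier[OF U] e(1) conv[rule_format]]) auto
    have "(\<lambda>k. 1 / real (Suc (s k))) \<longlonglongrightarrow> 0"
      using LIMSEQ_subseq_LIMSEQ[OF LIMSEQ_inverse_real_of_nat s] by (simp add: o_def inverse_eq_divide)
    then have "(\<lambda>k. l - 1 / real (Suc (s k))) \<longlonglongrightarrow> l - 0" by (intro tendsto_intros)
    then show "(\<lambda>k. l - 1 / real (Suc (s k))) \<longlonglongrightarrow> l" by simp
    show "\<exists>k0. \<forall>k\<ge>k0. l - 1 / real (Suc (s k)) \<le> q (V (s k) *\<^sub>v e)"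
      using Vl less_imp_le by (auto simp: e_def)
  qed
  then have qx0: "q x0 = l" using up[OF x0(1)] x0(2) by simp
  define z where "z = S *\<^sub>v x0 + (- l) \<cdot>\<^sub>v x0"
  have Sx: "S *\<^sub>v x0 \<in> carrier_vec n" using S x0 by auto
  have z: "z \<in> carrier_vec n" using Sx x0 by (simp add: z_def)
  have "z = 0\<^sub>v n"
  proof (rule ccontr)
    assume "z \<noteq> 0\<^sub>v n"
    then have zz: "z \<bullet> z > 0" using scalar_prod_self_pos z by blast
    define D where "D = l * (z \<bullet> z) - q z"
    have D: "D \<ge> 0" using up[OF z] by (simp add: D_def)
    have zS: "z \<bullet> (S *\<^sub>v x0) = (B *\<^sub>v z) \<bullet> (B *\<^sub>v x0)"
    proof -
      have "S *\<^sub>v x0 = B\<^sup>T *\<^sub>v (B *\<^sub>v x0)" unfolding S_def using B x0 by (simp add: assoc_mult_mat_vec[of _ n n _ n])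
      then show ?thesis using scalar_prod_transpose[of "B\<^sup>T" n n z "B *\<^sub>v x0"] B z Bx[OF x0(1)] by simp
    qed
    have zz_eq: "z \<bullet> z = (B *\<^sub>v z) \<bullet> (B *\<^sub>v x0) - l * (z \<bullet> x0)"
    proof -
      have "z \<bullet> z = z \<bullet> (S *\<^sub>v x0) + z \<bullet> ((- l) \<cdot>\<^sub>v x0)"
        by (subst (2) z_def) (rule scalar_prod_add_distrib[OF z Sx], use x0 in simp)
      then show ?thesis using zS z x0 by simp
    qed
    (* x0 maximizes q x - l * (x \<bullet> x), and z \<bullet> z is the first-order term of this function at x0 in
       the direction z, up to the factor 2. *)
    have parabola: "0 \<le> t\<^sup>2 * D - 2 * t * (z \<bullet> z)" for t
    proof -
      have "B *\<^sub>v (x0 + t \<cdot>\<^sub>v z) = B *\<^sub>v x0 + t \<cdot>\<^sub>v (B *\<^sub>v z)"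
        using B x0 z by (simp add: mult_add_distrib_mat_vec[of _ n n] mult_mat_vec[of _ n n])
      then have "q (x0 + t \<cdot>\<^sub>v z) = q x0 + 2 * t * ((B *\<^sub>v z) \<bullet> (B *\<^sub>v x0)) + t\<^sup>2 * q z"
        using scalar_prod_self_combination[OF Bx[OF x0(1)] Bx[OF z], of t] by (simp add: q_def)
      moreover have "q (x0 + t \<cdot>\<^sub>v z) \<le> l * (1 + 2 * t * (z \<bullet> x0) + t\<^sup>2 * (z \<bullet> z))"
        using up[of "x0 + t \<cdot>\<^sub>v z"] x0 z scalar_prod_self_combination[OF x0(1) z, of t] by simp
      moreover have "(B *\<^sub>v z) \<bullet> (B *\<^sub>v x0) = z \<bullet> z + l * (z \<bullet> x0)" using zz_eq by simp
      ultimately show ?thesis by (simp add: D_def qx0 algebra_simps)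
    qed
    define t where "t = (z \<bullet> z) / (D + 1)"
    have "0 \<le> t * (t * D) - 2 * t * (z \<bullet> z)" using parabola[of t] by (simp only: power2_eq_square mult.assoc)
    also have "t * D = z \<bullet> z - t" using D by (simp add: t_def field_simps)
    finally have "t * (z \<bullet> z) + t * t \<le> 0" by (simp add: algebra_simps)
    moreover have "t > 0" using zz D by (simp add: t_def)
    ultimately show False using zz by (smt (verit) mult_pos_pos)
  qed
  then have "S *\<^sub>v x0 = l \<cdot>\<^sub>v x0"
  proof -
    assume z0: "z = 0\<^sub>v n"
    have "S *\<^sub>v x0 = z + l \<cdot>\<^sub>v x0" unfolding z_def using S x0 by (intro eq_vecI) auto
    then show ?thesis using z0 x0 by simp
  qed
  moreover have "x0 \<noteq> 0\<^sub>v n" using x0 by auto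
  ultimately have "eigenvalue S l" using S x0 by (auto simp: eigenvalue_def eigenvector_def)
  then have "eigenvalue (map_mat complex_of_real S) (complex_of_real l)"
    by (rule of_real_hom.eigenvalue_hom[OF S])
  then have "cmod (complex_of_real l) \<in> cmod ` spectrum (map_mat complex_of_real S)"
    unfolding spectrum_def by (intro imageI CollectI)
  then have "cmod (complex_of_real l) \<le> spectral_radius (map_mat complex_of_real S)"
    by (intro spectral_radius_mem_max(2)[of _ n]) (use S n in auto)
  then have "l \<le> spectral_radius (map_mat complex_of_real S)" by simp
  then have "l * (x \<bullet> x) \<le> spectral_radius (map_mat complex_of_real S) * (x \<bullet> x)"
    by (intro mult_right_mono scalar_prod_self_nonneg)
  then show ?thesis using up[OF x] by (simp add: q_def S_def)
qed

text \<open>Cauchy-Schwarz applied to \<open>|B\<^sup>T x|\<^sup>2 = x \<bullet> B (B\<^sup>T x)\<close> bounds \<open>|B\<^sup>T x|\<close> by means of \<open>B\<close> alone.\<close>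
lemma transpose_norm_bound:
  fixes B :: "real mat"
  assumes B: "B \<in> carrier_mat n n" and \<rho>: "\<rho> \<ge> 0"
    and bound: "\<And>x. x \<in> carrier_vec n \<Longrightarrow> (B *\<^sub>v x) \<bullet> (B *\<^sub>v x) \<le> \<rho> * (x \<bullet> x)"
    and x: "x \<in> carrier_vec n"
  shows "(B\<^sup>T *\<^sub>v x) \<bullet> (B\<^sup>T *\<^sub>v x) \<le> \<rho> * (x \<bullet> x)"
proof -
  define y where "y = B\<^sup>T *\<^sub>v x"
  have y: "y \<in> carrier_vec n" using B x by (auto simp: y_def)
  have By: "B *\<^sub>v y \<in> carrier_vec n" using B y by auto
  have "y \<bullet> y = x \<bullet> (B *\<^sub>v y)" using scalar_prod_transpose[OF B x y] by (simp add: y_def)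
  then have "(y \<bullet> y)\<^sup>2 \<le> (x \<bullet> x) * ((B *\<^sub>v y) \<bullet> (B *\<^sub>v y))" using scalar_prod_Cauchy_Schwarz[OF x By] by simp
  also have "\<dots> \<le> (x \<bullet> x) * (\<rho> * (y \<bullet> y))" by (intro mult_left_mono bound y scalar_prod_self_nonneg)
  finally have "(y \<bullet> y) * (y \<bullet> y) \<le> (\<rho> * (x \<bullet> x)) * (y \<bullet> y)" by (simp add: power2_eq_square algebra_simps)
  then show ?thesis
    using \<rho> scalar_prod_self_nonneg[of y] scalar_prod_self_nonneg[of x]
    by (cases "y \<bullet> y = 0") (auto simp: y_def)
qed

section \<open>The lower bound for radii of sections\<close>

lemma mat_range_projection:
  assumes U: "frame n r U" and x: "x \<in> carrier_vec n"
  shows "(U * U\<^sup>T) *\<^sub>v x \<in> mat_range U"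
proof -
  have Uc: "U \<in> carrier_mat n r" using U by (rule frame_carrier)
  have "(U * U\<^sup>T) *\<^sub>v x = U *\<^sub>v (U\<^sup>T *\<^sub>v x)" using Uc x by (simp add: assoc_mult_mat_vec[of _ n r _ n])
  then show ?thesis
    using Uc x unfolding mat_range_def
    by (intro CollectI exI[of _ "U\<^sup>T *\<^sub>v x"]) auto
qed

context haar_orthonormal_system
begin

lemma sphere_mean_J_norm: "sphere_mean \<mu> (J_norm M \<phi> p) = S.mean (J_norm M \<phi> p) (1\<^sub>m n)"
  unfolding sphere_mean_def S.mean_def
  by (intro Bochner_Integration.integral_cong refl) (simp add: S.in_space_haar)

lemma sphere_mean_J_norm_ge_1:
  assumes "p \<ge> 2"
  shows "1 \<le> sphere_mean \<mu> (J_norm M \<phi> p)"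
proof -
  have "(\<integral>\<alpha>. 1 \<partial>\<mu>) \<le> S.mean (J_norm M \<phi> p) (1\<^sub>m n)"
    unfolding S.mean_def
  proof (rule integral_mono)
    show "integrable \<mu> (\<lambda>\<alpha>. J_norm M \<phi> p (1\<^sub>m n *\<^sub>v \<alpha>))"
      using assms by (intro S.integrable_seminorm J_norm_measurable_seminorm) auto
    show "1 \<le> J_norm M \<phi> p (1\<^sub>m n *\<^sub>v \<alpha>)" if "\<alpha> \<in> space \<mu>" for \<alpha>
      using that Euclidean_norm_le_J_norm[OF assms, of \<alpha> n] by (simp add: S.in_space_haar)
  qed simp
  then show ?thesis by (simp add: sphere_mean_J_norm S.prob_space)
qed

text \<open>The inequality between the means over the sphere holds at some point of it, and the projection of
  that point is the vector sought. Strictness makes this vector nonzero.\<close>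
lemma section_ratio_ge:
  assumes p: "p \<ge> 2" and B: "B \<in> carrier_mat n n" "R \<in> carrier_mat n n" "B * R = 1\<^sub>m n" and \<rho>: "\<rho> > 0"
    and bound: "\<And>x. x \<in> carrier_vec n \<Longrightarrow> (B\<^sup>T *\<^sub>v x) \<bullet> (B\<^sup>T *\<^sub>v x) \<le> \<rho> * (x \<bullet> x)"
    and U: "frame n r U" and r: "2 / 3 * real n \<le> real r"
    and W: "frame n m W" and m: "2 / 3 * real n \<le> real m"
    and K: "K > 0" "\<And>k. k < m \<Longrightarrow> AE x in M. \<bar>J \<phi> (col W k) x\<bar> \<le> K"
  obtains x where "x \<in> mat_range U"
    "1 / (27 * K) / (sqrt \<rho> * sphere_mean \<mu> (J_norm M \<phi> p)) * J_norm M \<phi> p (B *\<^sub>v x) < J_norm M \<phi> 1 x"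
proof -
  define E where "E = sphere_mean \<mu> (J_norm M \<phi> p)"
  define l where "l = 1 / (27 * K) / (sqrt \<rho> * E)"
  define P where "P = U * U\<^sup>T"
  have E: "E \<ge> 1" unfolding E_def by (rule sphere_mean_J_norm_ge_1[OF p])
  have l: "l > 0" using K(1) \<rho> E by (simp add: l_def)
  have P: "P \<in> carrier_mat n n" using frame_carrier[OF U] by (simp add: P_def)
  have BP: "B * P \<in> carrier_mat n n" using B P by simp
  have Np: "S.measurable_seminorm (J_norm M \<phi> p)" using p by (intro J_norm_measurable_seminorm) simp
  have N1: "S.measurable_seminorm (J_norm M \<phi> 1)" by (intro J_norm_measurable_seminorm) simp
  have "S.mean (J_norm M \<phi> p) (B * P) \<le> S.mean (J_norm M \<phi> p) B"
    unfolding P_def by (rule S.mean_mult_projection_le[OF Np B(1) U])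
  also have "\<dots> \<le> sqrt \<rho> * E"
    unfolding E_def sphere_mean_J_norm by (rule S.mean_le_operator_norm[OF Np B \<rho> bound])
  finally have "l * S.mean (J_norm M \<phi> p) (B * P) \<le> l * (sqrt \<rho> * E)" using l by (intro mult_left_mono) auto
  also have "\<dots> = 1 / (27 * K)" using \<rho> E by (simp add: l_def)
  (* The lower bound for the other mean is (2/9) * (1/3) / K; giving away a factor 2 makes the
     comparison strict. *)
  also have "\<dots> < 2 / (27 * K)" using K(1) by (simp add: field_simps)
  also have "\<dots> = 2 / (9 * K * real n) * (real n / 3)" using S.dim_pos by simp
  also have "\<dots> \<le> 2 / (9 * K * real n) * (real r + real m - real n)"
    using r m K(1) by (intro mult_left_mono) auto
  also have "\<dots> \<le> S.mean (J_norm M \<phi> 1) P"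
    unfolding P_def by (rule mean_J_norm_1_projection_ge[OF U W K])
  finally have lt: "l * S.mean (J_norm M \<phi> p) (B * P) < S.mean (J_norm M \<phi> 1) P" .
  have "\<exists>\<alpha>\<in>space \<mu>. l * J_norm M \<phi> p (B * P *\<^sub>v \<alpha>) < J_norm M \<phi> 1 (P *\<^sub>v \<alpha>)"
  proof (rule ccontr)
    assume "\<not> ?thesis"
    then have "S.mean (J_norm M \<phi> 1) P \<le> (\<integral>\<alpha>. l * J_norm M \<phi> p (B * P *\<^sub>v \<alpha>) \<partial>\<mu>)"
      unfolding S.mean_def using S.integrable_seminorm[OF N1 P] S.integrable_seminorm[OF Np BP]
      by (intro integral_mono) (auto simp: not_less)
    then show False using lt by (simp add: S.mean_def)
  qed
  then obtain \<alpha> where a: "\<alpha> \<in> carrier_vec n" "l * J_norm M \<phi> p (B * P *\<^sub>v \<alpha>) < J_norm M \<phi> 1 (P *\<^sub>v \<alpha>)"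
    by (auto simp: S.in_space_haar)
  have "B * P *\<^sub>v \<alpha> = B *\<^sub>v (P *\<^sub>v \<alpha>)" using B P a by (simp add: assoc_mult_mat_vec[of _ n n _ n])
  then show ?thesis
    using that[OF mat_range_projection[OF U a(1)]] a(2) by (simp add: l_def E_def P_def)
qed

end

lemma image_unit_ball_eq:
  assumes A: "A \<in> carrier_mat n n" and B: "B \<in> carrier_mat n n" "A * B = 1\<^sub>m n" "B * A = 1\<^sub>m n"
  shows "mult_mat_vec A ` J_ball M \<phi> n p = {\<alpha> \<in> carrier_vec n. J_norm M \<phi> p (B *\<^sub>v \<alpha>) \<le> 1}"
proof
  have BA: "B *\<^sub>v (A *\<^sub>v x) = x" if "x \<in> carrier_vec n" for x
    using that assms assoc_mult_mat_vec[OF B(1) A that] by simp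
  have AB: "A *\<^sub>v (B *\<^sub>v x) = x" if "x \<in> carrier_vec n" for x
    using that assms assoc_mult_mat_vec[OF A B(1) that] by simp
  show "mult_mat_vec A ` J_ball M \<phi> n p \<subseteq> {\<alpha> \<in> carrier_vec n. J_norm M \<phi> p (B *\<^sub>v \<alpha>) \<le> 1}"
    using A BA by (auto simp: J_ball_def)
  show "{\<alpha> \<in> carrier_vec n. J_norm M \<phi> p (B *\<^sub>v \<alpha>) \<le> 1} \<subseteq> mult_mat_vec A ` J_ball M \<phi> n p"
  proof
    fix \<alpha> assume a: "\<alpha> \<in> {\<alpha> \<in> carrier_vec n. J_norm M \<phi> p (B *\<^sub>v \<alpha>) \<le> 1}"
    then have "\<alpha> = A *\<^sub>v (B *\<^sub>v \<alpha>)" "B *\<^sub>v \<alpha> \<in> J_ball M \<phi> n p" using AB B by (auto simp: J_ball_def)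
    then show "\<alpha> \<in> mult_mat_vec A ` J_ball M \<phi> n p" by blast
  qed
qed

theorem theorem1:
  fixes M :: "'a measure" and \<phi> :: "nat \<Rightarrow> 'a \<Rightarrow> real"
  assumes "prob_space M"
    and "\<And>k. \<phi> k \<in> Linf M"
    and "orthonormal_on M UNIV \<phi>"
    and "essentially_bounded M \<phi>"
  shows "\<exists>C::real. C > 0 \<and>
    (\<forall>n::nat. n \<ge> 1 \<longrightarrow>
     (\<forall>\<mu>. sphere_haar n \<mu> \<longrightarrow>
      (\<forall>A \<in> carrier_mat n n. Determinant.det A \<noteq> 0 \<longrightarrow>
       (\<forall>r::nat. 2 / 3 * real n \<le> real r \<and> r \<le> n \<longrightarrow>
        (\<forall>p::real. 2 \<le> p \<longrightarrow>
          (\<exists>L. is_arg_min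
                 (\<lambda>L. rad (mult_mat_vec A ` J_ball M \<phi> n p \<inter> L) (J_norm M \<phi> 1))
                 (\<lambda>L. L \<in> grassmannian r n) L
             \<and> rad (mult_mat_vec A ` J_ball M \<phi> n p \<inter> L) (J_norm M \<phi> 1)
                 \<ge> C * varrho A * sphere_mean \<mu> (J_norm M \<phi> p) powr (- 3 / 2)))))))"
proof -
  interpret bounded_orthonormal_system M \<phi>
    using assms(1-3) by (simp add: bounded_orthonormal_system_def bounded_orthonormal_system_axioms_def)
  obtain K where K: "K > 0"
    and frames: "\<And>n. n \<ge> 1 \<Longrightarrow> \<exists>m W. 2 / 3 * real n \<le> real m \<and> frame n m W \<and> (\<forall>k<m. AE x in M. \<bar>J \<phi> (col W k) x\<bar> \<le> K)"
    using essentially_bounded_frame[OF assms(4), of "2 / 3"] by auto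
  show ?thesis
  proof (intro exI[of _ "1 / (27 * K)"] conjI allI ballI impI)
    show "0 < 1 / (27 * K)" using K by simp
    fix n :: nat and \<mu> :: "real vec measure" and A :: "real mat" and r :: nat and p :: real
    assume n: "1 \<le> n" and haar: "sphere_haar n \<mu>" and A: "A \<in> carrier_mat n n"
      and det: "Determinant.det A \<noteq> 0" and r: "2 / 3 * real n \<le> real r \<and> r \<le> n" and p: "2 \<le> p"
    interpret H: haar_orthonormal_system n \<mu> M \<phi>
      by unfold_locales (use n haar in auto)
    define B where "B = the (mat_inverse A)"
    have "mat_inverse A \<noteq> None"
      using mat_inverse(1)[OF A, of undefined] det_non_zero_imp_unit[OF A det, of undefined] by blast
    then have "mat_inverse A = Some B" by (auto simp: B_def)
    then have AB: "A * B = 1\<^sub>m n" and BA: "B * A = 1\<^sub>m n" and B: "B \<in> carrier_mat n n"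
      using mat_inverse(2)[OF A] by auto
    define \<rho> where "\<rho> = spectral_radius (map_mat complex_of_real (B\<^sup>T * B))"
    have normB: "(B *\<^sub>v x) \<bullet> (B *\<^sub>v x) \<le> \<rho> * (x \<bullet> x)" if "x \<in> carrier_vec n" for x
      unfolding \<rho>_def by (rule spectral_radius_bounds_norm[OF B n that])
    have \<rho>: "\<rho> > 0"
    proof -
      define e where "e = A *\<^sub>v unit_vec n 0"
      have e: "e \<in> carrier_vec n" using A by (auto simp: e_def)
      have "B *\<^sub>v e = unit_vec n 0" unfolding e_def using assoc_mult_mat_vec[OF B A, of "unit_vec n 0"] BA by simp
      then have "1 \<le> \<rho> * (e \<bullet> e)" using normB[OF e] n by simp
      then show ?thesis using scalar_prod_self_nonneg[of e] by (smt (verit) mult_nonpos_nonneg)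
    qed
    have normBt: "(B\<^sup>T *\<^sub>v x) \<bullet> (B\<^sup>T *\<^sub>v x) \<le> \<rho> * (x \<bullet> x)" if "x \<in> carrier_vec n" for x
      by (rule transpose_norm_bound[OF B _ normB that]) (use \<rho> in simp)
    have varrho: "varrho A = 1 / sqrt \<rho>"
      using \<rho> by (simp add: varrho_def Let_def B_def[symmetric] \<rho>_def[symmetric] powr_minus powr_half_sqrt inverse_eq_divide)
    define E where "E = sphere_mean \<mu> (J_norm M \<phi> p)"
    have E: "E \<ge> 1" unfolding E_def by (rule H.sphere_mean_J_norm_ge_1[OF p])
    define C where "C = 1 / (27 * K)"
    define lam where "lam = C / (sqrt \<rho> * E)"
    (* The distance of x from 0 is recovered from B x by applying A, and A is bounded. *)
    (* Since x = A (B x), the norm of B x controls the length of x up to the operator norm of A. *)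
    obtain c where c: "c > 0" and coercive: "\<And>x. x \<in> carrier_vec n \<Longrightarrow> c * sqrt (x \<bullet> x) \<le> J_norm M \<phi> p (B *\<^sub>v x)"
    proof -
      define \<sigma> where "\<sigma> = max 1 (spectral_radius (map_mat complex_of_real (A\<^sup>T * A)))"
      have \<sigma>: "\<sigma> > 0" by (simp add: \<sigma>_def)
      have "1 / sqrt \<sigma> * sqrt (x \<bullet> x) \<le> J_norm M \<phi> p (B *\<^sub>v x)" if x: "x \<in> carrier_vec n" for x
      proof -
        have Bx: "B *\<^sub>v x \<in> carrier_vec n" using B x by auto
        have "A *\<^sub>v (B *\<^sub>v x) = x" using assoc_mult_mat_vec[OF A B x] AB x by simp
        then have "x \<bullet> x \<le> spectral_radius (map_mat complex_of_real (A\<^sup>T * A)) * ((B *\<^sub>v x) \<bullet> (B *\<^sub>v x))"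
          using spectral_radius_bounds_norm[OF A n Bx] by simp
        also have "\<dots> \<le> \<sigma> * ((B *\<^sub>v x) \<bullet> (B *\<^sub>v x))"
          by (intro mult_right_mono scalar_prod_self_nonneg) (simp add: \<sigma>_def)
        finally have "sqrt (x \<bullet> x) \<le> sqrt \<sigma> * sqrt ((B *\<^sub>v x) \<bullet> (B *\<^sub>v x))" by (simp add: real_sqrt_mult[symmetric])
        also have "\<dots> \<le> sqrt \<sigma> * J_norm M \<phi> p (B *\<^sub>v x)"
          using Euclidean_norm_le_J_norm[OF p Bx] \<sigma> by (intro mult_left_mono) auto
        finally show ?thesis using \<sigma> by (simp add: field_simps)
      qed
      then show ?thesis using that[of "1 / sqrt \<sigma>"] \<sigma> by simp
    qed
    interpret SP: seminorm_pair n "J_norm M \<phi> 1" "\<lambda>x. J_norm M \<phi> p (B *\<^sub>v x)" c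
    proof
      show "seminorm_on n (\<lambda>x. J_norm M \<phi> p (B *\<^sub>v x))"
        using p by (intro seminorm_mult_mat[OF J_norm_seminorm B]) simp
    qed (use J_norm_seminorm c coercive in auto)
    have rad: "rad (mult_mat_vec A ` J_ball M \<phi> n p \<inter> L) (J_norm M \<phi> 1) = SP.section_rad L" for L
      by (simp add: SP.section_rad_def image_unit_ball_eq[OF A B AB BA])
    obtain m W where m: "2 / 3 * real n \<le> real m" and W: "frame n m W"
      and bd: "\<And>k. k < m \<Longrightarrow> AE x in M. \<bar>J \<phi> (col W k) x\<bar> \<le> K" using frames[OF n] by blast
    have lower: "lam \<le> SP.section_rad L" if L: "L \<in> grassmannian r n" for L
    proof -
      obtain U where U: "frame n r U" "L = mat_range U" using L by (rule grassmannianE)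
      obtain x where x: "x \<in> mat_range U" "lam * J_norm M \<phi> p (B *\<^sub>v x) < J_norm M \<phi> 1 x"
        using H.section_ratio_ge[OF p B A BA \<rho> normBt U(1) _ W m K bd] r
        unfolding lam_def C_def E_def by blast
      have xc: "x \<in> carrier_vec n" using x(1) frame_carrier[OF U(1)] by (auto simp: mat_range_def)
      have "lam * J_norm M \<phi> p (B *\<^sub>v x) < SP.section_rad L * J_norm M \<phi> p (B *\<^sub>v x)"
        using x(2) SP.section_rad_upper[OF frame_carrier[OF U(1)] x(1)] by (simp add: U(2))
      then show ?thesis using seminorm_nonneg[OF SP.G xc] by (simp add: mult_less_cancel_right)
    qed
    have "C * varrho A * E powr (- 3 / 2) \<le> C * varrho A * E powr (- 1)"
      using E K \<rho> by (intro mult_left_mono powr_mono) (auto simp: C_def varrho)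
    also have "\<dots> = lam" using E by (simp add: lam_def varrho powr_minus field_simps)
    finally have bound: "C * varrho A * E powr (- 3 / 2) \<le> lam" .
    obtain L where L: "is_arg_min SP.section_rad (\<lambda>L. L \<in> grassmannian r n) L"
      using SP.section_rad_attains_minimum r by blast
    then have "C * varrho A * E powr (- 3 / 2) \<le> SP.section_rad L"
      using lower bound by (force simp: is_arg_min_def)
    then show "\<exists>L. is_arg_min
                 (\<lambda>L. rad (mult_mat_vec A ` J_ball M \<phi> n p \<inter> L) (J_norm M \<phi> 1))
                 (\<lambda>L. L \<in> grassmannian r n) L
             \<and> rad (mult_mat_vec A ` J_ball M \<phi> n p \<inter> L) (J_norm M \<phi> 1)
                 \<ge> 1 / (27 * K) * varrho A * sphere_mean \<mu> (J_norm M \<phi> p) powr (- 3 / 2)"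
      unfolding rad using L by (auto simp: C_def E_def)
  qed
qed

end
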